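(* Let $r>0$ and let $X:S^n(r)\to\mathbb{R}^{n+1}$ be the $n$-dimensional round sphere of radius $r$ centered at the origin. If $r\le\frac{-1+\sqrt{1+4n}}{2}$ or $r\ge\frac{1+\sqrt{1+4n}}{2}$, then $X:S^n(r)\to\mathbb{R}^{n+1}$ is weakly stable. If $\frac{-1+\sqrt{1+4n}}{2}<r<\frac{1+\sqrt{1+4n}}{2}$, then $X:S^n(r)\to\mathbb{R}^{n+1}$ is weakly unstable.
   Context: For an immersed hypersurface $X:M\to\mathbb{R}^{n+1}$ with unit normal $N$ and area element $d\mu$, consider (compactly supported) normal variations $X(s)$ with $X(0)=X$, $\frac{\partial X(s)}{\partial s}=f(s)N(s)$, where $N(s)$ is the unit normal of $X(s)$ and $d\mu_s$ its area element. With fixed $X_0=0$ and $t_0=1$, put $\mathcal{T}(s)=(4\pi)^{-\frac n2}\int_M e^{-\frac{|X(s)|^2}{2}}d\mu_s$. The variation is weighted volume-preserving if $V(s)=\int_M\langle X(s),N\rangle e^{-\frac{|X|^2}{2}}d\mu$ (with $N,d\mu$ those of $X=X(0)$) satisfies $V(s)=V(0)$ for all $s$. A critical point of $\mathcal{T}$ for weighted volume-preserving variations (such as every sphere $S^n(r)$ centered at the origin) is called weakly stable if $\mathcal{T}''(0)\ge0$ for every weighted volume-preserving normal variation, and weakly unstable if there exists a weighted volume-preserving normal variation with $\mathcal{T}''(0)<0$. *)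

theory Defs
  imports "HOL-Analysis.Analysis"
begin

text \<open>
  Throughout, \<open>n = CARD('n)\<close>, and \<open>\<real>\<close> to the power \<open>n + 1\<close> is rendered as the Euclidean
  space \<open>real ^ 'n \<times> real\<close>, whose library norm and inner product are the Euclidean ones.
  The parameter manifold is \<open>M = sphere 0 r\<close>, the round sphere of dimension \<open>n\<close> and radius \<open>r\<close>.
  Maps on \<open>M\<close> are total functions of which only the restriction to \<open>M\<close> matters.
\<close>

type_synonym 'n space = "(real ^ 'n) \<times> real"

subsection \<open>Smooth maps\<close>

primrec C_on :: "nat \<Rightarrow> 'a::euclidean_space set \<Rightarrow> ('a \<Rightarrow> 'b::real_normed_vector) \<Rightarrow> bool" where
  "C_on 0 U f \<longleftrightarrow> continuous_on U f"
| "C_on (Suc k) U f \<longleftrightarrow>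
     (\<forall>x\<in>U. f differentiable at x) \<and> (\<forall>v. C_on k U (\<lambda>x. frechet_derivative f (at x) v))"

text \<open>Smoothness on a set that need not be open (such as an interval times a sphere) means
  having, locally, smooth extensions to open sets.\<close>

definition smooth_on :: "'a::euclidean_space set \<Rightarrow> ('a \<Rightarrow> 'b::real_normed_vector) \<Rightarrow> bool" where
  "smooth_on S f \<longleftrightarrow>
     (\<forall>x\<in>S. \<exists>U g. open U \<and> x \<in> U \<and> (\<forall>k. C_on k U g) \<and> (\<forall>y\<in>U \<inter> S. g y = f y))"

subsection \<open>Immersions of the sphere\<close>

definition tangent_space :: "'n::finite space \<Rightarrow> 'n space set" where
  "tangent_space p = {v. v \<bullet> p = 0}"

text \<open>The Frechet derivative within the sphere is a choice among linear maps that differ in the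
  radial direction; on tangent vectors it is determined. It is only applied to tangent vectors.\<close>

definition differential ::
    "real \<Rightarrow> ('n::finite space \<Rightarrow> 'n space) \<Rightarrow> 'n space \<Rightarrow> 'n space \<Rightarrow> 'n space" where
  "differential r X p = frechet_derivative X (at p within sphere 0 r)"

definition immersion :: "real \<Rightarrow> ('n::finite space \<Rightarrow> 'n space) \<Rightarrow> bool" where
  "immersion r X \<longleftrightarrow> smooth_on (sphere 0 r) X \<and>
     (\<forall>p\<in>sphere 0 r. inj_on (differential r X p) (tangent_space p))"

definition unit_normal ::
    "real \<Rightarrow> ('n::finite space \<Rightarrow> 'n space) \<Rightarrow> ('n space \<Rightarrow> 'n space) \<Rightarrow> bool" where
  "unit_normal r X N \<longleftrightarrow> continuous_on (sphere 0 r) N \<and>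
     (\<forall>p\<in>sphere 0 r. norm (N p) = 1 \<and> (\<forall>v\<in>tangent_space p. N p \<bullet> differential r X p v = 0))"

subsection \<open>Area element\<close>

text \<open>For \<open>\<sigma> = 1\<close> and \<open>\<sigma> = -1\<close>, central projection from the hyperplane at height \<open>\<sigma>\<close>
  parametrizes an open hemisphere by the whole of \<open>real ^ 'n\<close>; together the two charts cover the
  sphere up to the equator, a null set.\<close>

definition hemisphere_chart :: "real \<Rightarrow> real \<Rightarrow> real ^ 'n::finite \<Rightarrow> 'n space" where
  "hemisphere_chart r \<sigma> w = (\<sigma> * r / sqrt (1 + (norm w)\<^sup>2)) *\<^sub>R (w, 1)"

text \<open>The metric induced by \<open>X\<close>, in the coordinates of the parametrization \<open>\<phi>\<close>.\<close>

definition induced_metric ::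
    "('n::finite space \<Rightarrow> 'n space) \<Rightarrow> (real ^ 'n \<Rightarrow> 'n space) \<Rightarrow> real ^ 'n \<Rightarrow> real ^ 'n ^ 'n" where
  "induced_metric X \<phi> w = (\<chi> i j.
     frechet_derivative (X \<circ> \<phi>) (at w) (axis i 1) \<bullet> frechet_derivative (X \<circ> \<phi>) (at w) (axis j 1))"

text \<open>The integral of \<open>h\<close> over \<open>M\<close> against the area element of \<open>X\<close>, which in coordinates is
  the square root of the determinant of the induced metric times Lebesgue measure.\<close>

definition area_integral ::
    "real \<Rightarrow> ('n::finite space \<Rightarrow> 'n space) \<Rightarrow> ('n space \<Rightarrow> real) \<Rightarrow> real" where
  "area_integral r X h = (\<Sum>\<sigma>\<in>{1, -1}. LINT w|lborel.
     h (hemisphere_chart r \<sigma> w) * sqrt (det (induced_metric X (hemisphere_chart r \<sigma>) w)))"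

subsection \<open>Normal variations\<close>

text \<open>The parameter \<open>s\<close> ranges over \<open>(-\<epsilon>, \<epsilon>)\<close>. Compact support is automatic on the sphere.
  Joint continuity makes \<open>N s\<close> the unit normals of one orientation; the smoothness of \<open>N\<close> and \<open>f\<close>
  follows from that of \<open>X\<close>.\<close>

definition normal_variation ::
    "real \<Rightarrow> ('n::finite space \<Rightarrow> 'n space) \<Rightarrow> real \<Rightarrow> (real \<Rightarrow> 'n space \<Rightarrow> 'n space)
      \<Rightarrow> (real \<Rightarrow> 'n space \<Rightarrow> 'n space) \<Rightarrow> (real \<Rightarrow> 'n space \<Rightarrow> real) \<Rightarrow> bool" where
  "normal_variation r X0 \<epsilon> X N f \<longleftrightarrow>
     0 < \<epsilon> \<and>
     smooth_on ({-\<epsilon><..<\<epsilon>} \<times> sphere 0 r) (\<lambda>(s, p). X s p) \<and>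
     continuous_on ({-\<epsilon><..<\<epsilon>} \<times> sphere 0 r) (\<lambda>(s, p). N s p) \<and>
     (\<forall>s\<in>{-\<epsilon><..<\<epsilon>}. immersion r (X s) \<and> unit_normal r (X s) (N s)) \<and>
     (\<forall>p\<in>sphere 0 r. X 0 p = X0 p) \<and>
     (\<forall>s\<in>{-\<epsilon><..<\<epsilon>}. \<forall>p\<in>sphere 0 r.
        ((\<lambda>s. X s p) has_vector_derivative f s p *\<^sub>R N s p) (at s))"

definition weighted_area :: "real \<Rightarrow> (real \<Rightarrow> 'n::finite space \<Rightarrow> 'n space) \<Rightarrow> real \<Rightarrow> real" where
  "weighted_area r X s = (4 * pi) powr (- real CARD('n) / 2) *
     area_integral r (X s) (\<lambda>p. exp (- (norm (X s p))\<^sup>2 / 2))"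

definition weighted_volume ::
    "real \<Rightarrow> (real \<Rightarrow> 'n::finite space \<Rightarrow> 'n space) \<Rightarrow> (real \<Rightarrow> 'n space \<Rightarrow> 'n space)
      \<Rightarrow> real \<Rightarrow> real" where
  "weighted_volume r X N s =
     area_integral r (X 0) (\<lambda>p. (X s p \<bullet> N 0 p) * exp (- (norm (X 0 p))\<^sup>2 / 2))"

definition volume_preserving_variation ::
    "real \<Rightarrow> ('n::finite space \<Rightarrow> 'n space) \<Rightarrow> (real \<Rightarrow> 'n space \<Rightarrow> 'n space) \<Rightarrow> bool" where
  "volume_preserving_variation r X0 X \<longleftrightarrow>
     (\<exists>\<epsilon> N f. normal_variation r X0 \<epsilon> X N f \<and>
        (\<forall>s\<in>{-\<epsilon><..<\<epsilon>}. weighted_volume r X N s = weighted_volume r X N 0))"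

subsection \<open>Weak stability\<close>

definition critical_point :: "real \<Rightarrow> ('n::finite space \<Rightarrow> 'n space) \<Rightarrow> bool" where
  "critical_point r X0 \<longleftrightarrow>
     (\<forall>X. volume_preserving_variation r X0 X \<longrightarrow> deriv (weighted_area r X) 0 = 0)"

definition weakly_stable :: "real \<Rightarrow> ('n::finite space \<Rightarrow> 'n space) \<Rightarrow> bool" where
  "weakly_stable r X0 \<longleftrightarrow> critical_point r X0 \<and>
     (\<forall>X. volume_preserving_variation r X0 X \<longrightarrow> deriv (deriv (weighted_area r X)) 0 \<ge> 0)"

definition weakly_unstable :: "real \<Rightarrow> ('n::finite space \<Rightarrow> 'n space) \<Rightarrow> bool" where
  "weakly_unstable r X0 \<longleftrightarrow> critical_point r X0 \<and>
     (\<exists>X. volume_preserving_variation r X0 X \<and> deriv (deriv (weighted_area r X)) 0 < 0)"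

end

theory Submission
  imports Defs "HOL-Probability.Distributions"
begin

text \<open>
  Let \<open>X s\<close> be a normal variation of the sphere of radius \<open>r\<close> in Euclidean \<open>(n + 1)\<close>-space and
  let \<open>u\<close> be its initial speed, regarded as a function on the unit sphere. The area element of
  \<open>X s\<close>, relative to that of the unit sphere, is the square root of the determinant of the Gram
  matrix of the images of an orthonormal frame. Multiplied by the Gaussian weight, its first derivative at \<open>0\<close> is a constant times \<open>(n / r - r) u\<close>, and its second derivative
  is a constant times the sum of
  \<open>|grad u|^2 / r^2 + ((n / r - r)^2 - 1 - n / r^2) u^2\<close> and two terms that are linear in the
  acceleration \<open>A\<close> of the variation, namely \<open>div A / r\<close> and \<open>- r (A \<bullet> \<omega>)\<close>.

  The weighted volume is linear in \<open>X s\<close>: it is a constant times the integral of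
  \<open>X s \<bullet> \<omega>\<close> over the unit sphere. If it does not change with \<open>s\<close>, then both \<open>u\<close> and
  \<open>A \<bullet> \<omega>\<close> have mean zero (\<open>volume_constraint\<close>). By the divergence theorem (\<open>sphere_divergence\<close>)
  \<open>div A\<close> has mean zero as well, so the first derivative of the weighted area vanishes and the
  second derivative is a positive multiple of the integral of
  \<open>|grad u|^2 / r^2 + ((n / r - r)^2 - 1 - n / r^2) u^2\<close> (\<open>second_variation\<close>).

  The first nonzero eigenvalue of the Laplacian on the unit sphere is \<open>n\<close>: the integral of \<open>|grad u|^2\<close> is at least \<open>n\<close>
  times that of \<open>u^2\<close> (\<open>sphere_poincare\<close>), with equality for linear functions. Hence the second
  derivative is at least a positive multiple of \<open>((n / r - r)^2 - 1)\<close> times the integral of \<open>u^2\<close>,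
  and it equals this bound for linear \<open>u\<close>. The sphere is thus weakly stable precisely if
  \<open>|n / r - r| \<ge> 1\<close>, that is, if \<open>r^2 + r \<le> n\<close> or \<open>r^2 - r \<ge> n\<close>, which are the two ranges of
  \<open>r\<close> in the theorem (\<open>threshold_iff\<close>).

  For instability there must be a volume-preserving variation, normal at all times, whose initial
  speed is linear. Translated and rescaled spheres provide it. The points of a translated sphere do
  not move in the normal direction, but this is corrected by reparametrizing the sphere by a
  one-parameter group of conformal maps, and the radius is chosen so that the volume stays constant
  (\<open>unstable_variation_exists\<close>).

  The Poincare inequality on the sphere is obtained from the Gaussian one (\<open>gaussian_poincare\<close>),
  applied to the extension of \<open>u\<close> that is homogeneous of degree one. The Gaussian inequality in
  turn follows from Wirtinger's inequality on the circles along which a pair of independent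
  Gaussian vectors is rotated.

  Functions and vector fields on the unit sphere are represented by their extensions to the
  punctured space that are constant on rays. Their ambient derivatives have no radial part, so
  that gradients and divergences on the sphere are those of the ambient space.
\<close>

section \<open>Calculus of the classes of differentiability\<close>

abbreviation dir_deriv ::
    "'a::euclidean_space \<Rightarrow> ('a \<Rightarrow> 'b::real_normed_vector) \<Rightarrow> 'a \<Rightarrow> 'b" where
  "dir_deriv v f x \<equiv> frechet_derivative f (at x) v"

lemma has_derivative_cong_open:
  assumes "open U" "x \<in> U" "\<And>y. y \<in> U \<Longrightarrow> f y = g y"
  shows "(f has_derivative D) (at x) \<longleftrightarrow> (g has_derivative D) (at x)"
  using assms has_derivative_transform_within_open[of f D x UNIV U g]
    has_derivative_transform_within_open[of g D x UNIV U f] by auto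

lemma frechet_derivative_cong_open:
  assumes "open U" "x \<in> U" "\<And>y. y \<in> U \<Longrightarrow> f y = g y"
  shows "frechet_derivative f (at x) = frechet_derivative g (at x)"
  unfolding frechet_derivative_def using has_derivative_cong_open[OF assms] by simp

lemma C_on_cong:
  assumes "open U" "\<And>y. y \<in> U \<Longrightarrow> f y = g y"
  shows "C_on k U f \<longleftrightarrow> C_on k U g"
  using assms
proof (induction k arbitrary: f g)
  case 0
  then show ?case by (simp cong: continuous_on_cong)
next
  case (Suc k)
  have "f differentiable at x \<longleftrightarrow> g differentiable at x" if "x \<in> U" for x
    unfolding differentiable_def using has_derivative_cong_open[OF Suc.prems(1) that Suc.prems(2)] by simp
  moreover have "C_on k U (\<lambda>x. dir_deriv v f x) \<longleftrightarrow> C_on k U (\<lambda>x. dir_deriv v g x)" for v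
    by (rule Suc.IH[OF Suc.prems(1)])
      (use frechet_derivative_cong_open[OF Suc.prems(1) _ Suc.prems(2)] in simp)
  ultimately show ?case by simp
qed

lemma C_on_subset: "C_on k U f \<Longrightarrow> V \<subseteq> U \<Longrightarrow> C_on k V f"
  by (induction k arbitrary: f) (auto intro: continuous_on_subset)

lemma C_on_locally:
  assumes "\<And>x. x \<in> U \<Longrightarrow> \<exists>V. open V \<and> x \<in> V \<and> C_on k V f"
  shows "C_on k U f"
  using assms
proof (induction k arbitrary: f)
  case 0
  have "isCont f x" if "x \<in> U" for x
    using 0[OF that] by (auto simp: continuous_on_eq_continuous_at)
  then show ?case by (simp add: continuous_at_imp_continuous_on)
next
  case (Suc k)
  have "f differentiable at x" if "x \<in> U" for x
    using Suc.prems[OF that] by auto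
  moreover have "C_on k U (\<lambda>x. dir_deriv v f x)" for v
    by (rule Suc.IH) (use Suc.prems in fastforce)
  ultimately show ?case by simp
qed

lemma C_on_imp_differentiable:
  "C_on (Suc k) U f \<Longrightarrow> x \<in> U \<Longrightarrow> (f has_derivative (\<lambda>v. dir_deriv v f x)) (at x)"
  by (metis C_on.simps(2) frechet_derivative_works)

lemma C_on_imp_continuous_on: "C_on k U f \<Longrightarrow> continuous_on U f"
  by (cases k) (auto intro!: continuous_at_imp_continuous_on differentiable_imp_continuous_within)

lemma C_on_SucD: "C_on (Suc k) U f \<Longrightarrow> C_on k U f"
proof (induction k arbitrary: f)
  case 0
  then show ?case using C_on_imp_continuous_on[OF 0] by simp
next
  case (Suc k)
  then show ?case by (metis C_on.simps(2))
qed

lemma C_on_dir_deriv: "C_on (Suc k) U f \<Longrightarrow> C_on k U (dir_deriv v f)"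
  by simp

text \<open>The recursion that defines \<^const>\<open>C_on\<close> speaks of the chosen Frechet derivative; this rule lets the
  derivative be any expression.\<close>

lemma C_on_SucI:
  assumes "open U" "\<And>x. x \<in> U \<Longrightarrow> (f has_derivative f' x) (at x)"
    and "\<And>v. C_on k U (\<lambda>x. f' x v)"
  shows "C_on (Suc k) U f"
proof -
  have "dir_deriv v f x = f' x v" if "x \<in> U" for x v
    using frechet_derivative_at[OF assms(2)[OF that]] by metis
  then show ?thesis
    using assms(2,3) C_on_cong[OF assms(1), of "\<lambda>x. f' x v" "\<lambda>x. dir_deriv v f x" k for v]
    by (auto simp: differentiable_def)
qed

declare C_on.simps(2) [simp del]

lemma C_on_const [simp]: "open U \<Longrightarrow> C_on k U (\<lambda>x. c)"
  by (induction k arbitrary: c) (auto intro!: C_on_SucI derivative_eq_intros)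

lemma C_on_bounded_linear: "open U \<Longrightarrow> bounded_linear f \<Longrightarrow> C_on k U f"
  by (cases k) (auto simp: linear_continuous_on intro!: C_on_SucI bounded_linear_imp_has_derivative)

lemma C_on_ident: "open U \<Longrightarrow> C_on k U (\<lambda>x. x)"
  by (rule C_on_bounded_linear) (auto simp: bounded_linear_ident)

lemma C_on_add:
  "open U \<Longrightarrow> C_on k U f \<Longrightarrow> C_on k U g \<Longrightarrow> C_on k U (\<lambda>x. f x + g x)"
proof (induction k arbitrary: f g)
  case (Suc k)
  show ?case
    by (rule C_on_SucI[OF Suc.prems(1)
          has_derivative_add[OF C_on_imp_differentiable[OF Suc.prems(2)]
            C_on_imp_differentiable[OF Suc.prems(3)]]])
      (use Suc in \<open>auto simp: C_on_dir_deriv\<close>)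
qed (simp add: continuous_on_add)

lemma C_on_sum:
  "open U \<Longrightarrow> (\<And>i. i \<in> I \<Longrightarrow> C_on k U (f i)) \<Longrightarrow> C_on k U (\<lambda>x. \<Sum>i\<in>I. f i x)"
  by (induction I rule: infinite_finite_induct) (auto intro: C_on_add)

lemma C_on_bilinear:
  assumes "bounded_bilinear B" "open U"
  shows "C_on k U f \<Longrightarrow> C_on k U g \<Longrightarrow> C_on k U (\<lambda>x. B (f x) (g x))"
proof (induction k arbitrary: f g)
  case 0
  then show ?case by (simp add: bounded_bilinear.continuous_on[OF assms(1)])
next
  case (Suc k)
  have "C_on k U f" "C_on k U g"
    using Suc.prems by (blast intro: C_on_SucD)+
  then show ?case
    by (intro C_on_SucI[OF assms(2)
          bounded_bilinear.FDERIV[OF assms(1) C_on_imp_differentiable[OF Suc.prems(1)]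
            C_on_imp_differentiable[OF Suc.prems(2)]]])
      (use Suc assms in \<open>auto intro!: C_on_add simp: C_on_dir_deriv\<close>)
qed

lemmas C_on_mult = C_on_bilinear[OF bounded_bilinear_mult]
lemmas C_on_scaleR = C_on_bilinear[OF bounded_bilinear_scaleR]
lemmas C_on_inner = C_on_bilinear[OF bounded_bilinear_inner]

lemma C_on_linear_image:
  assumes "bounded_linear L" "open U" "C_on k U f"
  shows "C_on k U (\<lambda>x. L (f x))"
  using assms(3)
proof (induction k arbitrary: f)
  case 0
  then show ?case by (simp add: bounded_linear.continuous_on[OF assms(1)])
next
  case (Suc k)
  then show ?case
    by (intro C_on_SucI[OF assms(2) bounded_linear.has_derivative[OF assms(1)
            C_on_imp_differentiable[OF Suc.prems]]]) (auto simp: C_on_dir_deriv)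
qed

lemma C_on_minus: "open U \<Longrightarrow> C_on k U f \<Longrightarrow> C_on k U (\<lambda>x. - f x)"
  by (rule C_on_linear_image) (auto simp: bounded_linear_minus bounded_linear_ident)

lemma C_on_diff:
  "open U \<Longrightarrow> C_on k U f \<Longrightarrow> C_on k U g \<Longrightarrow> C_on k U (\<lambda>x. f x - g x)"
  using C_on_add[of U k f "\<lambda>x. - g x"] C_on_minus by auto

lemma C_on_prod:
  fixes f :: "'i \<Rightarrow> 'a::euclidean_space \<Rightarrow> real"
  shows "open U \<Longrightarrow> (\<And>i. i \<in> I \<Longrightarrow> C_on k U (f i)) \<Longrightarrow> C_on k U (\<lambda>x. \<Prod>i\<in>I. f i x)"
  by (induction I rule: infinite_finite_induct) (auto intro: C_on_mult)

lemma C_on_det: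
  fixes M :: "'a::euclidean_space \<Rightarrow> real ^ 'n ^ 'n::finite"
  assumes "open U" "\<And>i j. C_on k U (\<lambda>x. M x $ i $ j)"
  shows "C_on k U (\<lambda>x. det (M x))"
  unfolding det_def using assms by (intro C_on_sum C_on_mult C_on_prod) auto

text \<open>The induction needs the directional derivatives of the composite as polynomials in functions that
  are covered by the induction hypothesis, so the chain rule is expanded in a basis.\<close>

lemma C_on_compose:
  fixes f :: "'a::euclidean_space \<Rightarrow> 'b::euclidean_space"
  assumes "open U" "open V"
  shows "C_on k U f \<Longrightarrow> C_on k V g \<Longrightarrow> f ` U \<subseteq> V \<Longrightarrow> C_on k U (\<lambda>x. g (f x))"
proof (induction k arbitrary: g)
  case 0
  then show ?case by (auto intro: continuous_on_compose2)
next
  case (Suc k)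
  have fk: "C_on k U f" using Suc.prems by (blast intro: C_on_SucD)
  have V: "f x \<in> V" if "x \<in> U" for x using Suc.prems that by auto
  have der: "((\<lambda>x. g (f x)) has_derivative
      (\<lambda>v. \<Sum>b\<in>Basis. (dir_deriv v f x \<bullet> b) *\<^sub>R dir_deriv b g (f x))) (at x)" if "x \<in> U" for x
  proof -
    have lin: "linear (\<lambda>v. dir_deriv v g (f x))"
      using C_on_imp_differentiable[OF Suc.prems(2) V[OF that]] by (rule has_derivative_linear)
    have repr: "dir_deriv w g (f x) = (\<Sum>b\<in>Basis. (w \<bullet> b) *\<^sub>R dir_deriv b g (f x))" for w
      using linear_sum[OF lin, of "\<lambda>b. (w \<bullet> b) *\<^sub>R b" Basis] linear_scale[OF lin]
      by (simp add: euclidean_representation)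
    show ?thesis
      using has_derivative_compose[OF C_on_imp_differentiable[OF Suc.prems(1) that]
          C_on_imp_differentiable[OF Suc.prems(2) V[OF that]]]
      by (simp only: repr[symmetric])
  qed
  show ?case
  proof (rule C_on_SucI[OF assms(1) der])
    fix v
    show "C_on k U (\<lambda>x. \<Sum>b\<in>Basis. (dir_deriv v f x \<bullet> b) *\<^sub>R dir_deriv b g (f x))"
    proof (intro C_on_sum C_on_scaleR C_on_inner assms(1))
      fix b :: 'b
      show "C_on k U (dir_deriv v f)" using Suc.prems by (simp add: C_on_dir_deriv)
      show "C_on k U (\<lambda>x. dir_deriv b g (f x))"
        by (rule Suc.IH[OF fk]) (use Suc.prems in \<open>auto simp: C_on_dir_deriv\<close>)
    qed (use assms in auto)
  qed
qed

lemma C_on_realI: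
  fixes f :: "real \<Rightarrow> real"
  assumes "open U" "\<And>x. x \<in> U \<Longrightarrow> (f has_real_derivative f' x) (at x)" "C_on k U f'"
  shows "C_on (Suc k) U f"
  by (rule C_on_SucI[OF assms(1) assms(2)[unfolded has_field_derivative_def]])
    (use assms in \<open>auto intro!: C_on_mult\<close>)

lemma C_on_exp: "C_on k UNIV (exp :: real \<Rightarrow> real)"
  by (induction k) (auto intro!: C_on_realI[where f' = exp] derivative_eq_intros continuous_intros)

lemma C_on_inverse: "C_on k (- {0}) (inverse :: real \<Rightarrow> real)"
proof (induction k)
  case (Suc k)
  show ?case
    by (rule C_on_realI[where f' = "\<lambda>x. - (inverse x * inverse x)"])
      (auto intro!: derivative_eq_intros C_on_minus C_on_mult Suc
        simp: power2_eq_square)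
qed (auto intro!: continuous_intros)

lemma C_on_sqrt: "C_on k {0<..} sqrt"
proof (induction k)
  case (Suc k)
  have "C_on k {0<..} (\<lambda>x. inverse (sqrt x))"
    by (rule C_on_compose[OF _ _ Suc C_on_inverse]) auto
  then show ?case
    by (intro C_on_realI[where f' = "\<lambda>x. inverse (sqrt x) * (1 / 2)"] C_on_mult C_on_const)
      (auto intro!: derivative_eq_intros simp: field_simps)
qed (auto intro!: continuous_intros)

lemma C_on_sinh_cosh: "C_on k UNIV (sinh :: real \<Rightarrow> real) \<and> C_on k UNIV (cosh :: real \<Rightarrow> real)"
proof (induction k)
  case (Suc k)
  then show ?case
    by (auto intro!: C_on_realI derivative_eq_intros simp del: C_on.simps)
qed (auto intro!: continuous_intros)

lemma C_on_compose_real: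
  fixes f :: "'a::euclidean_space \<Rightarrow> real"
  assumes "open U" "C_on k U f"
  shows C_on_exp_compose: "C_on k U (\<lambda>x. exp (f x))"
    and C_on_inverse_compose: "(\<And>x. x \<in> U \<Longrightarrow> f x \<noteq> 0) \<Longrightarrow> C_on k U (\<lambda>x. inverse (f x))"
    and C_on_sqrt_compose: "(\<And>x. x \<in> U \<Longrightarrow> 0 < f x) \<Longrightarrow> C_on k U (\<lambda>x. sqrt (f x))"
    and C_on_sinh_compose: "C_on k U (\<lambda>x. sinh (f x))"
    and C_on_cosh_compose: "C_on k U (\<lambda>x. cosh (f x))"
proof -
  show "C_on k U (\<lambda>x. exp (f x))"
    by (rule C_on_compose[OF assms(1) open_UNIV assms(2) C_on_exp]) simp
  show "C_on k U (\<lambda>x. inverse (f x))" if "\<And>x. x \<in> U \<Longrightarrow> f x \<noteq> 0"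
    by (rule C_on_compose[OF assms(1) _ assms(2) C_on_inverse]) (use that in \<open>auto simp: open_Compl\<close>)
  show "C_on k U (\<lambda>x. sqrt (f x))" if "\<And>x. x \<in> U \<Longrightarrow> 0 < f x"
    by (rule C_on_compose[OF assms(1) _ assms(2) C_on_sqrt]) (use that in auto)
  show "C_on k U (\<lambda>x. sinh (f x))"
    by (rule C_on_compose[OF assms(1) open_UNIV assms(2) C_on_sinh_cosh[THEN conjunct1]]) simp
  show "C_on k U (\<lambda>x. cosh (f x))"
    by (rule C_on_compose[OF assms(1) open_UNIV assms(2) C_on_sinh_cosh[THEN conjunct2]]) simp
qed

lemma C_on_sgn:
  fixes f :: "'a::euclidean_space \<Rightarrow> 'b::euclidean_space"
  assumes "open U" "C_on k U f" "\<And>x. x \<in> U \<Longrightarrow> f x \<noteq> 0"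
  shows "C_on k U (\<lambda>x. sgn (f x))"
  unfolding sgn_div_norm norm_eq_sqrt_inner
  using assms by (intro C_on_scaleR C_on_inverse_compose C_on_sqrt_compose C_on_inner) auto

lemma C_on_Pair:
  fixes f :: "'a::euclidean_space \<Rightarrow> 'b::euclidean_space" and g :: "'a \<Rightarrow> 'c::euclidean_space"
  assumes "open U" "C_on k U f" "C_on k U g"
  shows "C_on k U (\<lambda>x. (f x, g x))"
proof -
  have *: "bounded_linear (\<lambda>y::'b. (y, 0::'c))" "bounded_linear (\<lambda>y::'c. (0::'b, y))"
    by (auto intro!: bounded_linear_Pair bounded_linear_ident bounded_linear_zero)
  show ?thesis
    using C_on_add[OF assms(1) C_on_linear_image[OF *(1) assms(1,2)]
        C_on_linear_image[OF *(2) assms(1,3)]] by simp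
qed

lemma C_on_fst: "open U \<Longrightarrow> C_on k U f \<Longrightarrow> C_on k U (\<lambda>x. fst (f x))"
  and C_on_snd: "open U \<Longrightarrow> C_on k U f \<Longrightarrow> C_on k U (\<lambda>x. snd (f x))"
  by (auto intro: C_on_linear_image bounded_linear_fst bounded_linear_snd)

lemmas C_on_intros = C_on_const C_on_ident C_on_add C_on_diff C_on_minus C_on_mult C_on_scaleR
  C_on_inner C_on_sum C_on_exp_compose C_on_inverse_compose C_on_sqrt_compose
  C_on_sinh_compose C_on_cosh_compose C_on_Pair C_on_fst C_on_snd

subsection \<open>Symmetry of second derivatives\<close>

lemma has_real_derivative_along_line:
  fixes f :: "'a::euclidean_space \<Rightarrow> real"
  assumes "C_on (Suc k) U f" "y + a *\<^sub>R u \<in> U"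
  shows "((\<lambda>a. f (y + a *\<^sub>R u)) has_real_derivative dir_deriv u f (y + a *\<^sub>R u)) (at a)"
proof -
  have "((\<lambda>a. y + a *\<^sub>R u) has_derivative (\<lambda>t. t *\<^sub>R u)) (at a)"
    by (auto intro!: derivative_eq_intros)
  from has_derivative_compose[OF this C_on_imp_differentiable[OF assms]]
  have "((\<lambda>a. f (y + a *\<^sub>R u)) has_derivative (\<lambda>t. dir_deriv (t *\<^sub>R u) f (y + a *\<^sub>R u))) (at a)" .
  moreover have "linear (\<lambda>v. dir_deriv v f (y + a *\<^sub>R u))"
    using C_on_imp_differentiable[OF assms] by (rule has_derivative_linear)
  ultimately show ?thesis
    by (simp add: has_field_derivative_def linear_scale mult_commute_abs)
qed

text \<open>The mean value theorem, applied first in the direction \<open>u\<close> and then in the direction \<open>v\<close>. The second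
  difference is symmetric in \<open>u\<close> and \<open>v\<close>, so the two mixed derivatives agree at two points near
  \<open>x\<close>, and continuity makes them agree at \<open>x\<close>.\<close>

lemma second_difference_mean_value:
  fixes f :: "'a::euclidean_space \<Rightarrow> real"
  assumes f: "C_on (Suc (Suc 0)) U f" and h: "0 < h"
    and U: "\<And>a b. 0 \<le> a \<Longrightarrow> a \<le> h \<Longrightarrow> 0 \<le> b \<Longrightarrow> b \<le> h \<Longrightarrow> x + a *\<^sub>R u + b *\<^sub>R v \<in> U"
  shows "\<exists>a b. 0 < a \<and> a < h \<and> 0 < b \<and> b < h \<and>
    f (x + h *\<^sub>R u + h *\<^sub>R v) - f (x + h *\<^sub>R u) - f (x + h *\<^sub>R v) + f x =
      h * h * dir_deriv v (dir_deriv u f) (x + a *\<^sub>R u + b *\<^sub>R v)"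
proof -
  define g where "g a = f ((x + h *\<^sub>R v) + a *\<^sub>R u) - f (x + a *\<^sub>R u)" for a
  have dg: "(g has_real_derivative
      dir_deriv u f ((x + h *\<^sub>R v) + a *\<^sub>R u) - dir_deriv u f (x + a *\<^sub>R u)) (at a)"
    if "0 \<le> a" "a \<le> h" for a
    unfolding g_def
    using U[of a h] U[of a 0] that h
    by (intro DERIV_diff has_real_derivative_along_line[OF f]) (auto simp: algebra_simps)
  obtain a where a: "0 < a" "a < h" "g h - g 0 = (h - 0) *
      (dir_deriv u f ((x + h *\<^sub>R v) + a *\<^sub>R u) - dir_deriv u f (x + a *\<^sub>R u))"
    using MVT2[OF h dg] by auto
  define k where "k b = dir_deriv u f ((x + a *\<^sub>R u) + b *\<^sub>R v)" for b
  have dk: "(k has_real_derivative dir_deriv v (dir_deriv u f) ((x + a *\<^sub>R u) + b *\<^sub>R v)) (at b)"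
    if "0 \<le> b" "b \<le> h" for b
    unfolding k_def
    using U[of a b] that a by (intro has_real_derivative_along_line[OF C_on_dir_deriv[OF f]]) auto
  obtain b where b: "0 < b" "b < h" "k h - k 0 = (h - 0) *
      dir_deriv v (dir_deriv u f) ((x + a *\<^sub>R u) + b *\<^sub>R v)"
    using MVT2[OF h dk] by auto
  have "f (x + h *\<^sub>R u + h *\<^sub>R v) - f (x + h *\<^sub>R u) - f (x + h *\<^sub>R v) + f x = g h - g 0"
    by (simp add: g_def algebra_simps)
  also have "\<dots> = h * (k h - k 0)"
    using a(3) by (simp add: k_def algebra_simps)
  finally show ?thesis using a b by (intro exI[of _ a] exI[of _ b]) auto
qed

lemma dir_deriv_commute_real:
  fixes f :: "'a::euclidean_space \<Rightarrow> real"
  assumes U: "open U" "x \<in> U" and f: "C_on (Suc (Suc 0)) U f"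
  shows "dir_deriv v (dir_deriv u f) x = dir_deriv u (dir_deriv v f) x"
proof (rule ccontr)
  let ?A = "dir_deriv v (dir_deriv u f)" and ?B = "dir_deriv u (dir_deriv v f)"
  define e where "e = \<bar>?A x - ?B x\<bar> / 2"
  assume "?A x \<noteq> ?B x"
  then have e: "e > 0" by (simp add: e_def)
  have c: "continuous_on U ?A" "continuous_on U ?B"
    using C_on_dir_deriv[OF C_on_dir_deriv[OF f]] by auto
  obtain d1 where d1: "d1 > 0" "\<And>y. dist y x < d1 \<Longrightarrow> dist (?A y) (?A x) < e"
    using c(1) U e unfolding continuous_on_eq_continuous_at[OF U(1)] continuous_at_eps_delta
    by (metis dist_commute)
  obtain d2 where d2: "d2 > 0" "\<And>y. dist y x < d2 \<Longrightarrow> dist (?B y) (?B x) < e"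
    using c(2) U e unfolding continuous_on_eq_continuous_at[OF U(1)] continuous_at_eps_delta
    by (metis dist_commute)
  obtain d3 where d3: "d3 > 0" "ball x d3 \<subseteq> U"
    using U openE by blast
  define d where "d = min d1 (min d2 d3)"
  define m where "m = norm u + norm v + 1"
  define h where "h = d / (2 * m)"
  have n: "0 < m" by (simp add: m_def add_nonneg_pos)
  then have h: "0 < h" using d1 d2 d3 by (auto simp: h_def d_def)
  have close: "dist (x + a *\<^sub>R u + b *\<^sub>R v) x < d" if "0 \<le> a" "a \<le> h" "0 \<le> b" "b \<le> h" for a b
  proof -
    have "dist (x + a *\<^sub>R u + b *\<^sub>R v) x \<le> norm (a *\<^sub>R u) + norm (b *\<^sub>R v)"
      using norm_triangle_ineq[of "a *\<^sub>R u" "b *\<^sub>R v"] by (simp add: dist_norm add.assoc)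
    also have "\<dots> \<le> h * norm u + h * norm v"
      using that by (intro add_mono) (auto intro: mult_right_mono)
    also have "\<dots> < h * m"
      using h by (simp add: m_def algebra_simps)
    also have "\<dots> = d / 2" using n by (simp add: h_def)
    also have "\<dots> < d" using d1 d2 d3 by (auto simp: d_def)
    finally show ?thesis .
  qed
  then have inU: "x + a *\<^sub>R u + b *\<^sub>R v \<in> U" if "0 \<le> a" "a \<le> h" "0 \<le> b" "b \<le> h" for a b
    using d3 that by (force simp: d_def dist_commute)
  obtain a b where ab: "0 < a" "a < h" "0 < b" "b < h"
    "f (x + h *\<^sub>R u + h *\<^sub>R v) - f (x + h *\<^sub>R u) - f (x + h *\<^sub>R v) + f x =
      h * h * ?A (x + a *\<^sub>R u + b *\<^sub>R v)"
    using second_difference_mean_value[OF f h inU] by blast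
  have inU': "x + a *\<^sub>R v + b *\<^sub>R u \<in> U" if "0 \<le> a" "a \<le> h" "0 \<le> b" "b \<le> h" for a b
    using inU[of b a] that by (simp add: algebra_simps)
  obtain a' b' where ab': "0 < a'" "a' < h" "0 < b'" "b' < h"
    "f (x + h *\<^sub>R v + h *\<^sub>R u) - f (x + h *\<^sub>R v) - f (x + h *\<^sub>R u) + f x =
      h * h * ?B (x + a' *\<^sub>R v + b' *\<^sub>R u)"
    using second_difference_mean_value[OF f h inU'] by blast
  have "h * h * ?A (x + a *\<^sub>R u + b *\<^sub>R v) = h * h * ?B (x + b' *\<^sub>R u + a' *\<^sub>R v)"
    using ab(5) ab'(5) by (simp add: algebra_simps)
  then have "?A (x + a *\<^sub>R u + b *\<^sub>R v) = ?B (x + b' *\<^sub>R u + a' *\<^sub>R v)"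
    using h by simp
  moreover have "dist (?A (x + a *\<^sub>R u + b *\<^sub>R v)) (?A x) < e"
    using close[of a b] ab by (intro d1) (auto simp: d_def)
  moreover have "dist (?B (x + b' *\<^sub>R u + a' *\<^sub>R v)) (?B x) < e"
    using close[of b' a'] ab' by (intro d2) (auto simp: d_def)
  moreover have "\<not> (\<bar>p - q\<bar> < \<bar>q - q'\<bar> / 2 \<and> \<bar>p - q'\<bar> < \<bar>q - q'\<bar> / 2)" for p q q' :: real
    by (auto simp: abs_if split: if_splits)
  ultimately show False unfolding e_def dist_real_def by metis
qed

lemma dir_deriv_inner:
  assumes "open U" "x \<in> U" "C_on (Suc k) U f"
  shows "dir_deriv v (\<lambda>x. f x \<bullet> b) x = dir_deriv v f x \<bullet> b"
proof -
  have "((\<lambda>x. f x \<bullet> b) has_derivative (\<lambda>v. dir_deriv v f x \<bullet> b)) (at x)"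
    by (rule has_derivative_inner_left[OF C_on_imp_differentiable[OF assms(3,2)]])
  from frechet_derivative_at[OF this] show ?thesis by metis
qed

lemma dir_deriv_commute:
  fixes f :: "'a::euclidean_space \<Rightarrow> 'b::euclidean_space"
  assumes U: "open U" "x \<in> U" and f: "C_on (Suc (Suc 0)) U f"
  shows "dir_deriv v (dir_deriv u f) x = dir_deriv u (dir_deriv v f) x"
proof (rule euclidean_eqI)
  fix b :: 'b
  have *: "dir_deriv v (dir_deriv u f) x \<bullet> b = dir_deriv v (dir_deriv u (\<lambda>x. f x \<bullet> b)) x" for u v
  proof -
    have "dir_deriv v (dir_deriv u f) x \<bullet> b = dir_deriv v (\<lambda>x. dir_deriv u f x \<bullet> b) x"
      by (rule dir_deriv_inner[OF U C_on_dir_deriv[OF f], symmetric])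
    also have "\<dots> = dir_deriv v (dir_deriv u (\<lambda>x. f x \<bullet> b)) x"
      by (subst frechet_derivative_cong_open[OF U]) (auto simp: dir_deriv_inner[OF U(1) _ f])
    finally show ?thesis .
  qed
  have "C_on (Suc (Suc 0)) U (\<lambda>x. f x \<bullet> b)"
    using f U by (intro C_on_inner) auto
  from dir_deriv_commute_real[OF U this]
  show "dir_deriv v (dir_deriv u f) x \<bullet> b = dir_deriv u (dir_deriv v f) x \<bullet> b"
    by (simp only: *)
qed

subsection \<open>Second-order jets\<close>

text \<open>The value and the first two derivatives at \<open>0\<close>, with a first derivative that is available near
  \<open>0\<close>. Jets can be multiplied and composed by rule, which reduces the second variation to algebra.\<close>

definition has_jet2 :: "(real \<Rightarrow> 'a::real_normed_vector) \<Rightarrow> 'a \<Rightarrow> 'a \<Rightarrow> 'a \<Rightarrow> bool" where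
  "has_jet2 f a b c \<longleftrightarrow> (\<exists>f'. (\<forall>\<^sub>F s in nhds 0. (f has_vector_derivative f' s) (at s)) \<and>
     f 0 = a \<and> f' 0 = b \<and> (f' has_vector_derivative c) (at 0))"

lemma has_jet2_const: "has_jet2 (\<lambda>s. a) a 0 0"
  unfolding has_jet2_def by (intro exI[of _ "\<lambda>_. 0"]) auto

lemma has_jet2_cong:
  assumes "has_jet2 f a b c" "\<forall>\<^sub>F s in nhds 0. f s = g s"
  shows "has_jet2 g a b c"
proof -
  from assms(1) obtain f' where f': "\<forall>\<^sub>F s in nhds 0. (f has_vector_derivative f' s) (at s)"
    "f 0 = a" "f' 0 = b" "(f' has_vector_derivative c) (at 0)"
    unfolding has_jet2_def by blast
  obtain S where S: "open S" "0 \<in> S" "\<And>s. s \<in> S \<Longrightarrow> f s = g s"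
    using assms(2) by (auto simp: eventually_nhds)
  have "\<forall>\<^sub>F s in nhds 0. s \<in> S" using S eventually_nhds by blast
  with f'(1) have "\<forall>\<^sub>F s in nhds 0. (g has_vector_derivative f' s) (at s)"
    by eventually_elim (rule has_vector_derivative_transform_within_open[OF _ S(1) _ S(3)])
  then show ?thesis unfolding has_jet2_def using f' S by (intro exI[of _ f']) auto
qed

lemma has_jet2_add:
  assumes "has_jet2 f a b c" "has_jet2 g a' b' c'"
  shows "has_jet2 (\<lambda>s. f s + g s) (a + a') (b + b') (c + c')"
proof -
  from assms obtain f' g' where
    "\<forall>\<^sub>F s in nhds 0. (f has_vector_derivative f' s) (at s)" "f 0 = a" "f' 0 = b" "(f' has_vector_derivative c) (at 0)"
    "\<forall>\<^sub>F s in nhds 0. (g has_vector_derivative g' s) (at s)" "g 0 = a'" "g' 0 = b'" "(g' has_vector_derivative c') (at 0)"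
    unfolding has_jet2_def by blast
  moreover from this(1,5) have
    "\<forall>\<^sub>F s in nhds 0. ((\<lambda>s. f s + g s) has_vector_derivative f' s + g' s) (at s)"
    by eventually_elim (rule has_vector_derivative_add)
  ultimately show ?thesis
    unfolding has_jet2_def
    by (intro exI[of _ "\<lambda>s. f' s + g' s"]) (auto intro!: has_vector_derivative_add)
qed

lemma has_jet2_bilinear:
  assumes B: "bounded_bilinear B" and "has_jet2 f a b c" "has_jet2 g a' b' c'"
  shows "has_jet2 (\<lambda>s. B (f s) (g s)) (B a a') (B a b' + B b a') (B a c' + 2 *\<^sub>R B b b' + B c a')"
proof -
  from assms obtain f' g' where *:
    "\<forall>\<^sub>F s in nhds 0. (f has_vector_derivative f' s) (at s)" "f 0 = a" "f' 0 = b" "(f' has_vector_derivative c) (at 0)"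
    "\<forall>\<^sub>F s in nhds 0. (g has_vector_derivative g' s) (at s)" "g 0 = a'" "g' 0 = b'" "(g' has_vector_derivative c') (at 0)"
    unfolding has_jet2_def by blast
  have f0: "(f has_vector_derivative b) (at 0)" and g0: "(g has_vector_derivative b') (at 0)"
    using eventually_nhds_x_imp_x[OF *(1)] eventually_nhds_x_imp_x[OF *(5)] * by auto
  have "((\<lambda>s. B (f s) (g' s) + B (f' s) (g s)) has_vector_derivative
      (B (f 0) c' + B b (g' 0)) + (B (f' 0) b' + B c (g 0))) (at 0)"
    by (intro has_vector_derivative_add bounded_bilinear.has_vector_derivative[OF B] f0 g0 *)
  moreover have "\<forall>\<^sub>F s in nhds 0. ((\<lambda>s. B (f s) (g s)) has_vector_derivative
      B (f s) (g' s) + B (f' s) (g s)) (at s)"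
    using *(1,5) by eventually_elim (rule bounded_bilinear.has_vector_derivative[OF B])
  ultimately show ?thesis
    unfolding has_jet2_def
    by (intro exI[of _ "\<lambda>s. B (f s) (g' s) + B (f' s) (g s)"])
      (use * in \<open>auto simp: scaleR_2 algebra_simps\<close>)
qed

lemmas has_jet2_mult = has_jet2_bilinear[OF bounded_bilinear_mult]
lemmas has_jet2_inner = has_jet2_bilinear[OF bounded_bilinear_inner]

lemma has_jet2_compose:
  fixes f :: "real \<Rightarrow> real"
  assumes f: "has_jet2 f a b c" and U: "open U" "a \<in> U"
    and g: "\<And>x. x \<in> U \<Longrightarrow> (g has_real_derivative g' x) (at x)"
    and g': "(g' has_real_derivative g'') (at a)"
  shows "has_jet2 (\<lambda>s. g (f s)) (g a) (g' a * b) (g' a * c + g'' * b * b)"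
proof -
  from f obtain f' where *:
    "\<forall>\<^sub>F s in nhds 0. (f has_real_derivative f' s) (at s)" "f 0 = a" "f' 0 = b" "(f' has_real_derivative c) (at 0)"
    unfolding has_jet2_def has_real_derivative_iff_has_vector_derivative by blast
  have f0: "(f has_real_derivative b) (at 0)"
    using eventually_nhds_x_imp_x[OF *(1)] * by auto
  have "\<forall>\<^sub>F s in nhds 0. f s \<in> U"
    using DERIV_isCont[OF f0] U *(2)
    by (auto simp: isCont_def tendsto_def eventually_nhds_conv_at)
  with *(1) have "\<forall>\<^sub>F s in nhds 0. ((\<lambda>s. g (f s)) has_real_derivative g' (f s) * f' s) (at s)"
    by eventually_elim (rule DERIV_chain2[OF g])
  moreover have "((\<lambda>s. g' (f s) * f' s) has_real_derivative g'' * b * f' 0 + c * g' (f 0)) (at 0)"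
    by (intro DERIV_mult DERIV_chain2[of g', OF _ f0] *) (use g' *(2) in auto)
  ultimately show ?thesis
    unfolding has_jet2_def has_real_derivative_iff_has_vector_derivative[symmetric]
    by (intro exI[of _ "\<lambda>s. g' (f s) * f' s"]) (use * in \<open>auto simp: algebra_simps\<close>)
qed

lemma has_jet2_unique:
  assumes "has_jet2 f a b c" "has_jet2 f a' b' c'"
  shows "a = a' \<and> b = b' \<and> c = c'"
proof -
  from assms obtain f' g' where *:
    "\<forall>\<^sub>F s in nhds 0. (f has_vector_derivative f' s) (at s)" "f 0 = a" "f' 0 = b" "(f' has_vector_derivative c) (at 0)"
    "\<forall>\<^sub>F s in nhds 0. (f has_vector_derivative g' s) (at s)" "f 0 = a'" "g' 0 = b'" "(g' has_vector_derivative c') (at 0)"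
    unfolding has_jet2_def by blast
  have eq: "\<forall>\<^sub>F s in nhds 0. f' s = g' s"
    using *(1,5) by eventually_elim (rule vector_derivative_unique_at)
  then obtain S where "open S" "0 \<in> S" "\<And>s. s \<in> S \<Longrightarrow> f' s = g' s"
    by (auto simp: eventually_nhds)
  then have "(g' has_vector_derivative c) (at 0)"
    using has_vector_derivative_transform_within_open[OF *(4)] by blast
  with * vector_derivative_unique_at eventually_nhds_x_imp_x[OF eq] show ?thesis by auto
qed

lemma has_vector_derivative_slice:
  fixes u :: "real \<times> 'a::euclidean_space \<Rightarrow> 'b::real_normed_vector"
  assumes "C_on (Suc k) U u" "(s, x) \<in> U"
  shows "((\<lambda>s. u (s, x)) has_vector_derivative dir_deriv (1, 0) u (s, x)) (at s)"
proof -
  have "((\<lambda>s. (s, x)) has_derivative (\<lambda>t. (t, 0))) (at s)"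
    by (auto intro!: derivative_eq_intros)
  from has_derivative_compose[OF this C_on_imp_differentiable[OF assms]]
  have "((\<lambda>s. u (s, x)) has_derivative (\<lambda>t. dir_deriv (t *\<^sub>R (1, 0)) u (s, x))) (at s)"
    by simp
  moreover have "linear (\<lambda>v. dir_deriv v u (s, x))"
    using C_on_imp_differentiable[OF assms] by (rule has_derivative_linear)
  ultimately show ?thesis
    by (simp add: has_vector_derivative_def linear_scale del: scaleR_Pair)
qed

lemma has_jet2_along:
  fixes u :: "real \<times> 'a::euclidean_space \<Rightarrow> 'b::real_normed_vector"
  assumes "open U" "(0, x) \<in> U" "C_on (Suc (Suc 0)) U u"
  shows "has_jet2 (\<lambda>s. u (s, x)) (u (0, x)) (dir_deriv (1, 0) u (0, x))
    (dir_deriv (1, 0) (dir_deriv (1, 0) u) (0, x))"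
proof -
  have "\<forall>\<^sub>F s in nhds 0. (s, x) \<in> U"
  proof -
    have "open ((\<lambda>s. (s, x)) -` U)"
      using assms by (intro open_vimage) (auto intro!: continuous_intros)
    then show ?thesis using assms(2) eventually_nhds by auto
  qed
  then show ?thesis
    unfolding has_jet2_def
    by (intro exI[of _ "\<lambda>s. dir_deriv (1, 0) u (s, x)"])
      (auto intro: has_vector_derivative_slice[OF C_on_dir_deriv[OF assms(3)] assms(2)]
        has_vector_derivative_slice[OF assms(3)] elim!: eventually_mono)
qed

section \<open>Integration over the round sphere\<close>

subsection \<open>Differentiation under the integral sign\<close>

text \<open>Dominated convergence of the difference quotients, which the mean value inequality bounds by the
  same function \<open>g\<close> as the derivative.\<close>

lemma has_real_derivative_integral:
  fixes f f' :: "real \<Rightarrow> 'w \<Rightarrow> real"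
  assumes s: "s \<in> {a<..<b}"
    and der: "\<And>t w. t \<in> {a<..<b} \<Longrightarrow> w \<in> space M \<Longrightarrow>
      ((\<lambda>t. f t w) has_real_derivative f' t w) (at t)"
    and bound: "\<And>t w. t \<in> {a<..<b} \<Longrightarrow> w \<in> space M \<Longrightarrow> \<bar>f' t w\<bar> \<le> g w"
    and g: "integrable M g"
    and int: "\<And>t. t \<in> {a<..<b} \<Longrightarrow> integrable M (f t)"
  shows "((\<lambda>t. LINT w|M. f t w) has_real_derivative (LINT w|M. f' s w)) (at s)"
proof -
  have main: "(\<lambda>i. ((LINT w|M. f (X i) w) - (LINT w|M. f s w)) / (X i - s)) \<longlonglongrightarrow> (LINT w|M. f' s w)"
    if X: "\<forall>i. X i \<noteq> s" "X \<longlonglongrightarrow> s" for X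
  proof -
    define u where "u i w = (if X i \<in> {a<..<b} then (f (X i) w - f s w) / (X i - s) else 0)" for i w
    have ev: "\<forall>\<^sub>F i in sequentially. X i \<in> {a<..<b}"
      using X(2) s by (rule topological_tendstoD[OF _ open_greaterThanLessThan])
    have lim: "(\<lambda>i. u i w) \<longlonglongrightarrow> f' s w" if "w \<in> space M" for w
    proof -
      have "((\<lambda>t. (f t w - f s w) / (t - s)) \<longlongrightarrow> f' s w) (at s)"
        using der[OF s that] by (simp add: has_field_derivative_iff)
      then have "(\<lambda>i. (f (X i) w - f s w) / (X i - s)) \<longlonglongrightarrow> f' s w"
        using X unfolding tendsto_at_iff_sequentially by (auto simp: o_def)
      then show ?thesis
        by (rule Lim_transform_eventually) (use ev in \<open>auto simp: u_def elim: eventually_mono\<close>)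
    qed
    have u_int: "integrable M (u i)" for i
      unfolding u_def using int s by (cases "X i \<in> {a<..<b}") auto
    have "\<bar>u i w\<bar> \<le> g w" if w: "w \<in> space M" for i w
    proof (cases "X i \<in> {a<..<b}")
      case True
      have seg: "closed_segment s (X i) \<subseteq> {a<..<b}"
        using True s by (auto simp: closed_segment_eq_real_ivl)
      have "norm (f (X i) w - f s w) \<le> g w * norm (X i - s)"
      proof (rule field_differentiable_bound[of "closed_segment s (X i)" "\<lambda>t. f t w" "\<lambda>t. f' t w"])
        fix t assume "t \<in> closed_segment s (X i)"
        with seg have t: "t \<in> {a<..<b}" by blast
        show "((\<lambda>t. f t w) has_real_derivative f' t w) (at t within closed_segment s (X i))"
          by (rule has_field_derivative_at_within[OF der[OF t w]])
        show "norm (f' t w) \<le> g w" using bound[OF t w] by simp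
      qed auto
      then show ?thesis
        using True X(1) by (auto simp: u_def field_simps)
    next
      case False
      then show ?thesis using bound[OF s w] by (auto simp: u_def)
    qed
    moreover have "f' s \<in> borel_measurable M"
      by (rule borel_measurable_LIMSEQ_real[of _ u]) (use lim u_int in auto)
    ultimately have "(\<lambda>i. LINT w|M. u i w) \<longlonglongrightarrow> (LINT w|M. f' s w)"
      using u_int lim g by (intro integral_dominated_convergence[where w = g]) auto
    moreover have "\<forall>\<^sub>F i in sequentially. (LINT w|M. u i w) =
        ((LINT w|M. f (X i) w) - (LINT w|M. f s w)) / (X i - s)"
      using ev by eventually_elim (use int s in \<open>auto simp: u_def\<close>)
    ultimately show ?thesis by (rule Lim_transform_eventually)
  qed
  show ?thesis
    unfolding has_field_derivative_iff tendsto_at_iff_sequentially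
    using main by (auto simp: o_def)
qed

subsection \<open>The gnomonic charts\<close>

text \<open>The area density of the unit sphere in the coordinates of central projection from the tangent
  plane at a pole.\<close>

definition gnomonic_density :: "real ^ 'n::finite \<Rightarrow> real" where
  "gnomonic_density w = (1 / sqrt (1 + (norm w)\<^sup>2)) ^ (CARD('n) + 1)"

definition gnomonic_measure :: "(real ^ 'n::finite) measure" where
  "gnomonic_measure = density lborel (\<lambda>w. ennreal (gnomonic_density w))"

abbreviation unit_chart :: "real \<Rightarrow> real ^ 'n::finite \<Rightarrow> 'n space" where
  "unit_chart \<equiv> hemisphere_chart 1"

definition hemisphere_integral :: "real \<Rightarrow> ('n::finite space \<Rightarrow> real) \<Rightarrow> real" where
  "hemisphere_integral \<sigma> h = (LINT w|gnomonic_measure. h (unit_chart \<sigma> w))"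

definition sphere_integral :: "('n::finite space \<Rightarrow> real) \<Rightarrow> real" where
  "sphere_integral h = hemisphere_integral 1 h + hemisphere_integral (-1) h"

definition closed_hemisphere :: "real \<Rightarrow> 'n::finite space set" where
  "closed_hemisphere \<sigma> = {p \<in> sphere 0 1. 0 \<le> \<sigma> * snd p}"

lemma gnomonic_denominator_pos [simp]: "0 < 1 + (norm w)\<^sup>2"
  by (simp add: add_pos_nonneg)

lemma gnomonic_density_pos: "0 < gnomonic_density w"
  unfolding gnomonic_density_def by simp

lemma continuous_gnomonic_density: "continuous_on A gnomonic_density"
  unfolding gnomonic_density_def
  by (intro continuous_intros) (use gnomonic_denominator_pos in \<open>auto simp: less_imp_neq[symmetric]\<close>)

lemma measurable_gnomonic_density [measurable]: "gnomonic_density \<in> borel_measurable borel"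
  by (rule borel_measurable_continuous_onI[OF continuous_gnomonic_density])

lemma continuous_chart: "continuous_on A (hemisphere_chart r \<sigma>)"
  unfolding hemisphere_chart_def
  by (intro continuous_intros) (use gnomonic_denominator_pos in \<open>auto simp: less_imp_neq[symmetric]\<close>)

lemma measurable_chart [measurable]: "hemisphere_chart r \<sigma> \<in> borel_measurable borel"
  by (rule borel_measurable_continuous_onI[OF continuous_chart])

lemma norm_unit_chart: "\<bar>\<sigma>\<bar> = 1 \<Longrightarrow> norm (unit_chart \<sigma> w) = 1"
  using gnomonic_denominator_pos[of w]
  by (simp add: hemisphere_chart_def norm_Pair power_divide add_divide_distrib[symmetric]
      less_imp_neq[symmetric] add.commute)

lemma unit_chart_in_hemisphere: "\<bar>\<sigma>\<bar> = 1 \<Longrightarrow> unit_chart \<sigma> w \<in> closed_hemisphere \<sigma>"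
  using norm_unit_chart[of \<sigma> w]
  by (auto simp: closed_hemisphere_def hemisphere_chart_def add_nonneg_nonneg
      intro!: divide_nonneg_nonneg)

lemma unit_chart_uminus: "unit_chart (- \<sigma>) w = - unit_chart \<sigma> w"
  by (simp add: hemisphere_chart_def)

lemma chart_eq_scaleR_unit_chart: "hemisphere_chart r \<sigma> w = r *\<^sub>R unit_chart \<sigma> w"
  by (simp add: hemisphere_chart_def)

lemma compact_closed_hemisphere: "compact (closed_hemisphere \<sigma> :: 'n::finite space set)"
proof -
  have "closed_hemisphere \<sigma> = sphere 0 1 \<inter> {p. 0 \<le> \<sigma> * snd p}"
    by (auto simp: closed_hemisphere_def)
  moreover have "closed {p :: 'n space. 0 \<le> \<sigma> * snd p}"
    by (intro closed_Collect_le continuous_intros)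
  ultimately show ?thesis by (metis compact_Int_closed compact_sphere)
qed

lemma sets_gnomonic [measurable_cong, simp]: "sets gnomonic_measure = sets borel"
  and space_gnomonic [simp]: "space gnomonic_measure = UNIV"
  by (simp_all add: gnomonic_measure_def)

subsection \<open>Polar coordinates\<close>

lemma nn_integral_lborel_scale:
  fixes f :: "'a::euclidean_space \<Rightarrow> ennreal"
  assumes [measurable]: "f \<in> borel_measurable borel" and "t \<noteq> 0"
  shows "(\<integral>\<^sup>+ y. f y \<partial>lborel) = ennreal (\<bar>t\<bar> ^ DIM('a)) * (\<integral>\<^sup>+ w. f (t *\<^sub>R w) \<partial>lborel)"
  by (subst lborel_affine[OF \<open>t \<noteq> 0\<close>, of 0])
    (simp add: nn_integral_density nn_integral_distr nn_integral_cmult)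

text \<open>The horizontal slice at height \<open>t\<close> is parametrized by \<open>t\<close> times the hyperplane at height one,
  with Jacobian \<open>|t| ^ n\<close>. The vertical line over a point \<open>w\<close> then becomes the line through \<open>(w, 1)\<close>
  and the origin, whose two halves are the rays through the two hemispheres; passing from \<open>t\<close> to
  the distance from the origin contributes the gnomonic density.\<close>

lemma nn_integral_polar:
  fixes \<Phi> :: "'n::finite space \<Rightarrow> ennreal"
  assumes [measurable]: "\<Phi> \<in> borel_measurable borel"
  shows "(\<integral>\<^sup>+ x. \<Phi> x \<partial>lborel) = (\<Sum>\<sigma>\<in>{1, -1}. \<integral>\<^sup>+ w. (\<integral>\<^sup>+ \<rho>.
    \<Phi> (\<rho> *\<^sub>R unit_chart \<sigma> w) * ennreal (\<rho> ^ CARD('n)) * indicator {0<..} \<rho> \<partial>lborel)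
      \<partial>gnomonic_measure)"
proof -
  let ?n = "CARD('n)"
  have inner: "(\<integral>\<^sup>+ t. ennreal (\<bar>t\<bar> ^ ?n) * \<Phi> (t *\<^sub>R (w, 1)) \<partial>lborel) =
      (\<Sum>\<sigma>\<in>{1, -1}. ennreal (gnomonic_density w) * (\<integral>\<^sup>+ \<rho>.
    \<Phi> (\<rho> *\<^sub>R unit_chart \<sigma> w) * ennreal (\<rho> ^ ?n) * indicator {0<..} \<rho> \<partial>lborel))" for w :: "real ^ 'n"
  proof -
    define d where "d = 1 / sqrt (1 + (norm w)\<^sup>2)"
    have d: "d > 0" by (simp add: d_def)
    have half: "(\<integral>\<^sup>+ t. ennreal (\<bar>t\<bar> ^ ?n) * \<Phi> (t *\<^sub>R (w, 1)) * indicator {0<..} (\<sigma> * t) \<partial>lborel) =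
      ennreal (gnomonic_density w) * (\<integral>\<^sup>+ \<rho>.
    \<Phi> (\<rho> *\<^sub>R unit_chart \<sigma> w) * ennreal (\<rho> ^ ?n) * indicator {0<..} \<rho> \<partial>lborel)"
      if \<sigma>: "\<sigma> = 1 \<or> \<sigma> = -1" for \<sigma> :: real
    proof -
      have "(\<integral>\<^sup>+ t. ennreal (\<bar>t\<bar> ^ ?n) * \<Phi> (t *\<^sub>R (w, 1)) * indicator {0<..} (\<sigma> * t) \<partial>lborel)
        = ennreal \<bar>\<sigma> * d\<bar> * (\<integral>\<^sup>+ \<rho>. ennreal (\<bar>0 + \<sigma> * d * \<rho>\<bar> ^ ?n) * \<Phi> ((0 + \<sigma> * d * \<rho>) *\<^sub>R (w, 1))
            * indicator {0<..} (\<sigma> * (0 + \<sigma> * d * \<rho>)) \<partial>lborel)"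
        using d \<sigma> by (intro nn_integral_real_affine) auto
      also have "\<dots> = ennreal d * (\<integral>\<^sup>+ \<rho>. ennreal (d ^ ?n) *
          (\<Phi> (\<rho> *\<^sub>R unit_chart \<sigma> w) * ennreal (\<rho> ^ ?n) * indicator {0<..} \<rho>) \<partial>lborel)"
      proof -
        have "ennreal (\<bar>0 + \<sigma> * d * \<rho>\<bar> ^ ?n) * \<Phi> ((0 + \<sigma> * d * \<rho>) *\<^sub>R (w, 1))
            * indicator {0<..} (\<sigma> * (0 + \<sigma> * d * \<rho>)) =
          ennreal (d ^ ?n) * (\<Phi> (\<rho> *\<^sub>R unit_chart \<sigma> w) * ennreal (\<rho> ^ ?n) * indicator {0<..} \<rho>)" for \<rho> :: real
        proof (cases "\<rho> > 0")
          case True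
          have "(0 + \<sigma> * d * \<rho>) *\<^sub>R (w, 1::real) = \<rho> *\<^sub>R unit_chart \<sigma> w"
            by (simp add: hemisphere_chart_def d_def)
          moreover have "\<bar>0 + \<sigma> * d * \<rho>\<bar> = d * \<rho>" using True d \<sigma> by (auto simp: abs_mult)
          moreover have "\<sigma> * (0 + \<sigma> * d * \<rho>) > 0" using True d \<sigma> by auto
          ultimately show ?thesis
            using True d by (simp add: power_mult_distrib ennreal_mult ac_simps)
        next
          case False
          then have "\<not> \<sigma> * (0 + \<sigma> * d * \<rho>) > 0"
            using d \<sigma> by (auto simp: zero_less_mult_iff)
          then show ?thesis using False by simp
        qed
        moreover have "ennreal \<bar>\<sigma> * d\<bar> = ennreal d" using d \<sigma> by auto
        ultimately show ?thesis by presburger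
      qed
      also have "\<dots> = ennreal (d ^ (?n + 1)) * (\<integral>\<^sup>+ \<rho>.
          \<Phi> (\<rho> *\<^sub>R unit_chart \<sigma> w) * ennreal (\<rho> ^ ?n) * indicator {0<..} \<rho> \<partial>lborel)"
        using d by (subst nn_integral_cmult) (auto simp: ennreal_mult mult.assoc)
      finally show ?thesis by (simp add: gnomonic_density_def d_def)
    qed
    have "(\<integral>\<^sup>+ t. ennreal (\<bar>t\<bar> ^ ?n) * \<Phi> (t *\<^sub>R (w, 1)) \<partial>lborel) =
      (\<integral>\<^sup>+ t. ennreal (\<bar>t\<bar> ^ ?n) * \<Phi> (t *\<^sub>R (w, 1)) * indicator {0<..} (1 * t)
          + ennreal (\<bar>t\<bar> ^ ?n) * \<Phi> (t *\<^sub>R (w, 1)) * indicator {0<..} (-1 * t) \<partial>lborel)"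
    proof (rule nn_integral_cong_AE)
      have "AE t in lborel. t \<noteq> (0::real)" by (rule AE_lborel_singleton)
      then show "AE t in lborel. ennreal (\<bar>t\<bar> ^ ?n) * \<Phi> (t *\<^sub>R (w, 1)) =
        ennreal (\<bar>t\<bar> ^ ?n) * \<Phi> (t *\<^sub>R (w, 1)) * indicator {0<..} (1 * t)
          + ennreal (\<bar>t\<bar> ^ ?n) * \<Phi> (t *\<^sub>R (w, 1)) * indicator {0<..} (-1 * t)"
        by eventually_elim (auto simp: indicator_def)
    qed
    also have "\<dots> = (\<integral>\<^sup>+ t. ennreal (\<bar>t\<bar> ^ ?n) * \<Phi> (t *\<^sub>R (w, 1)) * indicator {0<..} (1 * t) \<partial>lborel)
      + (\<integral>\<^sup>+ t. ennreal (\<bar>t\<bar> ^ ?n) * \<Phi> (t *\<^sub>R (w, 1)) * indicator {0<..} (-1 * t) \<partial>lborel)"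
      by (rule nn_integral_add) measurable
    finally show ?thesis by (simp only: half[of 1] half[of "-1"] simp_thms) (simp del: scaleR_Pair)
  qed
  have "(\<integral>\<^sup>+ x. \<Phi> x \<partial>lborel) = (\<integral>\<^sup>+ t. \<integral>\<^sup>+ y. \<Phi> (y, t) \<partial>lborel \<partial>lborel)"
    using lborel_pair.nn_integral_snd[of "\<lambda>x. \<Phi> x"] by (simp add: lborel_prod)
  also have "\<dots> = (\<integral>\<^sup>+ t. \<integral>\<^sup>+ w. ennreal (\<bar>t\<bar> ^ ?n) * \<Phi> (t *\<^sub>R (w, 1)) \<partial>lborel \<partial>lborel)"
  proof (rule nn_integral_cong_AE)
    have "AE t in lborel. t \<noteq> (0::real)" by (rule AE_lborel_singleton)
    then show "AE t in lborel. (\<integral>\<^sup>+ y. \<Phi> (y, t) \<partial>lborel) =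
        (\<integral>\<^sup>+ w. ennreal (\<bar>t\<bar> ^ ?n) * \<Phi> (t *\<^sub>R (w, 1)) \<partial>lborel)"
      by eventually_elim
        (subst nn_integral_lborel_scale, auto simp: nn_integral_cmult)
  qed
  also have "\<dots> = (\<integral>\<^sup>+ w. \<integral>\<^sup>+ t. ennreal (\<bar>t\<bar> ^ ?n) * \<Phi> (t *\<^sub>R (w, 1)) \<partial>lborel \<partial>lborel)"
    by (rule lborel_pair.Fubini') measurable
  also have "\<dots> = (\<Sum>\<sigma>\<in>{1, -1}. \<integral>\<^sup>+ w. ennreal (gnomonic_density w) * (\<integral>\<^sup>+ \<rho>.
    \<Phi> (\<rho> *\<^sub>R unit_chart \<sigma> w) * ennreal (\<rho> ^ ?n) * indicator {0<..} \<rho> \<partial>lborel) \<partial>lborel)"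
    unfolding inner by (subst nn_integral_sum) auto
  finally show ?thesis
    by (simp add: gnomonic_measure_def nn_integral_density)
qed

lemma nn_integral_polar_product:
  fixes f :: "'n::finite space \<Rightarrow> ennreal"
  assumes f [measurable]: "(\<lambda>x. f (sgn x)) \<in> borel_measurable borel"
    and g [measurable]: "g \<in> borel_measurable borel"
  shows "(\<integral>\<^sup>+ x. f (sgn x) * g (norm x) \<partial>lborel) =
    (\<Sum>\<sigma>\<in>{1, -1}. \<integral>\<^sup>+ w. f (unit_chart \<sigma> w) \<partial>gnomonic_measure) *
    (\<integral>\<^sup>+ \<rho>. g \<rho> * ennreal (\<rho> ^ CARD('n)) * indicator {0<..} \<rho> \<partial>lborel)"
proof -
  have chart: "sgn (unit_chart \<sigma> w) = unit_chart \<sigma> w" if "\<bar>\<sigma>\<bar> = 1" for \<sigma> and w :: "real ^ 'n"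
    using norm_unit_chart[OF that, of w] by (simp add: sgn_div_norm)
  have meas: "(\<lambda>w. f (unit_chart \<sigma> w)) \<in> borel_measurable borel" if "\<bar>\<sigma>\<bar> = 1" for \<sigma>
    using measurable_compose[OF measurable_chart f, of 1 \<sigma>] by (simp add: chart[OF that])
  have *: "(\<integral>\<^sup>+ \<rho>. f (sgn (\<rho> *\<^sub>R unit_chart \<sigma> w)) * g (norm (\<rho> *\<^sub>R unit_chart \<sigma> w))
        * ennreal (\<rho> ^ CARD('n)) * indicator {0<..} \<rho> \<partial>lborel) =
      f (unit_chart \<sigma> w) * (\<integral>\<^sup>+ \<rho>. g \<rho> * ennreal (\<rho> ^ CARD('n)) * indicator {0<..} \<rho> \<partial>lborel)"
    if "\<bar>\<sigma>\<bar> = 1" for \<sigma> and w :: "real ^ 'n"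
  proof -
    have "f (sgn (\<rho> *\<^sub>R unit_chart \<sigma> w)) * g (norm (\<rho> *\<^sub>R unit_chart \<sigma> w))
        * ennreal (\<rho> ^ CARD('n)) * indicator {0<..} \<rho> =
      f (unit_chart \<sigma> w) * (g \<rho> * ennreal (\<rho> ^ CARD('n)) * indicator {0<..} \<rho>)" for \<rho>
      using that by (cases "\<rho> > 0") (auto simp: sgn_scaleR chart norm_unit_chart mult.assoc)
    then show ?thesis by (simp add: nn_integral_cmult)
  qed
  have "(\<integral>\<^sup>+ x. f (sgn x) * g (norm x) \<partial>lborel) = (\<Sum>\<sigma>\<in>{1, -1}. \<integral>\<^sup>+ w. f (unit_chart \<sigma> w) *
      (\<integral>\<^sup>+ \<rho>. g \<rho> * ennreal (\<rho> ^ CARD('n)) * indicator {0<..} \<rho> \<partial>lborel) \<partial>gnomonic_measure)"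
    by (subst nn_integral_polar, measurable) (intro sum.cong refl nn_integral_cong *, auto)
  also have "\<dots> = (\<Sum>\<sigma>\<in>{1, -1}. (\<integral>\<^sup>+ w. f (unit_chart \<sigma> w) \<partial>gnomonic_measure) *
      (\<integral>\<^sup>+ \<rho>. g \<rho> * ennreal (\<rho> ^ CARD('n)) * indicator {0<..} \<rho> \<partial>lborel))"
    by (intro sum.cong refl nn_integral_multc) (auto simp: meas cong: measurable_cong_sets)
  finally show ?thesis by (simp only: sum_distrib_right)
qed

text \<open>The ball of radius two has finite volume, which in polar coordinates is a positive multiple of the
  total mass.\<close>

lemma finite_gnomonic_measure: "finite_measure (gnomonic_measure :: (real ^ 'n::finite) measure)"
proof
  let ?M = "gnomonic_measure :: (real ^ 'n) measure"
  let ?R = "\<integral>\<^sup>+ \<rho>. indicator {..2::real} \<rho> * ennreal (\<rho> ^ CARD('n)) * indicator {0<..} \<rho> \<partial>lborel"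
  have "(\<integral>\<^sup>+ x. 1 * indicator {..2} (norm (x :: 'n space)) \<partial>lborel) = (\<integral>\<^sup>+ x. indicator (cball 0 2) x \<partial>(lborel :: 'n space measure))"
    by (intro nn_integral_cong) (auto simp: indicator_def)
  also have "\<dots> < \<infinity>"
    using emeasure_bounded_finite[of "cball (0 :: 'n space) 2"] by simp
  finally have fin: "2 * emeasure ?M UNIV * ?R < \<infinity>"
    using nn_integral_polar_product[where 'n = 'n, of "\<lambda>_. 1" "indicator {..2}"]
    by (simp add: mult_2)
  have "1 = (\<integral>\<^sup>+ \<rho>. indicator {1..2::real} \<rho> \<partial>lborel)"
    by simp
  also have "\<dots> \<le> ?R"
  proof (rule nn_integral_mono)
    fix \<rho> :: real
    show "indicator {1..2} \<rho> \<le> indicator {..2} \<rho> * ennreal (\<rho> ^ CARD('n)) * indicator {0<..} \<rho>"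
    proof (cases "\<rho> \<in> {1..2}")
      case True
      then have "1 \<le> \<rho> ^ CARD('n)" by (intro one_le_power) auto
      then show ?thesis using True by auto
    qed simp
  qed
  finally have "?R \<noteq> 0" by auto
  with fin show "emeasure ?M (space ?M) \<noteq> \<infinity>"
    by (auto simp: ennreal_mult_eq_top_iff less_top[symmetric])
qed

interpretation gnomonic: finite_measure gnomonic_measure
  by (rule finite_gnomonic_measure)

lemma integrable_hemisphere:
  fixes h :: "'n::finite space \<Rightarrow> real"
  assumes "\<bar>\<sigma>\<bar> = 1" "continuous_on (closed_hemisphere \<sigma>) h"
  shows "integrable gnomonic_measure (\<lambda>w. h (unit_chart \<sigma> w))"
proof -
  have "bounded (h ` closed_hemisphere \<sigma>)"
    by (intro compact_imp_bounded compact_continuous_image assms compact_closed_hemisphere)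
  then obtain B where "\<And>p. p \<in> closed_hemisphere \<sigma> \<Longrightarrow> norm (h p) \<le> B"
    by (auto simp: bounded_iff)
  moreover have "continuous_on UNIV (\<lambda>w. h (unit_chart \<sigma> w))"
    by (rule continuous_on_compose2[OF assms(2) continuous_chart])
      (use unit_chart_in_hemisphere[OF assms(1)] in auto)
  then have "(\<lambda>w. h (unit_chart \<sigma> w)) \<in> borel_measurable gnomonic_measure"
    by (simp add: borel_measurable_continuous_onI cong: measurable_cong_sets)
  ultimately show ?thesis
    using unit_chart_in_hemisphere[OF assms(1)]
    by (intro finite_measure.integrable_const_bound[OF finite_gnomonic_measure, where B = B] AE_I2) blast+
qed

lemma integrable_sphere:
  fixes h :: "'n::finite space \<Rightarrow> real"
  assumes "\<bar>\<sigma>\<bar> = 1" "continuous_on (sphere 0 1) h"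
  shows "integrable gnomonic_measure (\<lambda>w. h (unit_chart \<sigma> w))"
  by (rule integrable_hemisphere[OF assms(1) continuous_on_subset[OF assms(2)]])
    (auto simp: closed_hemisphere_def)

lemma sphere_integral_cong:
  assumes "\<And>p. norm p = 1 \<Longrightarrow> h p = k p"
  shows "sphere_integral h = sphere_integral k"
  unfolding sphere_integral_def hemisphere_integral_def
  by (simp add: assms norm_unit_chart)

lemma hemisphere_integral_cong:
  assumes "\<bar>\<sigma>\<bar> = 1" "\<And>\<omega>. \<omega> \<in> closed_hemisphere \<sigma> \<Longrightarrow> h \<omega> = k \<omega>"
  shows "hemisphere_integral \<sigma> h = hemisphere_integral \<sigma> k"
  unfolding hemisphere_integral_def using assms(2)[OF unit_chart_in_hemisphere[OF assms(1)]] by simp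

lemma sphere_integral_add:
  "continuous_on (sphere 0 1) h \<Longrightarrow> continuous_on (sphere 0 1) k \<Longrightarrow>
    sphere_integral (\<lambda>p. h p + k p) = sphere_integral h + sphere_integral k"
  unfolding sphere_integral_def hemisphere_integral_def by (simp add: integrable_sphere)

lemma sphere_integral_cmult: "sphere_integral (\<lambda>p. c * h p) = c * sphere_integral h"
  unfolding sphere_integral_def hemisphere_integral_def by (simp add: distrib_left)

lemma sphere_integral_diff:
  "continuous_on (sphere 0 1) h \<Longrightarrow> continuous_on (sphere 0 1) k \<Longrightarrow>
    sphere_integral (\<lambda>p. h p - k p) = sphere_integral h - sphere_integral k"
  unfolding sphere_integral_def hemisphere_integral_def by (simp add: integrable_sphere)

lemma sphere_integral_mono:
  "continuous_on (sphere 0 1) h \<Longrightarrow> continuous_on (sphere 0 1) k \<Longrightarrow>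
    (\<And>p. norm p = 1 \<Longrightarrow> h p \<le> k p) \<Longrightarrow> sphere_integral h \<le> sphere_integral k"
  unfolding sphere_integral_def hemisphere_integral_def
  by (intro add_mono integral_mono) (auto simp: integrable_sphere norm_unit_chart)

lemma sphere_integral_reflect: "sphere_integral (\<lambda>p. h (- p)) = sphere_integral h"
  unfolding sphere_integral_def hemisphere_integral_def
  by (simp add: unit_chart_uminus[symmetric])

lemma measurable_compose_sgn:
  fixes h :: "'a::euclidean_space \<Rightarrow> real"
  assumes "continuous_on (sphere 0 1) h"
  shows "(\<lambda>x. h (sgn x)) \<in> borel_measurable borel"
proof (rule borel_measurable_continuous_countable_exceptions)
  show "countable {0 :: 'a}" by simp
  show "continuous_on (- {0}) (\<lambda>x. h (sgn x))"
    by (rule continuous_on_compose2[OF assms])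
      (auto simp: norm_sgn split: if_splits intro!: continuous_intros)
qed

definition radial_integral :: "nat \<Rightarrow> (real \<Rightarrow> real) \<Rightarrow> real" where
  "radial_integral n \<psi> = (LINT \<rho>|lborel. \<psi> \<rho> * \<rho> ^ n * indicator {0<..} \<rho>)"

lemma has_bochner_integral_polar_nonneg:
  fixes h :: "'n::finite space \<Rightarrow> real"
  assumes h: "continuous_on (sphere 0 1) h" and \<psi>[measurable]: "\<psi> \<in> borel_measurable borel"
    and int: "integrable lborel (\<lambda>\<rho>. \<psi> \<rho> * \<rho> ^ CARD('n) * indicator {0<..} \<rho>)"
    and nonneg: "\<And>p. 0 \<le> h p" "\<And>\<rho>. 0 \<le> \<psi> \<rho>"
  shows "has_bochner_integral lborel (\<lambda>x. h (sgn x) * \<psi> (norm x))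
    (sphere_integral h * radial_integral CARD('n) \<psi>)"
proof -
  have "(\<integral>\<^sup>+ w. ennreal (h (unit_chart \<sigma> w)) \<partial>gnomonic_measure) = ennreal (hemisphere_integral \<sigma> h)"
    if "\<bar>\<sigma>\<bar> = 1" for \<sigma>
    unfolding hemisphere_integral_def
    using integrable_sphere[OF that h] nonneg by (intro nn_integral_eq_integral) auto
  moreover have hemi: "0 \<le> hemisphere_integral \<sigma> h" for \<sigma>
    unfolding hemisphere_integral_def using nonneg by (intro integral_nonneg_AE) auto
  ultimately have 1: "(\<Sum>\<sigma>\<in>{1, -1}. \<integral>\<^sup>+ w. ennreal (h (unit_chart \<sigma> w)) \<partial>gnomonic_measure) =
      ennreal (sphere_integral h)"
    by (simp add: sphere_integral_def ennreal_plus)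
  have "(\<integral>\<^sup>+ \<rho>. ennreal (\<psi> \<rho>) * ennreal (\<rho> ^ CARD('n)) * indicator {0<..} \<rho> \<partial>lborel) =
      (\<integral>\<^sup>+ \<rho>. ennreal (\<psi> \<rho> * \<rho> ^ CARD('n) * indicator {0<..} \<rho>) \<partial>lborel)"
    using nonneg by (intro nn_integral_cong) (auto simp: indicator_def ennreal_mult)
  also have "\<dots> = ennreal (radial_integral CARD('n) \<psi>)"
    unfolding radial_integral_def
    using nonneg by (intro nn_integral_eq_integral int) (auto simp: indicator_def)
  finally have 2: "(\<integral>\<^sup>+ \<rho>. ennreal (\<psi> \<rho>) * ennreal (\<rho> ^ CARD('n)) * indicator {0<..} \<rho> \<partial>lborel) =
      ennreal (radial_integral CARD('n) \<psi>)" .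
  have [measurable]: "(\<lambda>x. h (sgn x)) \<in> borel_measurable borel"
    by (rule measurable_compose_sgn[OF h])
  have 3: "0 \<le> sphere_integral h" using hemi by (simp add: sphere_integral_def)
  have 4: "0 \<le> radial_integral CARD('n) \<psi>"
    unfolding radial_integral_def using nonneg by (intro integral_nonneg_AE) (auto simp: indicator_def)
  show ?thesis
  proof (rule has_bochner_integral_nn_integral)
    show "(\<integral>\<^sup>+ x. ennreal (h (sgn x) * \<psi> (norm x)) \<partial>lborel) =
        ennreal (sphere_integral h * radial_integral CARD('n) \<psi>)"
      using nn_integral_polar_product[of "\<lambda>x. ennreal (h x)" "\<lambda>\<rho>. ennreal (\<psi> \<rho>)"] nonneg
      by (simp add: ennreal_mult 1[simplified] 2 3 4)
  qed (use nonneg 3 4 in \<open>auto intro!: mult_nonneg_nonneg\<close>)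
qed

text \<open>The general case follows by splitting both factors into positive and negative parts.\<close>

lemma has_bochner_integral_polar:
  fixes h :: "'n::finite space \<Rightarrow> real"
  assumes h: "continuous_on (sphere 0 1) h" and \<psi>: "\<psi> \<in> borel_measurable borel"
    and int: "integrable lborel (\<lambda>\<rho>. \<psi> \<rho> * \<rho> ^ CARD('n) * indicator {0<..} \<rho>)"
  shows "has_bochner_integral lborel (\<lambda>x. h (sgn x) * \<psi> (norm x))
    (sphere_integral h * radial_integral CARD('n) \<psi>)"
proof -
  let ?n = "CARD('n)"
  have parts: "t = max 0 t - max 0 (- t)" for t :: real by (simp add: max_def)
  have \<psi>': "(\<lambda>\<rho>. max 0 (s * \<psi> \<rho>)) \<in> borel_measurable borel"
    "integrable lborel (\<lambda>\<rho>. max 0 (s * \<psi> \<rho>) * \<rho> ^ ?n * indicator {0<..} \<rho>)" for s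
  proof -
    show m: "(\<lambda>\<rho>. max 0 (s * \<psi> \<rho>)) \<in> borel_measurable borel" using \<psi> by measurable
    show "integrable lborel (\<lambda>\<rho>. max 0 (s * \<psi> \<rho>) * \<rho> ^ ?n * indicator {0<..} \<rho>)"
    proof (rule Bochner_Integration.integrable_bound[OF integrable_mult_right[OF int, of s]])
      show "AE \<rho> in lborel. norm (max 0 (s * \<psi> \<rho>) * \<rho> ^ ?n * indicator {0<..} \<rho>)
          \<le> norm (s * (\<psi> \<rho> * \<rho> ^ ?n * indicator {0<..} \<rho>))"
      proof (rule AE_I2)
        fix \<rho>
        have "norm (max 0 (s * \<psi> \<rho>)) * norm (\<rho> ^ ?n * indicator {0<..} \<rho>)
            \<le> norm (s * \<psi> \<rho>) * norm (\<rho> ^ ?n * indicator {0<..} \<rho>)"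
          by (intro mult_right_mono) (simp_all add: max_def)
        then show "norm (max 0 (s * \<psi> \<rho>) * \<rho> ^ ?n * indicator {0<..} \<rho>)
            \<le> norm (s * (\<psi> \<rho> * \<rho> ^ ?n * indicator {0<..} \<rho>))"
          by (simp only: norm_mult[symmetric] mult.assoc)
      qed
    qed (use m in measurable)
  qed
  have h': "continuous_on (sphere 0 1) (\<lambda>p. max 0 (s * h p))" for s
    using h by (intro continuous_intros)
  have rad: "radial_integral ?n \<psi> = radial_integral ?n (\<lambda>\<rho>. max 0 (1 * \<psi> \<rho>)) - radial_integral ?n (\<lambda>\<rho>. max 0 (-1 * \<psi> \<rho>))"
    unfolding radial_integral_def
    by (subst Bochner_Integration.integral_diff[symmetric, OF \<psi>'(2) \<psi>'(2)])
      (auto intro!: Bochner_Integration.integral_cong simp: left_diff_distrib[symmetric] max_def)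
  have sph: "sphere_integral h = sphere_integral (\<lambda>p. max 0 (1 * h p)) - sphere_integral (\<lambda>p. max 0 (-1 * h p))"
    by (subst sphere_integral_diff[symmetric, OF h' h']) (auto intro!: sphere_integral_cong simp: max_def)
  have base: "has_bochner_integral lborel (\<lambda>x. max 0 (s * h (sgn x)) * max 0 (t * \<psi> (norm x)))
    (sphere_integral (\<lambda>p. max 0 (s * h p)) * radial_integral ?n (\<lambda>\<rho>. max 0 (t * \<psi> \<rho>)))" for s t
    using has_bochner_integral_polar_nonneg[OF h' \<psi>', of s t] by simp
  have "has_bochner_integral lborel (\<lambda>x.
      (max 0 (1 * h (sgn x)) * max 0 (1 * \<psi> (norm x)) - max 0 (-1 * h (sgn x)) * max 0 (1 * \<psi> (norm x))) -
      (max 0 (1 * h (sgn x)) * max 0 (-1 * \<psi> (norm x)) - max 0 (-1 * h (sgn x)) * max 0 (-1 * \<psi> (norm x))))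
    ((sphere_integral (\<lambda>p. max 0 (1 * h p)) * radial_integral ?n (\<lambda>\<rho>. max 0 (1 * \<psi> \<rho>)) -
      sphere_integral (\<lambda>p. max 0 (-1 * h p)) * radial_integral ?n (\<lambda>\<rho>. max 0 (1 * \<psi> \<rho>))) -
     (sphere_integral (\<lambda>p. max 0 (1 * h p)) * radial_integral ?n (\<lambda>\<rho>. max 0 (-1 * \<psi> \<rho>)) -
      sphere_integral (\<lambda>p. max 0 (-1 * h p)) * radial_integral ?n (\<lambda>\<rho>. max 0 (-1 * \<psi> \<rho>))))"
    by (intro has_bochner_integral_diff base)
  moreover have "(\<lambda>x. (max 0 (1 * h (sgn x)) * max 0 (1 * \<psi> (norm x)) - max 0 (-1 * h (sgn x)) * max 0 (1 * \<psi> (norm x))) -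
      (max 0 (1 * h (sgn x)) * max 0 (-1 * \<psi> (norm x)) - max 0 (-1 * h (sgn x)) * max 0 (-1 * \<psi> (norm x))))
    = (\<lambda>x. h (sgn x) * \<psi> (norm x))"
    by (auto simp: max_def)
  ultimately show ?thesis by (simp only: rad sph left_diff_distrib right_diff_distrib)
qed

lemma sphere_integral_1_pos: "0 < sphere_integral (\<lambda>p :: 'n::finite space. 1)"
proof -
  have "emeasure (gnomonic_measure :: (real ^ 'n) measure) UNIV \<noteq> 0"
  proof -
    have "ennreal (gnomonic_density w) \<noteq> 0" for w :: "real ^ 'n"
      using gnomonic_density_pos[of w] by (simp add: ennreal_eq_0_iff)
    then show ?thesis
      by (simp add: gnomonic_measure_def emeasure_density nn_integral_0_iff_AE eventually_False
          ae_filter_eq_bot_iff)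
  qed
  then have "0 < measure (gnomonic_measure :: (real ^ 'n) measure) UNIV"
    by (simp add: gnomonic.emeasure_eq_measure zero_less_measure_iff)
  then show ?thesis by (simp add: sphere_integral_def hemisphere_integral_def)
qed

subsection \<open>Parameter derivatives of hemisphere integrals\<close>

text \<open>A closed hemisphere is compact, so the parameter derivative is bounded on it by a constant.\<close>

lemma has_real_derivative_hemisphere_integral:
  fixes q :: "real \<times> 'n::finite space \<Rightarrow> real"
  assumes q: "C_on (Suc k) U q"
    and sub: "{-\<delta>..\<delta>} \<times> closed_hemisphere \<sigma> \<subseteq> U" and \<sigma>: "\<bar>\<sigma>\<bar> = 1" and s: "s \<in> {-\<delta><..<\<delta>}"
  shows "((\<lambda>s. hemisphere_integral \<sigma> (\<lambda>p. q (s, p))) has_real_derivative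
    hemisphere_integral \<sigma> (\<lambda>p. dir_deriv (1, 0) q (s, p))) (at s)"
proof -
  have "compact ({-\<delta>..\<delta>} \<times> (closed_hemisphere \<sigma> :: 'n space set))"
    by (intro compact_Times compact_closed_hemisphere compact_Icc)
  moreover have "continuous_on ({-\<delta>..\<delta>} \<times> closed_hemisphere \<sigma>) (dir_deriv (1, 0) q)"
    by (rule continuous_on_subset[OF C_on_imp_continuous_on[OF C_on_dir_deriv[OF q]] sub])
  ultimately have "bounded (dir_deriv (1, 0) q ` ({-\<delta>..\<delta>} \<times> closed_hemisphere \<sigma>))"
    by (intro compact_imp_bounded compact_continuous_image)
  then obtain B where B: "norm (dir_deriv (1, 0) q z) \<le> B"
    if "z \<in> {-\<delta>..\<delta>} \<times> closed_hemisphere \<sigma>" for z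
    by (auto simp: bounded_iff)
  note chart = unit_chart_in_hemisphere[OF \<sigma>]
  show ?thesis
    unfolding hemisphere_integral_def
  proof (rule has_real_derivative_integral[OF s, where g = "\<lambda>_. B"])
    fix t and w :: "real ^ 'n" assume t: "t \<in> {-\<delta><..<\<delta>}"
    then have mem: "(t, unit_chart \<sigma> w) \<in> {-\<delta>..\<delta>} \<times> closed_hemisphere \<sigma>"
      using chart[of w] by auto
    show "((\<lambda>t. q (t, unit_chart \<sigma> w)) has_real_derivative
        dir_deriv (1, 0) q (t, unit_chart \<sigma> w)) (at t)"
      using has_vector_derivative_slice[OF q subsetD[OF sub mem]]
      by (simp add: has_real_derivative_iff_has_vector_derivative)
    show "\<bar>dir_deriv (1, 0) q (t, unit_chart \<sigma> w)\<bar> \<le> B"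
      using B[OF mem] by simp
  next
    fix t assume t: "t \<in> {-\<delta><..<\<delta>}"
    have "continuous_on (closed_hemisphere \<sigma>) (\<lambda>p. q (t, p))"
      by (rule continuous_on_compose2[OF C_on_imp_continuous_on[OF q]])
        (use t sub in \<open>auto intro!: continuous_intros\<close>)
    from integrable_hemisphere[OF \<sigma> this]
    show "integrable gnomonic_measure (\<lambda>w. q (t, unit_chart \<sigma> w))" .
  qed simp
qed

lemma has_real_derivative_sphere_integral:
  fixes q :: "real \<times> 'n::finite space \<Rightarrow> real"
  assumes "C_on (Suc k) U q" "{-\<delta>..\<delta>} \<times> sphere 0 1 \<subseteq> U" "s \<in> {-\<delta><..<\<delta>}"
  shows "((\<lambda>s. sphere_integral (\<lambda>p. q (s, p))) has_real_derivative
    sphere_integral (\<lambda>p. dir_deriv (1, 0) q (s, p))) (at s)"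
proof -
  have "{-\<delta>..\<delta>} \<times> closed_hemisphere \<sigma> \<subseteq> U" for \<sigma>
    using assms(2) by (auto simp: closed_hemisphere_def)
  then show ?thesis
    unfolding sphere_integral_def
    by (intro DERIV_add has_real_derivative_hemisphere_integral[OF assms(1) _ _ assms(3)]) auto
qed

section \<open>The divergence theorem on the sphere\<close>

subsection \<open>Homogeneous extensions\<close>

text \<open>Away from the origin the function is constant on rays, that is, it extends a function on the unit
  sphere.\<close>

definition homogeneous0 :: "('a::real_normed_vector \<Rightarrow> 'b) \<Rightarrow> bool" where
  "homogeneous0 W \<longleftrightarrow> (\<forall>x. x \<noteq> 0 \<longrightarrow> W (sgn x) = W x)"

lemma homogeneous0D: "homogeneous0 W \<Longrightarrow> x \<noteq> 0 \<Longrightarrow> W (sgn x) = W x"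
  unfolding homogeneous0_def by blast

lemma homogeneous0_scale: "homogeneous0 W \<Longrightarrow> 0 < t \<Longrightarrow> x \<noteq> 0 \<Longrightarrow> W (t *\<^sub>R x) = W x"
  unfolding homogeneous0_def
  by (frule spec[of _ x], drule spec[of _ "t *\<^sub>R x"]) (simp add: sgn_scaleR)

lemma dir_deriv_homogeneous0:
  fixes W :: "'a::euclidean_space \<Rightarrow> 'b::real_normed_vector"
  assumes W: "C_on (Suc k) (- {0}) W" and hom: "homogeneous0 W" and x: "x \<noteq> 0"
  shows "dir_deriv v W x = inverse (norm x) *\<^sub>R dir_deriv v W (sgn x)"
proof -
  have "((\<lambda>y. inverse (norm x) *\<^sub>R y) has_derivative (\<lambda>v. inverse (norm x) *\<^sub>R v)) (at x)"
    by (auto intro!: derivative_eq_intros)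
  moreover have "(W has_derivative (\<lambda>v. dir_deriv v W (sgn x))) (at (inverse (norm x) *\<^sub>R x))"
    using C_on_imp_differentiable[OF W, of "sgn x"] x by (simp add: sgn_div_norm)
  ultimately have "((\<lambda>y. W (inverse (norm x) *\<^sub>R y)) has_derivative
      (\<lambda>v. dir_deriv (inverse (norm x) *\<^sub>R v) W (sgn x))) (at x)"
    by (rule has_derivative_compose)
  then have "(W has_derivative (\<lambda>v. dir_deriv (inverse (norm x) *\<^sub>R v) W (sgn x))) (at x)"
    by (rule has_derivative_transform_within_open[where s = "- {0}"])
      (use x homogeneous0_scale[OF hom, of "inverse (norm x)"] in auto)
  from frechet_derivative_at[OF this]
  have "dir_deriv v W x = dir_deriv (inverse (norm x) *\<^sub>R v) W (sgn x)" by metis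
  moreover have "linear (\<lambda>v. dir_deriv v W (sgn x))"
    using C_on_imp_differentiable[OF W, of "sgn x"] x has_derivative_linear
    by (auto simp: sgn_zero_iff)
  ultimately show ?thesis by (simp add: linear_scale)
qed

lemma dir_deriv_radial:
  fixes W :: "'a::euclidean_space \<Rightarrow> 'b::real_normed_vector"
  assumes W: "C_on (Suc k) (- {0}) W" and hom: "homogeneous0 W" and x: "x \<noteq> 0"
  shows "dir_deriv x W x = 0"
proof -
  have "((\<lambda>a::real. (1 + a) *\<^sub>R x) has_derivative (\<lambda>t. t *\<^sub>R x)) (at 0)"
    by (auto intro!: derivative_eq_intros)
  moreover have "(W has_derivative (\<lambda>v. dir_deriv v W x)) (at ((1 + 0) *\<^sub>R x))"
    using C_on_imp_differentiable[OF W, of x] x by simp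
  ultimately have "((\<lambda>a::real. W ((1 + a) *\<^sub>R x)) has_derivative (\<lambda>t. dir_deriv (t *\<^sub>R x) W x)) (at 0)"
    by (rule has_derivative_compose)
  then have "((\<lambda>a::real. W x) has_derivative (\<lambda>t. dir_deriv (t *\<^sub>R x) W x)) (at 0)"
    by (rule has_derivative_transform_within_open[where s = "{-1<..}"])
      (use x in \<open>auto intro!: homogeneous0_scale[OF hom]\<close>)
  moreover have "((\<lambda>a::real. W x) has_derivative (\<lambda>t. 0)) (at 0)" by simp
  ultimately have "(\<lambda>t::real. dir_deriv (t *\<^sub>R x) W x) = (\<lambda>t. 0)"
    by (rule has_derivative_unique)
  from fun_cong[OF this, of 1] show ?thesis by simp
qed

lemma homogeneous0_sgn: "homogeneous0 (sgn :: 'a::real_normed_vector \<Rightarrow> 'a)"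
  unfolding homogeneous0_def by (simp add: sgn_div_norm)

lemma has_derivative_sgn:
  fixes x :: "'a::euclidean_space"
  assumes "x \<noteq> 0"
  shows "(sgn has_derivative (\<lambda>v. inverse (norm x) *\<^sub>R (v - (sgn x \<bullet> v) *\<^sub>R sgn x))) (at x)"
proof -
  have "((\<lambda>x. inverse (norm x)) has_derivative
      (\<lambda>v. - (inverse (norm x) * (v \<bullet> sgn x) * inverse (norm x)))) (at x)"
    by (rule Deriv.has_derivative_inverse[OF _ has_derivative_norm]) (use assms in auto)
  from has_derivative_scaleR[OF this has_derivative_ident]
  have "((\<lambda>x. inverse (norm x) *\<^sub>R x) has_derivative
      (\<lambda>v. inverse (norm x) *\<^sub>R v + (- (inverse (norm x) * (v \<bullet> sgn x) * inverse (norm x))) *\<^sub>R x)) (at x)" .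
  moreover have "inverse (norm x) *\<^sub>R v + (- (inverse (norm x) * (v \<bullet> sgn x) * inverse (norm x))) *\<^sub>R x
      = inverse (norm x) *\<^sub>R (v - (sgn x \<bullet> v) *\<^sub>R sgn x)" for v
    by (simp add: sgn_div_norm scaleR_diff_right inner_commute)
  ultimately show ?thesis by (simp only: sgn_div_norm[abs_def])
qed

lemma dir_deriv_sgn: "x \<noteq> 0 \<Longrightarrow>
    dir_deriv v sgn x = inverse (norm x) *\<^sub>R (v - (sgn x \<bullet> v) *\<^sub>R sgn (x :: 'a::euclidean_space))"
  using frechet_derivative_at[OF has_derivative_sgn, of x] by metis

lemma C_on_sgn_punctured: "C_on k (- {0}) (sgn :: 'a::euclidean_space \<Rightarrow> 'a)"
  by (rule C_on_sgn) (auto intro: C_on_ident)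

subsection \<open>Integrals of derivatives of compactly supported functions\<close>

lemma integral_lborel_translate:
  fixes f :: "'a::euclidean_space \<Rightarrow> real"
  assumes "f \<in> borel_measurable borel"
  shows "(LINT x|lborel. f (c + x)) = (LINT x|lborel. f x)"
  by (subst (2) lborel_distr_plus[of c, symmetric]) (simp add: integral_distr assms)

text \<open>The integral of a function over the whole space does not change when the function is translated;
  differentiating this in the direction of the translation gives the claim.\<close>

lemma integral_dir_deriv_eq_0:
  fixes \<Phi> :: "'a::euclidean_space \<Rightarrow> real"
  assumes der: "\<And>x. (\<Phi> has_derivative \<Phi>' x) (at x)"
    and cont: "continuous_on UNIV (\<lambda>x. \<Phi>' x b)"
    and supp: "\<And>x. R < norm x \<Longrightarrow> \<Phi> x = 0" "\<And>x. R < norm x \<Longrightarrow> \<Phi>' x b = 0"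
  shows "has_bochner_integral lborel (\<lambda>x. \<Phi>' x b) 0"
proof -
  have c0: "continuous_on UNIV \<Phi>"
    using der by (auto intro!: continuous_at_imp_continuous_on has_derivative_continuous)
  have meas [measurable]: "\<Phi> \<in> borel_measurable borel" "(\<lambda>x. \<Phi>' x b) \<in> borel_measurable borel"
    using c0 cont by (auto intro: borel_measurable_continuous_onI)
  have bounded: "\<exists>B. \<forall>x. \<bar>f x\<bar> \<le> B" if f: "continuous_on UNIV f" "\<And>x. R < norm x \<Longrightarrow> f x = 0"
    for f :: "'a \<Rightarrow> real"
  proof -
    have "bounded (f ` cball 0 R)"
      by (intro compact_imp_bounded compact_continuous_image continuous_on_subset[OF f(1)]) auto
    then obtain B where B: "\<And>x. x \<in> cball 0 R \<Longrightarrow> norm (f x) \<le> B"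
      unfolding bounded_iff by blast
    have "\<bar>f x\<bar> \<le> max 0 B" for x
      using B[of x] f(2)[of x] by (cases "norm x \<le> R") (auto simp: max_def)
    then show ?thesis by blast
  qed
  obtain B where B: "\<And>x. \<bar>\<Phi> x\<bar> \<le> B" using bounded[OF c0 supp(1)] by blast
  obtain B' where B': "\<And>x. \<bar>\<Phi>' x b\<bar> \<le> B'" using bounded[OF cont supp(2)] by blast
  let ?K = "cball (0::'a) (R + norm b)"
  have K: "emeasure lborel ?K < \<infinity>" by (rule emeasure_bounded_finite) simp
  have out: "R < norm (x + t *\<^sub>R b)" if "\<bar>t\<bar> \<le> 1" "x \<notin> ?K" for t x
  proof -
    have "norm x \<le> norm (x + t *\<^sub>R b) + norm (t *\<^sub>R b)"
      using norm_triangle_ineq4[of "x + t *\<^sub>R b" "t *\<^sub>R b"] by simp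
    moreover have "norm (t *\<^sub>R b) \<le> norm b"
      using mult_right_mono[OF that(1), of "norm b"] by simp
    ultimately show ?thesis using that(2) by simp
  qed
  have int: "integrable lborel (\<lambda>x. f (x + t *\<^sub>R b))"
    if "\<bar>t\<bar> \<le> 1" "f \<in> borel_measurable borel" "\<And>x. \<bar>f x\<bar> \<le> C" "\<And>x. R < norm x \<Longrightarrow> f x = 0"
    for t C and f :: "'a \<Rightarrow> real"
    by (rule integrableI_bounded_set[where A = ?K and B = C])
      (use that K out in \<open>auto intro!: AE_I2 measurable_compose[OF _ that(2)]\<close>)
  have "((\<lambda>t. LINT x|lborel. \<Phi> (x + t *\<^sub>R b)) has_real_derivative
      (LINT x|lborel. \<Phi>' (x + 0 *\<^sub>R b) b)) (at 0)"
  proof (rule has_real_derivative_integral[where a = "-1" and b = 1 and g = "\<lambda>x. B' * indicator ?K x"])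
    fix t :: real and x assume t: "t \<in> {-1<..<1}"
    have "((\<lambda>t. x + t *\<^sub>R b) has_derivative (\<lambda>t. t *\<^sub>R b)) (at t)"
      by (auto intro!: derivative_eq_intros)
    from has_derivative_compose[OF this der]
    show "((\<lambda>t. \<Phi> (x + t *\<^sub>R b)) has_real_derivative \<Phi>' (x + t *\<^sub>R b) b) (at t)"
      using linear_scale[OF has_derivative_linear[OF der]]
      by (simp add: has_field_derivative_def mult_commute_abs)
    show "\<bar>\<Phi>' (x + t *\<^sub>R b) b\<bar> \<le> B' * indicator ?K x"
      using B'[of "x + t *\<^sub>R b"] supp(2)[OF out[of t x]] t by (auto simp: indicator_def)
  next
    show "integrable lborel (\<lambda>x. B' * indicator ?K x)"
      using K by (intro integrable_mult_right integrable_real_indicator) auto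
  qed (use int[OF _ meas(1) B supp(1)] in auto)
  moreover have "(LINT x|lborel. \<Phi> (x + t *\<^sub>R b)) = (LINT x|lborel. \<Phi> x)" for t
    using integral_lborel_translate[OF meas(1), of "t *\<^sub>R b"] by (simp add: add.commute)
  ultimately have "((\<lambda>t::real. LINT x|lborel. \<Phi> x) has_real_derivative (LINT x|lborel. \<Phi>' x b)) (at 0)"
    by simp
  then have "(LINT x|lborel. \<Phi>' x b) = 0"
    by (rule DERIV_unique[OF _ DERIV_const])
  moreover have "integrable lborel (\<lambda>x. \<Phi>' x b)"
    using int[of 0, OF _ meas(2) B' supp(2)] by simp
  ultimately show ?thesis by (simp add: has_bochner_integral_iff)
qed

subsection \<open>A radial cutoff\<close>

text \<open>Applied to the squared norm this is a continuously differentiable function supported in the annulus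
  between radii one and two, away from the singularity of a homogeneous field at the origin.\<close>

definition cutoff :: "real \<Rightarrow> real" where
  "cutoff t = (max 0 ((t - 1) * (4 - t)))\<^sup>2"

definition cutoff' :: "real \<Rightarrow> real" where
  "cutoff' t = 2 * max 0 ((t - 1) * (4 - t)) * (5 - 2 * t)"

lemma has_real_derivative_cutoff: "(cutoff has_real_derivative cutoff' t) (at t)"
proof -
  have sq: "((\<lambda>t::real. (max 0 t)\<^sup>2) has_real_derivative 2 * max 0 t) (at t)" for t
  proof (cases t "0::real" rule: linorder_cases)
    case less
    have "((\<lambda>t::real. 0) has_real_derivative 0) (at t)" by simp
    then have "((\<lambda>t::real. (max 0 t)\<^sup>2) has_real_derivative 0) (at t)"
      by (rule has_field_derivative_transform_within_open[where S = "{..<0}"]) (use less in auto)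
    then show ?thesis using less by simp
  next
    case greater
    have "((\<lambda>t::real. t\<^sup>2) has_real_derivative 2 * t) (at t)"
      by (auto intro!: derivative_eq_intros)
    then have "((\<lambda>t::real. (max 0 t)\<^sup>2) has_real_derivative 2 * t) (at t)"
      by (rule has_field_derivative_transform_within_open[where S = "{0<..}"]) (use greater in auto)
    then show ?thesis using greater by simp
  next
    case equal
    have "((\<lambda>t::real. (max 0 t)\<^sup>2 / t) \<longlongrightarrow> 0) (at 0)"
    proof (rule tendsto_0_le[where K = 1 and f = "\<lambda>t. t"])
      show "\<forall>\<^sub>F t in at (0::real). norm ((max 0 t)\<^sup>2 / t) \<le> norm t * 1"
        by (auto simp: max_def power2_eq_square)
    qed (auto intro!: tendsto_eq_intros)
    then show ?thesis using equal by (simp add: has_field_derivative_iff)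
  qed
  show ?thesis
    unfolding cutoff_def cutoff'_def
    by (rule DERIV_cong[OF DERIV_chain2[OF sq]]) (auto intro!: derivative_eq_intros)
qed

lemma cutoff_outside: "t \<notin> {1<..<4} \<Longrightarrow> cutoff t = 0 \<and> cutoff' t = 0"
proof -
  assume "t \<notin> {1<..<4}"
  then have "(t - 1) * (4 - t) \<le> 0" by (auto simp: mult_le_0_iff)
  then show ?thesis by (simp add: cutoff_def cutoff'_def max_def)
qed

lemma cutoff_pos: "t \<in> {1<..<4} \<Longrightarrow> 0 < cutoff t"
  unfolding cutoff_def by (simp add: max_def mult_less_0_iff not_le)

lemma continuous_cutoff: "continuous_on A cutoff" "continuous_on A cutoff'"
  unfolding cutoff_def[abs_def] cutoff'_def[abs_def] by (intro continuous_intros)+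

lemma square_in_cutoff_range: "0 < \<rho> \<Longrightarrow> \<rho>\<^sup>2 \<in> {1<..<4} \<longleftrightarrow> \<rho> \<in> {1<..<2}" for \<rho> :: real
  using power2_less_imp_less[of 1 \<rho>] power2_less_imp_less[of \<rho> 2]
    power_strict_mono[of 1 \<rho> 2] power_strict_mono[of \<rho> 2 2] by auto

lemma integrable_radial:
  fixes \<psi> :: "real \<Rightarrow> real"
  assumes "continuous_on {0<..} \<psi>" "\<And>\<rho>. 0 < \<rho> \<Longrightarrow> \<rho> \<notin> {1<..<2} \<Longrightarrow> \<psi> \<rho> = 0"
  shows "integrable lborel (\<lambda>\<rho>. \<psi> \<rho> * \<rho> ^ n * indicator {0<..} \<rho>)"
proof -
  have c: "continuous_on {1..2} \<psi>" by (rule continuous_on_subset[OF assms(1)]) auto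
  have "integrable lborel (\<lambda>\<rho>. indicator {1..2} \<rho> *\<^sub>R (\<psi> \<rho> * \<rho> ^ n))"
    by (intro borel_integrable_compact continuous_intros c) simp
  moreover have "(\<lambda>\<rho>. indicator {1..2} \<rho> *\<^sub>R (\<psi> \<rho> * \<rho> ^ n)) = (\<lambda>\<rho>. \<psi> \<rho> * \<rho> ^ n * indicator {0<..} \<rho>)"
  proof (rule ext)
    fix \<rho> :: real
    show "indicator {1..2} \<rho> *\<^sub>R (\<psi> \<rho> * \<rho> ^ n) = \<psi> \<rho> * \<rho> ^ n * indicator {0<..} \<rho>"
      using assms(2)[of \<rho>] by (cases "\<rho> \<in> {1..2}") (auto simp: indicator_def)
  qed
  ultimately show ?thesis by simp
qed

lemma measurable_cutoff [measurable]:
  "cutoff \<in> borel_measurable borel" "cutoff' \<in> borel_measurable borel"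
  using continuous_cutoff by (auto intro: borel_measurable_continuous_onI)

lemma continuous_cutoff_compose:
  assumes "continuous_on A f"
  shows "continuous_on A (\<lambda>x. cutoff (f x))" "continuous_on A (\<lambda>x. cutoff' (f x))"
  using continuous_on_compose2[OF continuous_cutoff(1)[of UNIV] assms]
    continuous_on_compose2[OF continuous_cutoff(2)[of UNIV] assms] by auto

lemma cutoff_square_outside:
  "0 < \<rho> \<Longrightarrow> \<rho> \<notin> {1<..<2} \<Longrightarrow> cutoff (\<rho>\<^sup>2) = 0 \<and> cutoff' (\<rho>\<^sup>2) = 0"
  using cutoff_outside[of "\<rho>\<^sup>2"] square_in_cutoff_range[of \<rho>] by blast

lemma integrable_cutoff:
  "integrable lborel (\<lambda>\<rho>. cutoff (\<rho>\<^sup>2) / \<rho> * \<rho> ^ n * indicator {0<..} \<rho>)"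
  "integrable lborel (\<lambda>\<rho>. 2 * \<rho> * cutoff' (\<rho>\<^sup>2) * \<rho> ^ n * indicator {0<..} \<rho>)"
  by (rule integrable_radial; use cutoff_square_outside in
      \<open>force intro!: continuous_intros continuous_cutoff_compose\<close>)+

lemma radial_integral_cutoff_pos: "0 < radial_integral n (\<lambda>\<rho>. cutoff (\<rho>\<^sup>2) / \<rho>)"
proof -
  let ?f = "\<lambda>\<rho>. cutoff (\<rho>\<^sup>2) / \<rho> * \<rho> ^ n * indicator {0<..} \<rho>"
  have nonneg: "0 \<le> ?f \<rho>" for \<rho>
    by (auto simp: indicator_def cutoff_def)
  have "integral\<^sup>L lborel ?f \<noteq> 0"
  proof
    assume "integral\<^sup>L lborel ?f = 0"
    then have "AE \<rho> in lborel. ?f \<rho> = 0"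
      using integral_nonneg_eq_0_iff_AE[OF integrable_cutoff(1) AE_I2[OF nonneg]] by simp
    then have "AE \<rho> in lborel. \<rho> \<notin> {1<..<2::real}"
    proof eventually_elim
      case (elim \<rho>)
      then show ?case
        using square_in_cutoff_range[of \<rho>] cutoff_pos[of "\<rho>\<^sup>2"] by (auto simp: indicator_def)
    qed
    then have "{1<..<2::real} \<in> null_sets lborel"
      by (subst AE_iff_null_sets) auto
    then show False by (auto simp: null_sets_def)
  qed
  moreover have "0 \<le> integral\<^sup>L lborel ?f" using nonneg by (intro integral_nonneg_AE) auto
  ultimately show ?thesis by (simp add: radial_integral_def)
qed

subsection \<open>Divergence and radial component\<close>

definition divergence :: "('a::euclidean_space \<Rightarrow> 'a) \<Rightarrow> 'a \<Rightarrow> real" where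
  "divergence W x = (\<Sum>b\<in>Basis. dir_deriv b W x \<bullet> b)"

lemma continuous_divergence:
  assumes "C_on (Suc k) (- {0}) W"
  shows "continuous_on (sphere 0 1) (divergence W)"
proof -
  have "continuous_on (- {0}) (divergence W)"
    unfolding divergence_def[abs_def]
    by (intro continuous_intros C_on_imp_continuous_on[OF C_on_dir_deriv[OF assms]])
  then show ?thesis by (rule continuous_on_subset) auto
qed

text \<open>The product of \<open>W\<close> with a radial cutoff is a field whose divergence integrates to zero. In polar coordinates it splits into
  the divergence of \<open>W\<close> and the radial component of \<open>W\<close>, each with a radial integral as a factor.\<close>

lemma divergence_radial_balance:
  fixes W :: "'n::finite space \<Rightarrow> 'n space"
  assumes W: "C_on (Suc k) (- {0}) W" and hom: "homogeneous0 W"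
  shows "sphere_integral (divergence W) * radial_integral CARD('n) (\<lambda>\<rho>. cutoff (\<rho>\<^sup>2) / \<rho>) +
    sphere_integral (\<lambda>p. W p \<bullet> p) * radial_integral CARD('n) (\<lambda>\<rho>. 2 * \<rho> * cutoff' (\<rho>\<^sup>2)) = 0"
proof -
  let ?\<psi>1 = "\<lambda>\<rho>. cutoff (\<rho>\<^sup>2) / \<rho>" and ?\<psi>2 = "\<lambda>\<rho>. 2 * \<rho> * cutoff' (\<rho>\<^sup>2)"
  define \<Phi> where "\<Phi> b x = (W x \<bullet> b) * cutoff (x \<bullet> x)" for b x
  define \<Phi>' where "\<Phi>' b x v = (W x \<bullet> b) * (cutoff' (x \<bullet> x) * (2 * (x \<bullet> v)))
    + (dir_deriv v W x \<bullet> b) * cutoff (x \<bullet> x)" for b x v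
  have inside: "\<Phi> b x = 0" "\<Phi>' b x v = 0" if "norm x < 1 \<or> 2 < norm x" for b x v
    using that cutoff_outside[of "x \<bullet> x"] power_strict_mono[of 2 "norm x" 2]
      power_less_one_iff[of "norm x" 2]
    by (auto simp: \<Phi>_def \<Phi>'_def dot_square_norm)
  have der: "(\<Phi> b has_derivative \<Phi>' b x) (at x)" for b x
  proof (cases "norm x < 1")
    case True
    have "((\<lambda>x. 0 :: real) has_derivative (\<lambda>v. 0)) (at x)" by simp
    then have "(\<Phi> b has_derivative (\<lambda>v. 0)) (at x)"
      by (rule has_derivative_transform_within_open[where s = "ball 0 1"])
        (use True inside in auto)
    moreover have "\<Phi>' b x = (\<lambda>v. 0)"
      by (rule ext) (rule inside(2)[OF disjI1[OF True]])
    ultimately show ?thesis by simp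
  next
    case False
    then have x: "x \<in> - {0}" by auto
    have "((\<lambda>x. x \<bullet> x) has_derivative (\<lambda>v. 2 * (x \<bullet> v))) (at x)"
      by (auto intro!: derivative_eq_intros simp: inner_commute)
    then have "((\<lambda>x. cutoff (x \<bullet> x)) has_derivative (\<lambda>v. cutoff' (x \<bullet> x) * (2 * (x \<bullet> v)))) (at x)"
      by (rule has_derivative_compose) (rule has_real_derivative_cutoff[unfolded has_field_derivative_def])
    then show ?thesis
      unfolding \<Phi>_def \<Phi>'_def
      by (intro has_derivative_mult has_derivative_inner_left C_on_imp_differentiable[OF W x])
  qed
  have cont: "continuous_on UNIV (\<lambda>x. \<Phi>' b x v)" for b v
  proof -
    have "continuous_on (- {0}) (\<lambda>x. \<Phi>' b x v)"
      unfolding \<Phi>'_def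
      by (intro continuous_intros continuous_cutoff_compose C_on_imp_continuous_on[OF W]
          C_on_imp_continuous_on[OF C_on_dir_deriv[OF W]])
    moreover have "continuous_on (ball 0 1) (\<lambda>x. \<Phi>' b x v)"
      by (rule continuous_on_eq[OF continuous_on_const[of _ 0]]) (simp add: inside)
    ultimately have "continuous_on (- {0} \<union> ball 0 1) (\<lambda>x. \<Phi>' b x v)"
      by (intro continuous_on_open_Un) auto
    moreover have "- {0} \<union> ball 0 1 = (UNIV :: 'n space set)" by auto
    ultimately show ?thesis by simp
  qed
  have "has_bochner_integral lborel (\<lambda>x. \<Phi>' b x b) 0" for b
    by (rule integral_dir_deriv_eq_0[of "\<Phi> b" "\<Phi>' b" b 2]) (simp_all add: der cont inside)
  then have "has_bochner_integral lborel (\<lambda>x. \<Sum>b\<in>Basis. \<Phi>' b x b) (\<Sum>b\<in>(Basis :: 'n space set). 0)"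
    by (intro has_bochner_integral_sum)
  moreover have "(\<Sum>b\<in>Basis. \<Phi>' b x b) = divergence W (sgn x) * ?\<psi>1 (norm x) +
      (W (sgn x) \<bullet> sgn x) * ?\<psi>2 (norm x)" for x
  proof (cases "x = 0")
    case True
    then show ?thesis using cutoff_outside[of 0] by (simp add: \<Phi>'_def)
  next
    case False
    have "(\<Sum>b\<in>Basis. \<Phi>' b x b) = (\<Sum>b\<in>Basis. (W x \<bullet> b) * (x \<bullet> b)) * (2 * cutoff' (x \<bullet> x))
        + divergence W x * cutoff (x \<bullet> x)"
      by (simp add: \<Phi>'_def divergence_def sum.distrib sum_distrib_left sum_distrib_right algebra_simps)
    also have "(\<Sum>b\<in>Basis. (W x \<bullet> b) * (x \<bullet> b)) = W x \<bullet> x"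
      by (rule euclidean_inner[symmetric])
    also have "divergence W x = inverse (norm x) * divergence W (sgn x)"
      unfolding divergence_def
      by (subst dir_deriv_homogeneous0[OF W hom False]) (simp add: sum_distrib_left)
    also have "W x \<bullet> x = norm x * (W (sgn x) \<bullet> sgn x)"
      using homogeneous0D[OF hom False] False by (simp add: sgn_div_norm)
    finally show ?thesis
      by (simp add: dot_square_norm divide_inverse algebra_simps)
  qed
  ultimately have 0: "has_bochner_integral lborel (\<lambda>x. divergence W (sgn x) * ?\<psi>1 (norm x) +
      (W (sgn x) \<bullet> sgn x) * ?\<psi>2 (norm x)) 0" by simp
  have cW: "continuous_on (sphere 0 1) (\<lambda>p. W p \<bullet> p)"
    by (intro continuous_intros continuous_on_subset[OF C_on_imp_continuous_on[OF W]]) auto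
  have "has_bochner_integral lborel (\<lambda>x. divergence W (sgn x) * ?\<psi>1 (norm x) +
      (W (sgn x) \<bullet> sgn x) * ?\<psi>2 (norm x))
    (sphere_integral (divergence W) * radial_integral CARD('n) ?\<psi>1 +
      sphere_integral (\<lambda>p. W p \<bullet> p) * radial_integral CARD('n) ?\<psi>2)"
    by (intro has_bochner_integral_add has_bochner_integral_polar
        has_bochner_integral_polar[of "\<lambda>p. W p \<bullet> p"] continuous_divergence[OF W] cW integrable_cutoff) measurable
  with 0 show ?thesis by (simp add: has_bochner_integral_eq)
qed

text \<open>Since the two radial integrals do not depend on the field, their ratio can be read off from
  the field \<^term>\<open>sgn\<close>.\<close>

theorem sphere_divergence:
  fixes W :: "'n::finite space \<Rightarrow> 'n space"
  assumes W: "C_on (Suc k) (- {0}) W" and hom: "homogeneous0 W"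
  shows "sphere_integral (divergence W) = real CARD('n) * sphere_integral (\<lambda>p. W p \<bullet> p)"
proof -
  let ?R1 = "radial_integral CARD('n) (\<lambda>\<rho>. cutoff (\<rho>\<^sup>2) / \<rho>)"
  let ?R2 = "radial_integral CARD('n) (\<lambda>\<rho>. 2 * \<rho> * cutoff' (\<rho>\<^sup>2))"
  have "divergence (sgn :: 'n space \<Rightarrow> _) p = real CARD('n)" if p: "norm p = 1" for p :: "'n space"
  proof -
    have "divergence sgn p = (\<Sum>b\<in>Basis. 1 - (p \<bullet> b) * (p \<bullet> b))"
      unfolding divergence_def
      by (intro sum.cong refl, subst dir_deriv_sgn) (use p in \<open>auto simp: sgn_div_norm inner_diff_left\<close>)
    also have "\<dots> = real DIM('n space) - p \<bullet> p"
      by (simp add: sum_subtractf euclidean_inner[of p p])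
    finally show ?thesis using p by (simp add: dot_square_norm)
  qed
  then have "sphere_integral (divergence sgn :: 'n space \<Rightarrow> real) = sphere_integral (\<lambda>p :: 'n space. real CARD('n) * 1)"
    by (intro sphere_integral_cong) simp
  moreover have "sphere_integral (\<lambda>p :: 'n space. sgn p \<bullet> p) = sphere_integral (\<lambda>p :: 'n space. 1)"
    by (intro sphere_integral_cong) (simp add: sgn_div_norm dot_square_norm)
  ultimately have "sphere_integral (\<lambda>p :: 'n space. 1) * (real CARD('n) * ?R1 + ?R2) = 0"
    using divergence_radial_balance[OF C_on_sgn_punctured homogeneous0_sgn, where 'n = 'n]
    by (simp only: sphere_integral_cmult) (simp only: ring_distribs ac_simps)
  then have "?R2 = - real CARD('n) * ?R1"
    using sphere_integral_1_pos[where 'n = 'n] by simp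
  then have "?R1 * sphere_integral (divergence W) = ?R1 * (real CARD('n) * sphere_integral (\<lambda>p. W p \<bullet> p))"
    using divergence_radial_balance[OF W hom] by (simp add: ac_simps)
  then show ?thesis using radial_integral_cutoff_pos[of "CARD('n)"] by simp
qed

section \<open>A sharp Gaussian Poincare inequality\<close>

subsection \<open>Wirtinger's inequality for antiperiodic functions\<close>

lemma integral_periodic_shift:
  fixes k :: "real \<Rightarrow> real"
  assumes k: "continuous_on UNIV k" "\<And>t. k (t + L) = k t" and c: "0 \<le> c" "c \<le> L"
  shows "integral {c..c + L} k = integral {0..L} k"
proof -
  have int: "k integrable_on {a..b}" for a b
    by (intro integrable_continuous_real continuous_on_subset[OF k(1)]) auto
  have "integral {c..c + L} k = integral {c..L} k + integral {L..c + L} k"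
    by (rule Henstock_Kurzweil_Integration.integral_combine[symmetric]) (use c int in auto)
  also have "integral {L..c + L} k = integral {0..c} k"
    using integral_shift_Icc_real[of 0 c k L] k(2) by (simp add: o_def add.commute)
  also have "integral {c..L} k + integral {0..c} k = integral {0..L} k"
    using Henstock_Kurzweil_Integration.integral_combine[of 0 c L k] c int by simp
  finally show ?thesis .
qed

text \<open>The pole of the cotangent at a zero of \<open>b\<close> is simple, whereas the zero of \<open>b^2\<close> is at least double. Hence the
  boundary terms in the proof of Wirtinger's inequality vanish.\<close>

lemma tendsto_square_times_cot:
  fixes b :: "real \<Rightarrow> real"
  assumes "(b has_real_derivative b') (at t1)" "b t1 = 0"
  shows "((\<lambda>t. (b t)\<^sup>2 * cot (t - t1)) \<longlongrightarrow> 0) (at t1)"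
proof -
  have slope: "((\<lambda>t. (b t - b t1) / (t - t1)) \<longlongrightarrow> b') (at t1)"
    using assms(1) by (simp add: has_field_derivative_iff)
  have sin: "((\<lambda>t. (sin (t - t1) - sin (t1 - t1)) / (t - t1)) \<longlongrightarrow> 1) (at t1)"
  proof -
    have "((\<lambda>t. sin (t - t1)) has_real_derivative 1) (at t1)"
      by (auto intro!: derivative_eq_intros)
    then show ?thesis by (simp add: has_field_derivative_iff)
  qed
  have cont: "(b \<longlongrightarrow> 0) (at t1)"
    using DERIV_isCont[OF assms(1)] assms(2) by (simp add: isCont_def)
  have cos: "((\<lambda>t. cos (t - t1)) \<longlongrightarrow> 1) (at t1)"
    by (auto intro!: tendsto_eq_intros)
  have "((\<lambda>t. (b t - b t1) / (t - t1) * b t * cos (t - t1) /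
      ((sin (t - t1) - sin (t1 - t1)) / (t - t1))) \<longlongrightarrow> b' * 0 * 1 / 1) (at t1)"
    by (intro tendsto_intros slope sin cont cos) simp
  moreover have "\<forall>\<^sub>F t in at t1. (b t - b t1) / (t - t1) * b t * cos (t - t1) /
      ((sin (t - t1) - sin (t1 - t1)) / (t - t1)) = (b t)\<^sup>2 * cot (t - t1)"
    using assms(2) by (auto simp: eventually_at_filter cot_def power2_eq_square)
  ultimately show ?thesis by (simp add: tendsto_cong)
qed

text \<open>An antiperiodic function has a zero \<open>t0\<close>. On the period that starts there,
  \<open>b'^2 - b^2 = (b' - b cot (t - t0))^2 + (b^2 cot (t - t0))'\<close>, and the last term contributes nothing
  because \<open>b\<close> vanishes at both ends.\<close>

lemma wirtinger_antiperiodic: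
  fixes b b' :: "real \<Rightarrow> real"
  assumes der: "\<And>t. (b has_real_derivative b' t) (at t)" and cont: "continuous_on UNIV b'"
    and anti: "\<And>t. b (t + pi) = - b t"
  shows "integral {0..pi} (\<lambda>t. (b t)\<^sup>2) \<le> integral {0..pi} (\<lambda>t. (b' t)\<^sup>2)"
proof -
  have cb: "continuous_on UNIV b"
    by (auto intro!: continuous_at_imp_continuous_on DERIV_isCont[OF der])
  have anti': "b' (t + pi) = - b' t" for t
  proof -
    have "((\<lambda>t. b (t + pi)) has_real_derivative b' (t + pi)) (at t)"
      by (rule DERIV_shift[THEN iffD1, OF der])
    moreover have "((\<lambda>t. - b t) has_real_derivative - b' t) (at t)"
      by (rule DERIV_minus[OF der])
    ultimately show ?thesis using anti by (simp add: DERIV_unique)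
  qed
  obtain t0 where t0: "0 \<le> t0" "t0 \<le> pi" "b t0 = 0"
  proof -
    have c: "continuous_on {0..pi} b" by (rule continuous_on_subset[OF cb]) simp
    have "b pi = - b 0" using anti[of 0] by simp
    then consider "b 0 \<le> 0" "0 \<le> b pi" | "b pi \<le> 0" "0 \<le> b 0" by linarith
    then show ?thesis
      using IVT'[of b 0 0 pi, OF _ _ _ c] IVT2'[of b pi 0 0, OF _ _ _ c] that by cases auto
  qed
  define t1 where "t1 = t0 + pi"
  have b1: "b t1 = 0" using t0 anti by (simp add: t1_def)
  let ?h = "\<lambda>t. (b' t)\<^sup>2 - (b t)\<^sup>2"
  have ch: "continuous_on UNIV ?h" by (intro continuous_intros cont cb)
  \<comment> \<open>\<open>P\<close> is the integral of the square \<open>(b' - b cot (t - t0))^2\<close>, and therefore it is nondecreasing.\<close>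
  define P where "P t = integral {t0..t} ?h - (b t)\<^sup>2 * cot (t - t0)" for t
  have sin_pos: "0 < sin (t - t0)" if "t \<in> {t0<..<t1}" for t
    using that by (intro sin_gt_zero) (auto simp: t1_def)
  have dP: "(P has_real_derivative (b' t - b t * cot (t - t0))\<^sup>2) (at t)" if t: "t \<in> {t0<..<t1}" for t
  proof -
    have "((\<lambda>x. integral {t0..x} ?h) has_real_derivative ?h t) (at t within {t0..t1})"
      by (rule integral_has_real_derivative) (use t ch in \<open>auto intro: continuous_on_subset\<close>)
    then have 1: "((\<lambda>x. integral {t0..x} ?h) has_real_derivative ?h t) (at t)"
      using t by (simp add: at_within_Icc_at)
    have 2: "((\<lambda>t. cot (t - t0)) has_real_derivative - inverse ((sin (t - t0))\<^sup>2)) (at t)"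
    proof -
      have "((\<lambda>t. t - t0) has_real_derivative 1) (at t)" by (auto intro!: derivative_eq_intros)
      then show ?thesis
        using DERIV_chain2[OF DERIV_cot, of "\<lambda>t. t - t0" t 1 UNIV] sin_pos[OF t] by simp
    qed
    have 3: "((\<lambda>t. (b t)\<^sup>2 * cot (t - t0)) has_real_derivative
        (b t)\<^sup>2 * (- inverse ((sin (t - t0))\<^sup>2)) + 2 * b t * b' t * cot (t - t0)) (at t)"
      using DERIV_mult[OF DERIV_power[OF der, of 2 t] 2] by (simp add: algebra_simps)
    have "inverse ((sin (t - t0))\<^sup>2) = 1 + (cot (t - t0))\<^sup>2"
      using sin_pos[OF t] sin_cos_squared_add[of "t - t0"]
      by (simp add: cot_def power_divide field_simps)
    then have eq: "?h t - ((b t)\<^sup>2 * (- inverse ((sin (t - t0))\<^sup>2)) + 2 * b t * b' t * cot (t - t0))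
        = (b' t - b t * cot (t - t0))\<^sup>2"
      by (simp add: power2_eq_square algebra_simps)
    show ?thesis
      using DERIV_diff[OF 1 3] unfolding P_def eq .
  qed
  have mono: "P u \<le> P v" if "t0 < u" "u \<le> v" "v < t1" for u v
    by (rule DERIV_nonneg_imp_nondecreasing[OF that(2)])
      (use dP that zero_le_power2 in \<open>meson greaterThanLessThan_iff le_less_trans less_le_trans\<close>)
  have cI: "continuous_on {t0..t1} (\<lambda>t. integral {t0..t} ?h)"
    by (intro indefinite_integral_continuous_1 integrable_continuous_real continuous_on_subset[OF ch]) simp
  have t01: "t0 < t1" by (simp add: t1_def)
  have start: "(P \<longlongrightarrow> 0) (at_right t0)"
  proof -
    have 1: "((\<lambda>t. integral {t0..t} ?h) \<longlongrightarrow> integral {t0..t0} ?h) (at_right t0)"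
      by (intro continuous_on_Icc_at_rightD[OF cI t01])
    have 2: "((\<lambda>t. (b t)\<^sup>2 * cot (t - t0)) \<longlongrightarrow> 0) (at_right t0)"
      using tendsto_mono[OF at_le tendsto_square_times_cot[OF der t0(3)]] by simp
    show ?thesis
      unfolding P_def using tendsto_diff[OF 1 2] by simp
  qed
  have stop: "(P \<longlongrightarrow> integral {t0..t1} ?h) (at_left t1)"
  proof -
    have 1: "((\<lambda>t. integral {t0..t} ?h) \<longlongrightarrow> integral {t0..t1} ?h) (at_left t1)"
      by (intro continuous_on_Icc_at_leftD[OF cI t01])
    have "cot (t - t1) = cot (t - t0)" for t
    proof -
      have "t - t0 = (t - t1) + pi" by (simp add: t1_def)
      then show ?thesis by (simp only: cot_def sin_periodic_pi cos_periodic_pi minus_divide_divide)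
    qed
    then have 2: "((\<lambda>t. (b t)\<^sup>2 * cot (t - t0)) \<longlongrightarrow> 0) (at_left t1)"
      using tendsto_mono[OF at_le tendsto_square_times_cot[OF der b1]] by simp
    show ?thesis
      unfolding P_def using tendsto_diff[OF 1 2] by simp
  qed
  have "0 \<le> P v" if "t0 < v" "v < t1" for v
  proof (rule tendsto_upperbound[OF start])
    show "\<forall>\<^sub>F u in at_right t0. P u \<le> P v"
      using eventually_at_right_real[OF that(1)] by eventually_elim (use mono that in auto)
  qed simp
  then have "0 \<le> integral {t0..t1} ?h"
    by (intro tendsto_lowerbound[OF stop])
      (use eventually_at_left_real[OF t01] in \<open>auto elim: eventually_mono\<close>)
  also have "\<dots> = integral {0..pi} ?h"
    unfolding t1_def
    by (rule integral_periodic_shift[OF ch]) (use anti anti' t0 in auto)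
  also have "\<dots> = integral {0..pi} (\<lambda>t. (b' t)\<^sup>2) - integral {0..pi} (\<lambda>t. (b t)\<^sup>2)"
    by (intro Henstock_Kurzweil_Integration.integral_diff integrable_continuous_real
        continuous_intros continuous_on_subset[OF cont] continuous_on_subset[OF cb]) auto
  finally show ?thesis by simp
qed

subsection \<open>Rotations in a pair of vectors\<close>

definition pair_rotation :: "real \<Rightarrow> 'a::euclidean_space \<times> 'a \<Rightarrow> 'a \<times> 'a" where
  "pair_rotation \<theta> z = (cos \<theta> *\<^sub>R fst z + sin \<theta> *\<^sub>R snd z, cos \<theta> *\<^sub>R snd z - sin \<theta> *\<^sub>R fst z)"

lemma nn_integral_lborel_shift:
  fixes f :: "'a::euclidean_space \<Rightarrow> ennreal"
  assumes [measurable]: "f \<in> borel_measurable borel"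
  shows "(\<integral>\<^sup>+ x. f (x + c) \<partial>lborel) = (\<integral>\<^sup>+ x. f x \<partial>lborel)"
  by (subst (2) lborel_distr_plus[of c, symmetric]) (simp add: nn_integral_distr add.commute)

lemma nn_integral_shear:
  fixes f :: "'a::euclidean_space \<times> 'a \<Rightarrow> ennreal"
  assumes [measurable]: "f \<in> borel_measurable borel"
  shows "(\<integral>\<^sup>+ z. f (fst z + a *\<^sub>R snd z, snd z) \<partial>lborel) = (\<integral>\<^sup>+ z. f z \<partial>lborel)" (is "?L1 = ?R")
    and "(\<integral>\<^sup>+ z. f (fst z, snd z + a *\<^sub>R fst z) \<partial>lborel) = (\<integral>\<^sup>+ z. f z \<partial>lborel)" (is "?L2 = ?R")
proof -
  have [measurable]: "f \<in> borel_measurable (lborel \<Otimes>\<^sub>M lborel)"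
    by (simp add: lborel_prod)
  have "?L1 = (\<integral>\<^sup>+ y. \<integral>\<^sup>+ x. f (x + a *\<^sub>R y, y) \<partial>lborel \<partial>lborel)"
    by (subst lborel_prod[symmetric], subst lborel_pair.nn_integral_snd[symmetric]) auto
  also have "\<dots> = (\<integral>\<^sup>+ y. \<integral>\<^sup>+ x. f (x, y) \<partial>lborel \<partial>lborel)"
    by (intro nn_integral_cong nn_integral_lborel_shift) measurable
  also have "\<dots> = ?R"
    by (subst lborel_pair.nn_integral_snd) (auto simp: lborel_prod)
  finally show "?L1 = ?R" .
  have "?L2 = (\<integral>\<^sup>+ x. \<integral>\<^sup>+ y. f (x, y + a *\<^sub>R x) \<partial>lborel \<partial>lborel)"
    by (subst lborel_prod[symmetric], subst lborel.nn_integral_fst[symmetric]) auto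
  also have "\<dots> = (\<integral>\<^sup>+ x. \<integral>\<^sup>+ y. f (x, y) \<partial>lborel \<partial>lborel)"
    by (intro nn_integral_cong nn_integral_lborel_shift) measurable
  also have "\<dots> = ?R"
    by (subst lborel.nn_integral_fst) (auto simp: lborel_prod)
  finally show "?L2 = ?R" .
qed

lemma measurable_pair_rotation [measurable]: "pair_rotation \<theta> \<in> borel_measurable borel"
  unfolding pair_rotation_def[abs_def]
  by (intro borel_measurable_continuous_onI continuous_intros)

text \<open>A rotation by an angle with nonzero sine is a product of three shears, each of which
  preserves Lebesgue measure by translation invariance in the slices.\<close>

lemma nn_integral_pair_rotation:
  fixes f :: "'a::euclidean_space \<times> 'a \<Rightarrow> ennreal"
  assumes [measurable]: "f \<in> borel_measurable borel" and \<theta>: "sin \<theta> \<noteq> 0"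
  shows "(\<integral>\<^sup>+ z. f (pair_rotation \<theta> z) \<partial>lborel) = (\<integral>\<^sup>+ z. f z \<partial>lborel)"
proof -
  define t where "t = (1 - cos \<theta>) / sin \<theta>"
  define g where "g z = f (fst z + t *\<^sub>R snd z, snd z)" for z
  define h where "h z = g (fst z, snd z + (- sin \<theta>) *\<^sub>R fst z)" for z
  have mg: "g \<in> borel_measurable borel"
    unfolding g_def
    by (rule measurable_compose[OF _ assms(1)]) (intro borel_measurable_continuous_onI continuous_intros)
  have mh: "h \<in> borel_measurable borel"
    unfolding h_def
    by (rule measurable_compose[OF _ mg]) (intro borel_measurable_continuous_onI continuous_intros)
  have ts: "t * sin \<theta> = 1 - cos \<theta>" using \<theta> by (simp add: t_def)
  have "(1 - cos \<theta>) * (1 + cos \<theta>) = sin \<theta> * sin \<theta>"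
    using sin_cos_squared_add[of \<theta>] by (simp add: algebra_simps power2_eq_square)
  then have tc: "t * (1 + cos \<theta>) = sin \<theta>" using \<theta> by (simp add: t_def field_simps)
  have "h (fst z + t *\<^sub>R snd z, snd z) = f (pair_rotation \<theta> z)" for z
  proof -
    obtain x y where z: "z = (x, y)" by (cases z)
    have 1: "y + (- sin \<theta>) *\<^sub>R (x + t *\<^sub>R y) = cos \<theta> *\<^sub>R y - sin \<theta> *\<^sub>R x"
    proof -
      have "y + (- sin \<theta>) *\<^sub>R (x + t *\<^sub>R y) = (1 - t * sin \<theta>) *\<^sub>R y - sin \<theta> *\<^sub>R x"
        by (simp add: algebra_simps)
      then show ?thesis by (simp add: ts)
    qed
    have 2: "x + t *\<^sub>R y + t *\<^sub>R (cos \<theta> *\<^sub>R y - sin \<theta> *\<^sub>R x) = cos \<theta> *\<^sub>R x + sin \<theta> *\<^sub>R y"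
    proof -
      have "x + t *\<^sub>R y + t *\<^sub>R (cos \<theta> *\<^sub>R y - sin \<theta> *\<^sub>R x)
          = (1 - t * sin \<theta>) *\<^sub>R x + (t * (1 + cos \<theta>)) *\<^sub>R y"
        by (simp add: algebra_simps)
      then show ?thesis by (simp add: ts tc)
    qed
    show ?thesis using 1 2 by (simp add: h_def g_def z pair_rotation_def)
  qed
  then have "(\<integral>\<^sup>+ z. f (pair_rotation \<theta> z) \<partial>lborel) = (\<integral>\<^sup>+ z. h (fst z + t *\<^sub>R snd z, snd z) \<partial>lborel)"
    by simp
  also have "\<dots> = (\<integral>\<^sup>+ z. f z \<partial>lborel)"
    using nn_integral_shear(1)[OF mh, of t] nn_integral_shear(2)[OF mg, of "- sin \<theta>"]
      nn_integral_shear(1)[of f t] by (simp add: h_def g_def)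
  finally show ?thesis .
qed

lemma lborel_distr_pair_rotation:
  assumes "sin \<theta> \<noteq> 0"
  shows "distr lborel borel (pair_rotation \<theta>) = (lborel :: ('a::euclidean_space \<times> 'a) measure)"
proof (rule measure_eqI)
  fix A :: "('a \<times> 'a) set" assume "A \<in> sets (distr lborel borel (pair_rotation \<theta>))"
  then have [measurable]: "A \<in> sets borel" by simp
  have "emeasure (distr lborel borel (pair_rotation \<theta>)) A =
      (\<integral>\<^sup>+ z. indicator A z \<partial>distr lborel borel (pair_rotation \<theta>))"
    by simp
  also have "\<dots> = (\<integral>\<^sup>+ z. indicator A (pair_rotation \<theta> z) \<partial>lborel)"
    by (rule nn_integral_distr) auto
  also have "\<dots> = emeasure lborel A"
    by (subst nn_integral_pair_rotation[OF _ assms]) auto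
  finally show "emeasure (distr lborel borel (pair_rotation \<theta>)) A = emeasure lborel A" .
qed simp

text \<open>By the invariance of Lebesgue measure, the integral of \<open>\<Psi>\<close> equals the integral of its averages over
  arcs of rotation orbits, of angle \<open>c * pi\<close>.\<close>

lemma rotation_average_nonpos:
  fixes \<Psi> :: "'a::euclidean_space \<times> 'a \<Rightarrow> real"
  assumes int: "integrable lborel \<Psi>" and c: "0 < c" "c \<le> 1"
    and ae: "AE z in lborel. continuous_on {0..pi} (\<lambda>\<theta>. \<Psi> (pair_rotation (c * \<theta>) z)) \<and>
      integral {0..pi} (\<lambda>\<theta>. \<Psi> (pair_rotation (c * \<theta>) z)) \<le> 0"
  shows "integral\<^sup>L lborel \<Psi> \<le> 0"
proof -
  have [measurable]: "\<Psi> \<in> borel_measurable borel"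
    using borel_measurable_integrable[OF int] by simp
  define f where "f \<theta> z = indicator {0<..<pi} \<theta> * \<Psi> (pair_rotation (c * \<theta>) z)" for \<theta> z
  have rot: "(\<lambda>(\<theta>, z). pair_rotation (c * \<theta>) z) \<in> borel_measurable (borel :: (real \<times> 'a \<times> 'a) measure)"
    unfolding pair_rotation_def case_prod_unfold
    by (intro borel_measurable_continuous_onI continuous_intros)
  have fm: "case_prod f \<in> borel_measurable (lborel \<Otimes>\<^sub>M lborel)"
  proof -
    have "(\<lambda>x. \<Psi> (case x of (\<theta>, z) \<Rightarrow> pair_rotation (c * \<theta>) z)) \<in> borel_measurable borel"
      by (rule measurable_compose[OF rot]) simp
    then have "(\<lambda>x. indicator {0<..<pi} (fst x) * \<Psi> (case x of (\<theta>, z) \<Rightarrow> pair_rotation (c * \<theta>) z))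
        \<in> borel_measurable borel"
      by (intro borel_measurable_times borel_measurable_continuous_onI[of fst] continuous_intros
          measurable_compose[OF _ borel_measurable_indicator[of _ borel], of fst]) auto
    then show ?thesis by (simp add: f_def case_prod_unfold lborel_prod)
  qed
  have sin: "sin (c * \<theta>) \<noteq> 0" if "\<theta> \<in> {0<..<pi}" for \<theta>
  proof -
    have "c * \<theta> \<le> 1 * \<theta>" using that c by (intro mult_right_mono) auto
    then have "c * \<theta> < pi" using that unfolding greaterThanLessThan_iff by linarith
    then have "0 < sin (c * \<theta>)" using that c by (intro sin_gt_zero) auto
    then show ?thesis by simp
  qed
  have rot_int: "integrable lborel (\<lambda>z. \<Psi> (pair_rotation (c * \<theta>) z))"
    "(LINT z|lborel. \<Psi> (pair_rotation (c * \<theta>) z)) = integral\<^sup>L lborel \<Psi>"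
    "(LINT z|lborel. \<bar>\<Psi> (pair_rotation (c * \<theta>) z)\<bar>) = (LINT z|lborel. \<bar>\<Psi> z\<bar>)" if "\<theta> \<in> {0<..<pi}" for \<theta>
    using int integrable_distr_eq[of "pair_rotation (c * \<theta>)" lborel borel \<Psi>]
      integral_distr[of "pair_rotation (c * \<theta>)" lborel borel \<Psi>]
      integral_distr[of "pair_rotation (c * \<theta>)" lborel borel "\<lambda>z. \<bar>\<Psi> z\<bar>"]
    by (simp_all add: lborel_distr_pair_rotation[OF sin[OF that]])
  have inner: "(LINT z|lborel. f \<theta> z) = indicator {0<..<pi} \<theta> * integral\<^sup>L lborel \<Psi>"
    "(LINT z|lborel. norm (f \<theta> z)) = indicator {0<..<pi} \<theta> * (LINT z|lborel. \<bar>\<Psi> z\<bar>)"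
    "integrable lborel (f \<theta>)" for \<theta>
    using rot_int[of \<theta>] unfolding f_def by (cases "\<theta> \<in> {0<..<pi}"; simp add: abs_mult)+
  have ind: "integrable lborel (\<lambda>\<theta>. indicator {0<..<pi} \<theta> * K)" for K :: real
    by (intro integrable_mult_left integrable_real_indicator) auto
  have fi: "integrable (lborel \<Otimes>\<^sub>M lborel) (case_prod f)"
    by (rule lborel_pair.Fubini_integrable[OF fm]) (use inner ind in auto)
  have "(LINT z|lborel. LINT \<theta>|lborel. f \<theta> z) = (LINT \<theta>|lborel. LINT z|lborel. f \<theta> z)"
    by (rule lborel_pair.Fubini_integral[OF fi])
  also have "\<dots> = pi * integral\<^sup>L lborel \<Psi>"
    by (simp add: inner)
  finally have eq: "pi * integral\<^sup>L lborel \<Psi> = (LINT z|lborel. LINT \<theta>|lborel. f \<theta> z)" by simp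
  have "AE z in lborel. (LINT \<theta>|lborel. f \<theta> z) \<le> 0"
    using ae
  proof eventually_elim
    case (elim z)
    let ?k = "\<lambda>\<theta>. \<Psi> (pair_rotation (c * \<theta>) z)"
    have si: "set_integrable lborel {0..pi} ?k"
      by (rule borel_integrable_atLeastAtMost'[OF conjunct1[OF elim]])
    have "(LINT \<theta>|lborel. f \<theta> z) = (LINT \<theta>:{0..pi}|lborel. ?k \<theta>)"
      unfolding set_lebesgue_integral_def
    proof (rule integral_cong_AE)
      show "AE \<theta> in lborel. f \<theta> z = indicat_real {0..pi} \<theta> *\<^sub>R ?k \<theta>"
        using AE_lborel_singleton[of "0::real"] AE_lborel_singleton[of pi]
        by eventually_elim (auto simp: f_def indicator_def)
      show "(\<lambda>\<theta>. f \<theta> z) \<in> borel_measurable lborel"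
        using measurable_Pair1[OF fm, of z] by simp
      show "(\<lambda>\<theta>. indicat_real {0..pi} \<theta> *\<^sub>R ?k \<theta>) \<in> borel_measurable lborel"
        using si unfolding set_integrable_def by (rule borel_measurable_integrable)
    qed
    also have "\<dots> = integral {0..pi} ?k"
      by (rule set_borel_integral_eq_integral(2)[OF si])
    finally show ?case using elim by simp
  qed
  then have "(LINT z|lborel. LINT \<theta>|lborel. f \<theta> z) \<le> 0"
    using integral_nonneg_AE[of "\<lambda>z. - (LINT \<theta>|lborel. f \<theta> z)" lborel] by simp
  then have "pi * integral\<^sup>L lborel \<Psi> \<le> 0" by (simp only: eq)
  then show ?thesis using pi_gt_zero by (simp add: mult_le_0_iff)
qed

subsection \<open>Gaussian integrals\<close>

definition gauss :: "'a::real_normed_vector \<Rightarrow> real" where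
  "gauss x = exp (- (norm x)\<^sup>2 / 2)"

lemma gauss_pos: "0 < gauss x"
  by (simp add: gauss_def)

lemma measurable_gauss [measurable]: "gauss \<in> borel_measurable (borel :: 'a::euclidean_space measure)"
  unfolding gauss_def[abs_def] by measurable

lemma gauss_Pair: "gauss (x, y) = gauss x * gauss y"
  by (simp add: gauss_def norm_Pair exp_add[symmetric] add_divide_distrib)

lemma integrable_wide_gauss: "integrable lborel (\<lambda>z :: 'a::euclidean_space. exp (- (norm z)\<^sup>2 / 4))"
proof (rule integrableI_nonneg)
  have dens: "exp (- t\<^sup>2 / 4) = sqrt (4 * pi) * normal_density 0 (sqrt 2) t" for t :: real
    by (simp add: normal_density_def)
  have "integrable lborel (\<lambda>t::real. exp (- t\<^sup>2 / 4))"
    unfolding dens by (intro integrable_mult_right integrable_normal_density) simp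
  then have fin: "(\<integral>\<^sup>+ t. ennreal (exp (- t\<^sup>2 / 4)) \<partial>(lborel :: real measure)) < \<infinity>"
    by (simp add: integrable_iff_bounded)
  have "(norm z)\<^sup>2 = (\<Sum>b\<in>Basis. (z \<bullet> b)\<^sup>2)" for z :: 'a
    unfolding power2_norm_eq_inner by (subst euclidean_inner) (simp add: power2_eq_square)
  then have "ennreal (exp (- (norm z)\<^sup>2 / 4)) = (\<Prod>b\<in>Basis. ennreal (exp (- (z \<bullet> b)\<^sup>2 / 4)))" for z :: 'a
    by (simp add: prod_ennreal exp_sum[symmetric] sum_negf sum_divide_distrib)
  then have "(\<integral>\<^sup>+ z. ennreal (exp (- (norm z)\<^sup>2 / 4)) \<partial>(lborel :: 'a measure)) =
      (\<Prod>b\<in>(Basis :: 'a set). \<integral>\<^sup>+ t. ennreal (exp (- t\<^sup>2 / 4)) \<partial>lborel)"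
    using nn_integral_lborel_prod[of "\<lambda>_ t. ennreal (exp (- t\<^sup>2 / 4))"] by simp
  also have "\<dots> < \<infinity>"
    using fin by (simp add: less_top[symmetric] power_eq_top_ennreal)
  finally show "(\<integral>\<^sup>+ z. ennreal (exp (- (norm z)\<^sup>2 / 4)) \<partial>(lborel :: 'a measure)) < \<infinity>" .
qed auto

lemma integrable_gauss_product:
  fixes a b :: "'a::euclidean_space \<Rightarrow> real"
  assumes [measurable]: "a \<in> borel_measurable borel" "b \<in> borel_measurable borel"
    and bound: "\<And>z. \<bar>a z\<bar> \<le> K * norm z" "\<And>z. \<bar>b z\<bar> \<le> K * norm z"
  shows "integrable lborel (\<lambda>z. a z * b z * gauss z)"
proof (rule Bochner_Integration.integrable_bound)
  show "integrable lborel (\<lambda>z::'a. (4 * K\<^sup>2) * exp (- (norm z)\<^sup>2 / 4))"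
    by (intro integrable_mult_right integrable_wide_gauss)
  show "AE z in lborel. norm (a z * b z * gauss z) \<le> norm ((4 * K\<^sup>2) * exp (- (norm z)\<^sup>2 / 4))"
  proof (rule AE_I2)
    fix z :: 'a
    define u where "u = (norm z)\<^sup>2"
    have "\<bar>a z\<bar> * \<bar>b z\<bar> \<le> (K * norm z) * (K * norm z)"
      using bound[of z] by (intro mult_mono) (auto intro: order_trans[OF abs_ge_zero])
    then have 1: "\<bar>a z * b z\<bar> \<le> K\<^sup>2 * u"
      by (simp add: abs_mult u_def power2_eq_square ac_simps)
    have "u / 4 \<le> exp (u / 4)" using exp_ge_add_one_self[of "u / 4"] by linarith
    then have "u \<le> 4 * exp (u / 4)" by simp
    then have "u * exp (- u / 2) \<le> 4 * exp (u / 4) * exp (- u / 2)"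
      by (intro mult_right_mono) auto
    also have "\<dots> = 4 * exp (- u / 4)"
      by (simp add: exp_add[symmetric])
    finally have 2: "K\<^sup>2 * (u * exp (- u / 2)) \<le> K\<^sup>2 * (4 * exp (- u / 4))"
      by (intro mult_left_mono) auto
    have "norm (a z * b z * gauss z) = \<bar>a z * b z\<bar> * exp (- u / 2)"
      by (simp add: abs_mult gauss_def u_def)
    also have "\<dots> \<le> K\<^sup>2 * u * exp (- u / 2)"
      by (intro mult_right_mono 1) simp
    finally show "norm (a z * b z * gauss z) \<le> norm ((4 * K\<^sup>2) * exp (- (norm z)\<^sup>2 / 4))"
      using 2 by (simp add: u_def abs_mult ac_simps)
  qed
qed measurable

lemma norm_pair_rotation: "norm (pair_rotation \<theta> z) = norm z"
proof -
  obtain x y where z: "z = (x, y)" by (cases z)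
  have "(norm (pair_rotation \<theta> z))\<^sup>2 = (cos \<theta> * cos \<theta> + sin \<theta> * sin \<theta>) * (x \<bullet> x + y \<bullet> y)"
    unfolding power2_norm_eq_inner pair_rotation_def z
    by (simp add: inner_commute algebra_simps del: sin_cos_squared_add3)
  also have "\<dots> = (norm z)\<^sup>2" by (simp add: power2_norm_eq_inner z sin_cos_squared_add3)
  finally show ?thesis by simp
qed

lemma gauss_pair_rotation: "gauss (pair_rotation \<theta> z) = gauss z"
  by (simp add: gauss_def norm_pair_rotation)

lemma integral_gauss_quarter_turn:
  fixes h :: "'a::euclidean_space \<times> 'a \<Rightarrow> real"
  assumes [measurable]: "h \<in> borel_measurable borel"
  shows "(LINT z|lborel. h (snd z, - fst z) * gauss z) = (LINT z|lborel. h z * gauss z)"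
proof -
  have "(LINT z|lborel. h z * gauss z) = (LINT z|distr lborel borel (pair_rotation (pi / 2)). h z * gauss z)"
    by (simp add: lborel_distr_pair_rotation)
  also have "\<dots> = (LINT z|lborel. h (pair_rotation (pi / 2) z) * gauss (pair_rotation (pi / 2) z))"
    by (rule integral_distr) measurable
  finally show ?thesis by (simp add: gauss_pair_rotation) (simp add: pair_rotation_def)
qed

lemma integral_gauss_split_eq_0:
  fixes f h :: "'a::euclidean_space \<Rightarrow> real"
  assumes "integrable lborel (\<lambda>z. f (fst z) * h (snd z) * gauss z)" "(LINT y|lborel. h y * gauss y) = 0"
  shows "(LINT z|lborel. f (fst z) * h (snd z) * gauss z) = 0"
proof -
  have "(LINT z|lborel. f (fst z) * h (snd z) * gauss z) =
      (LINT x|lborel. LINT y|lborel. f x * h y * gauss (x, y))"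
    using lborel_pair.integral_fst'[of "\<lambda>z. f (fst z) * h (snd z) * gauss z"] assms(1)
    by (simp add: lborel_prod)
  also have "\<dots> = (LINT x|lborel. LINT y|lborel. (f x * gauss x) * (h y * gauss y))"
    by (simp add: gauss_Pair ac_simps)
  finally show ?thesis using assms(2) by simp
qed

subsection \<open>Paths of rotated pairs\<close>

text \<open>Linear independence, expressed as strictness in the Cauchy-Schwarz inequality. Along the rotation
  orbit of such a pair neither component meets the origin, where a homogeneous function need not be
  differentiable.\<close>

definition independent_pair :: "'a::euclidean_space \<times> 'a \<Rightarrow> bool" where
  "independent_pair z \<longleftrightarrow> (fst z \<bullet> snd z)\<^sup>2 \<noteq> (fst z \<bullet> fst z) * (snd z \<bullet> snd z)"

lemma independent_pair_rotation:
  assumes "independent_pair z"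
  shows "fst (pair_rotation \<theta> z) \<noteq> 0" "snd (pair_rotation \<theta> z) \<noteq> 0"
proof -
  have *: False if "c *\<^sub>R x + s *\<^sub>R y = 0" "c\<^sup>2 + s\<^sup>2 = 1" "(x \<bullet> y)\<^sup>2 \<noteq> (x \<bullet> x) * (y \<bullet> y)" for c s and x y :: 'a
  proof -
    have 0: "(c *\<^sub>R x + s *\<^sub>R y) \<bullet> x = 0" "(c *\<^sub>R x + s *\<^sub>R y) \<bullet> y = 0" using that by auto
    then have 1: "c * (x \<bullet> x) = - s * (x \<bullet> y)" "s * (y \<bullet> y) = - c * (x \<bullet> y)"
      by (simp_all add: inner_add_left inner_commute[of y x] eq_neg_iff_add_eq_0 add.commute)
    have "s * c * ((x \<bullet> x) * (y \<bullet> y)) = s * c * (x \<bullet> y)\<^sup>2"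
      using arg_cong2[OF 1, of "(*)"] by (simp add: power2_eq_square ac_simps)
    moreover have "x = 0" if "s = 0" using that \<open>c *\<^sub>R x + s *\<^sub>R y = 0\<close> \<open>c\<^sup>2 + s\<^sup>2 = 1\<close> by auto
    moreover have "y = 0" if "c = 0" using that \<open>c *\<^sub>R x + s *\<^sub>R y = 0\<close> \<open>c\<^sup>2 + s\<^sup>2 = 1\<close> by auto
    ultimately show False using that(3) by (cases "s = 0"; cases "c = 0") auto
  qed
  show "fst (pair_rotation \<theta> z) \<noteq> 0"
    using *[of "cos \<theta>" "fst z" "sin \<theta>" "snd z"] assms
    by (auto simp: pair_rotation_def independent_pair_def)
  show "snd (pair_rotation \<theta> z) \<noteq> 0"
    using *[of "- sin \<theta>" "fst z" "cos \<theta>" "snd z"] assms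
    by (auto simp: pair_rotation_def independent_pair_def)
qed

lemma AE_independent_pair:
  assumes dim: "2 \<le> DIM('a::euclidean_space)"
  shows "AE z in lborel. independent_pair (z :: 'a \<times> 'a)"
proof -
  have null: "AE y in lborel. independent_pair (x, y)" if x: "x \<noteq> 0" for x :: 'a
  proof -
    let ?S = "{y. (x \<bullet> y)\<^sup>2 = (x \<bullet> x) * (y \<bullet> y)}"
    have closed: "closed ?S" by (intro closed_Collect_eq continuous_intros)
    have "?S \<subseteq> span {x}"
    proof
      fix y assume "y \<in> ?S"
      then have eq: "(x \<bullet> y) * (x \<bullet> y) = (x \<bullet> x) * (y \<bullet> y)" by (simp add: power2_eq_square)
      let ?c = "(x \<bullet> y) / (x \<bullet> x)"
      have "(y - ?c *\<^sub>R x) \<bullet> (y - ?c *\<^sub>R x) = y \<bullet> y - ((x \<bullet> y) * (x \<bullet> y)) / (x \<bullet> x)"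
        using x by (simp add: algebra_simps inner_commute)
      also have "\<dots> = 0" using x by (simp add: eq)
      finally have "y = ?c *\<^sub>R x" by simp
      then show "y \<in> span {x}" by (metis span_base span_scale singletonI)
    qed
    then have "dim ?S \<le> 1" using dim_subset[of ?S "span {x}"] x by (simp add: dim_span)
    then have "negligible ?S" using dim by (intro negligible_lowdim) simp
    then have "?S \<in> null_sets lborel"
      using closed by (simp add: negligible_iff_null_sets null_sets_completion_iff)
    then have "AE y in lborel. y \<notin> ?S" by (rule AE_not_in)
    then show ?thesis by (simp add: independent_pair_def)
  qed
  have "AE z in (lborel :: 'a measure) \<Otimes>\<^sub>M lborel. independent_pair z"
  proof (rule lborel_pair.AE_pair_measure)
    have "open {z :: 'a \<times> 'a. independent_pair z}"
      unfolding independent_pair_def by (intro open_Collect_neq continuous_intros)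
    then show "{z \<in> space (lborel \<Otimes>\<^sub>M lborel). independent_pair z} \<in> sets ((lborel :: 'a measure) \<Otimes>\<^sub>M lborel)"
      unfolding lborel_prod by simp
    show "AE x in lborel. AE y in lborel. independent_pair (x :: 'a, y)"
      using AE_lborel_singleton[of 0] by eventually_elim (rule null)
  qed
  then show ?thesis by (simp only: lborel_prod)
qed

lemma has_vector_derivative_pair_rotation:
  "((\<lambda>\<theta>. fst (pair_rotation (c * \<theta>) z)) has_vector_derivative c *\<^sub>R snd (pair_rotation (c * \<theta>) z)) (at \<theta>)"
  "((\<lambda>\<theta>. snd (pair_rotation (c * \<theta>) z)) has_vector_derivative c *\<^sub>R (- fst (pair_rotation (c * \<theta>) z))) (at \<theta>)"
  unfolding pair_rotation_def fst_conv snd_conv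
  by (auto intro!: derivative_eq_intros simp: has_real_derivative_iff_has_vector_derivative[symmetric] algebra_simps)

lemma continuous_pair_rotation: "continuous_on A (\<lambda>\<theta>. pair_rotation (c * \<theta>) z)"
  unfolding pair_rotation_def by (intro continuous_intros)

text \<open>Wirtinger's inequality along almost every rotation orbit, averaged over the orbits.\<close>

lemma antiperiodic_gauss_inequality:
  fixes B B' :: "'a::euclidean_space \<times> 'a \<Rightarrow> real"
  assumes dim: "2 \<le> DIM('a)" and c: "0 < c" "c \<le> 1"
    and meas: "B \<in> borel_measurable borel" "B' \<in> borel_measurable borel"
    and bound: "\<And>z. \<bar>B z\<bar> \<le> K * norm z" "\<And>z. \<bar>B' z\<bar> \<le> K * norm z"
    and der: "\<And>z \<theta>. independent_pair z \<Longrightarrow>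
      ((\<lambda>\<theta>. B (pair_rotation (c * \<theta>) z)) has_real_derivative B' (pair_rotation (c * \<theta>) z)) (at \<theta>)"
    and cont: "\<And>z. independent_pair z \<Longrightarrow> continuous_on UNIV (\<lambda>\<theta>. B' (pair_rotation (c * \<theta>) z))"
    and anti: "\<And>z \<theta>. B (pair_rotation (c * (\<theta> + pi)) z) = - B (pair_rotation (c * \<theta>) z)"
  shows "(LINT z|lborel. (B z)\<^sup>2 * gauss z) \<le> (LINT z|lborel. (B' z)\<^sup>2 * gauss z)"
proof -
  have int: "integrable lborel (\<lambda>z. (B z)\<^sup>2 * gauss z)" "integrable lborel (\<lambda>z. (B' z)\<^sup>2 * gauss z)"
    using integrable_gauss_product[OF meas(1,1) bound(1,1)] integrable_gauss_product[OF meas(2,2) bound(2,2)]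
    by (simp_all add: power2_eq_square)
  have "(LINT z|lborel. (B z)\<^sup>2 * gauss z - (B' z)\<^sup>2 * gauss z) \<le> 0"
  proof (rule rotation_average_nonpos[OF Bochner_Integration.integrable_diff[OF int] c])
    show "AE z in lborel.
       continuous_on {0..pi} (\<lambda>\<theta>. (B (pair_rotation (c * \<theta>) z))\<^sup>2 * gauss (pair_rotation (c * \<theta>) z) -
          (B' (pair_rotation (c * \<theta>) z))\<^sup>2 * gauss (pair_rotation (c * \<theta>) z)) \<and>
       integral {0..pi} (\<lambda>\<theta>. (B (pair_rotation (c * \<theta>) z))\<^sup>2 * gauss (pair_rotation (c * \<theta>) z) -
          (B' (pair_rotation (c * \<theta>) z))\<^sup>2 * gauss (pair_rotation (c * \<theta>) z)) \<le> 0"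
      using AE_independent_pair[OF dim]
    proof eventually_elim
      case (elim z)
      define b where "b \<theta> = B (pair_rotation (c * \<theta>) z)" for \<theta>
      define b' where "b' \<theta> = B' (pair_rotation (c * \<theta>) z)" for \<theta>
      have db: "(b has_real_derivative b' \<theta>) (at \<theta>)" for \<theta>
        unfolding b_def b'_def by (rule der[OF elim])
      have cb': "continuous_on UNIV b'" unfolding b'_def by (rule cont[OF elim])
      have cb: "continuous_on UNIV b"
        by (auto intro!: continuous_at_imp_continuous_on DERIV_isCont[OF db])
      have ci: "continuous_on {0..pi} (\<lambda>\<theta>. (b \<theta>)\<^sup>2)" "continuous_on {0..pi} (\<lambda>\<theta>. (b' \<theta>)\<^sup>2)"
        by (intro continuous_intros continuous_on_subset[OF cb] continuous_on_subset[OF cb']; simp)+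
      have "integral {0..pi} (\<lambda>\<theta>. (b \<theta>)\<^sup>2) \<le> integral {0..pi} (\<lambda>\<theta>. (b' \<theta>)\<^sup>2)"
        by (rule wirtinger_antiperiodic[OF db cb']) (simp add: b_def anti)
      then have "integral {0..pi} (\<lambda>\<theta>. (b \<theta>)\<^sup>2 - (b' \<theta>)\<^sup>2) \<le> 0"
        by (subst Henstock_Kurzweil_Integration.integral_diff)
          (auto intro!: integrable_continuous_real ci)
      then have "integral {0..pi} (\<lambda>\<theta>. ((b \<theta>)\<^sup>2 - (b' \<theta>)\<^sup>2) * gauss z) \<le> 0"
        using gauss_pos[of z] by (simp add: mult_le_0_iff)
      moreover have "continuous_on {0..pi} (\<lambda>\<theta>. ((b \<theta>)\<^sup>2 - (b' \<theta>)\<^sup>2) * gauss z)"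
        by (intro continuous_intros ci)
      ultimately show ?case
        by (simp add: gauss_pair_rotation b_def b'_def left_diff_distrib)
    qed
  qed
  then show ?thesis using int by simp
qed

subsection \<open>The inequality\<close>

text \<open>With \<open>x\<close> and \<open>y\<close> independent Gaussian vectors, the right-hand side is, up to normalization, the
  expectation of \<open>(D x y)^2\<close>, which is that of the squared gradient. The odd part \<open>F1\<close> of \<open>F\<close> changes sign when the
  pair \<open>(x, y)\<close> is rotated by \<open>pi\<close>. The even part \<open>F2\<close> is handled through \<open>F2 x - F2 y\<close>, which changes
  sign when the pair is rotated by \<open>pi / 2\<close>; here the mean of \<open>F\<close> enters, as it makes the mixed term
  in the square of the difference vanish. Wirtinger's inequality bounds both parts, the even one
  with the better constant \<open>1 / 2\<close>.\<close>

theorem gaussian_poincare: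
  fixes F :: "'a::euclidean_space \<Rightarrow> real" and D :: "'a \<Rightarrow> 'a \<Rightarrow> real"
  assumes dim: "2 \<le> DIM('a)"
    and F: "continuous_on UNIV F" "\<And>x. \<bar>F x\<bar> \<le> K * norm x"
    and der: "\<And>x. x \<noteq> 0 \<Longrightarrow> (F has_derivative D x) (at x)"
    and D0: "\<And>v. D 0 v = 0"
    and cont: "continuous_on ((- {0}) \<times> UNIV) (\<lambda>z. D (fst z) (snd z))"
    and D: "\<And>x v. \<bar>D x v\<bar> \<le> K * norm v"
    and mean: "(LINT x|lborel. F x * gauss x) = 0"
  shows "(LINT z|(lborel :: ('a \<times> 'a) measure). (F (fst z))\<^sup>2 * gauss z) \<le> (LINT z|lborel. (D (fst z) (snd z))\<^sup>2 * gauss z)"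
proof -
  define d where "d z = D (fst z) (snd z)" for z
  have lin: "linear (D x)" for x
    using has_derivative_linear[OF der] D0 by (cases "x = 0") (auto simp: linear_iff)
  have neg: "D x (- v) = - D x v" for x v using linear_neg[OF lin] .
  have K: "0 \<le> K"
  proof -
    have "0 \<le> K * norm (SOME b. b \<in> (Basis :: 'a set))" using order_trans[OF abs_ge_zero F(2)] .
    then show ?thesis by (simp add: some_in_eq)
  qed
  have [measurable]: "F \<in> borel_measurable borel" by (rule borel_measurable_continuous_onI[OF F(1)])
  have [measurable]: "d \<in> borel_measurable borel"
  proof -
    have "(\<lambda>z. indicator ((- {0}) \<times> UNIV) z *\<^sub>R d z) \<in> borel_measurable borel"
      using cont unfolding d_def
      by (intro borel_measurable_continuous_on_indicator) (auto simp: borel_open open_Times open_Compl)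
    moreover have "(\<lambda>z. indicator ((- {0}) \<times> UNIV) z *\<^sub>R d z) = d"
      using D0 by (auto simp: d_def indicator_def fun_eq_iff)
    ultimately show ?thesis by simp
  qed
  have neg_m: "(\<lambda>z. - fst z :: 'a) \<in> borel_measurable (borel :: ('a \<times> 'a) measure)"
    "(\<lambda>z. - snd z :: 'a) \<in> borel_measurable (borel :: ('a \<times> 'a) measure)"
    "fst \<in> borel_measurable (borel :: ('a \<times> 'a) measure)"
    "snd \<in> borel_measurable (borel :: ('a \<times> 'a) measure)"
    "(\<lambda>z. (- fst z, snd z)) \<in> borel_measurable (borel :: ('a \<times> 'a) measure)"
    "(\<lambda>z. (snd z, fst z)) \<in> borel_measurable (borel :: ('a \<times> 'a) measure)"
    "(\<lambda>z. (- snd z, fst z)) \<in> borel_measurable (borel :: ('a \<times> 'a) measure)"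
    by (intro borel_measurable_continuous_onI continuous_intros)+
  \<comment> \<open>In the pair \<open>(x, y)\<close>, the odd part of \<open>F\<close> at \<open>x\<close> is \<open>(a1 - a2) / 2\<close>, and the even parts at \<open>x\<close>
    and at \<open>y\<close> are \<open>(a1 + a2) / 2\<close> and \<open>(b1 + b2) / 2\<close>. The remaining four are derivatives of \<open>F\<close> at
    \<open>x\<close> and at \<open>- x\<close> along \<open>y\<close>, and at \<open>y\<close> and at \<open>- y\<close> along \<open>x\<close>.\<close>
  define a1 a2 b1 b2 where "a1 z = F (fst z)" and "a2 z = F (- fst z)" and "b1 z = F (snd z)"
    and "b2 z = F (- snd z)" for z :: "'a \<times> 'a"
  define d1 d2 e1 e2 where "d1 z = d z" and "d2 z = D (- fst z) (snd z)" and "e1 z = D (snd z) (fst z)"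
    and "e2 z = D (- snd z) (fst z)" for z :: "'a \<times> 'a"
  note defs = a1_def a2_def b1_def b2_def d1_def d2_def e1_def e2_def d_def
  have meas [measurable]: "a1 \<in> borel_measurable borel" "a2 \<in> borel_measurable borel"
    "b1 \<in> borel_measurable borel" "b2 \<in> borel_measurable borel"
    "d1 \<in> borel_measurable borel" "d2 \<in> borel_measurable borel"
    "e1 \<in> borel_measurable borel" "e2 \<in> borel_measurable borel"
    unfolding a1_def[abs_def] a2_def[abs_def] b1_def[abs_def] b2_def[abs_def] d1_def[abs_def]
    using measurable_compose[OF neg_m(3), of F borel] measurable_compose[OF neg_m(1), of F borel]
      measurable_compose[OF neg_m(4), of F borel] measurable_compose[OF neg_m(2), of F borel]
      measurable_compose[OF neg_m(5), of d borel] measurable_compose[OF neg_m(6), of d borel]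
      measurable_compose[OF neg_m(7), of d borel]
      \<open>d \<in> borel_measurable borel\<close>
    by (simp_all add: d2_def[abs_def] e1_def[abs_def] e2_def[abs_def] d_def[abs_def])
  have nf: "K * norm (fst z) \<le> K * norm z" "K * norm (snd z) \<le> K * norm z" for z :: "'a \<times> 'a"
    using norm_fst_le[of "fst z" "snd z"] norm_snd_le[of "snd z" "fst z"] K by (auto intro!: mult_left_mono)
  have bound: "\<bar>a1 z\<bar> \<le> K * norm z" "\<bar>a2 z\<bar> \<le> K * norm z" "\<bar>b1 z\<bar> \<le> K * norm z" "\<bar>b2 z\<bar> \<le> K * norm z"
    "\<bar>d1 z\<bar> \<le> K * norm z" "\<bar>d2 z\<bar> \<le> K * norm z" "\<bar>e1 z\<bar> \<le> K * norm z" "\<bar>e2 z\<bar> \<le> K * norm z" for z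
    unfolding defs
    using F(2)[of "- fst z"] nf[of z]
      F(2)[of "- snd z"] F(2)[of "snd z"] F(2)[of "fst z"] D[of "fst z" "snd z"] D[of "- fst z" "snd z"]
      D[of "snd z" "fst z"] D[of "- snd z" "fst z"]
    by (auto intro: order_trans)
  define J where "J h = (LINT z|lborel. h z * gauss z)" for h :: "'a \<times> 'a \<Rightarrow> real"
  have turn: "J (\<lambda>z. h (snd z, - fst z)) = J h" if "h \<in> borel_measurable borel" for h
    unfolding J_def by (rule integral_gauss_quarter_turn[OF that])
  have chain: "((\<lambda>\<theta>. F (\<gamma> \<theta>)) has_real_derivative c * D (\<gamma> \<theta>) v) (at \<theta>)"
    if "(\<gamma> has_vector_derivative c *\<^sub>R v) (at \<theta>)" "\<gamma> \<theta> \<noteq> 0" for \<gamma> c v \<theta>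
    using has_derivative_compose[OF that(1)[unfolded has_vector_derivative_def] der[OF that(2)]]
    by (simp add: has_field_derivative_def linear_scale[OF lin] mult_commute_abs ac_simps)
  have contD: "continuous_on UNIV (\<lambda>\<theta>. D (p \<theta>) (q \<theta>))"
    if "continuous_on UNIV p" "continuous_on UNIV q" "\<And>\<theta>. p \<theta> \<noteq> 0" for p q :: "real \<Rightarrow> 'a"
    using continuous_on_compose2[OF cont continuous_on_Pair[OF that(1,2)]] that(3) by auto
  have dF: "((\<lambda>\<theta>. a1 (pair_rotation (c * \<theta>) z)) has_real_derivative c * d1 (pair_rotation (c * \<theta>) z)) (at \<theta>)"
    "((\<lambda>\<theta>. a2 (pair_rotation (c * \<theta>) z)) has_real_derivative c * - d2 (pair_rotation (c * \<theta>) z)) (at \<theta>)"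
    "((\<lambda>\<theta>. b1 (pair_rotation (c * \<theta>) z)) has_real_derivative c * - e1 (pair_rotation (c * \<theta>) z)) (at \<theta>)"
    "((\<lambda>\<theta>. b2 (pair_rotation (c * \<theta>) z)) has_real_derivative c * e2 (pair_rotation (c * \<theta>) z)) (at \<theta>)"
    if "independent_pair z" for c z \<theta>
    using has_vector_derivative_pair_rotation[of c z \<theta>] independent_pair_rotation[OF that, of "c * \<theta>"]
      chain[of "\<lambda>\<theta>. fst (pair_rotation (c * \<theta>) z)" c "snd (pair_rotation (c * \<theta>) z)" \<theta>]
      chain[of "\<lambda>\<theta>. - fst (pair_rotation (c * \<theta>) z)" c "- snd (pair_rotation (c * \<theta>) z)" \<theta>]
      chain[of "\<lambda>\<theta>. snd (pair_rotation (c * \<theta>) z)" c "- fst (pair_rotation (c * \<theta>) z)" \<theta>]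
      chain[of "\<lambda>\<theta>. - snd (pair_rotation (c * \<theta>) z)" c "fst (pair_rotation (c * \<theta>) z)" \<theta>]
      has_vector_derivative_minus[OF has_vector_derivative_pair_rotation(1)[of c z \<theta>]]
      has_vector_derivative_minus[OF has_vector_derivative_pair_rotation(2)[of c z \<theta>]]
    unfolding defs by (auto simp: neg)
  have cR: "continuous_on UNIV (\<lambda>\<theta>. fst (pair_rotation (c * \<theta>) z))"
    "continuous_on UNIV (\<lambda>\<theta>. snd (pair_rotation (c * \<theta>) z))" for c and z :: "'a \<times> 'a"
    by (intro continuous_intros continuous_pair_rotation)+
  have cD: "continuous_on UNIV (\<lambda>\<theta>. d1 (pair_rotation (c * \<theta>) z))"
    "continuous_on UNIV (\<lambda>\<theta>. d2 (pair_rotation (c * \<theta>) z))"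
    "continuous_on UNIV (\<lambda>\<theta>. e1 (pair_rotation (c * \<theta>) z))"
    "continuous_on UNIV (\<lambda>\<theta>. e2 (pair_rotation (c * \<theta>) z))" if "independent_pair z" for c z
    unfolding defs
    using independent_pair_rotation[OF that]
    by (intro contD continuous_on_minus cR; simp)+
  have half_turn: "pair_rotation (\<theta> + pi) z = - pair_rotation \<theta> z" for \<theta> and z :: "'a \<times> 'a"
    by (simp add: pair_rotation_def)
  have quarter_turn: "pair_rotation (\<theta> + pi / 2) z = (snd (pair_rotation \<theta> z), - fst (pair_rotation \<theta> z))"
    for \<theta> and z :: "'a \<times> 'a"
    by (simp add: pair_rotation_def cos_add sin_add)
  \<comment> \<open>The odd part turns into its negative after a half turn, so it is followed at unit speed.\<close>
  have odd_part: "J (\<lambda>z. ((a1 z - a2 z) / 2)\<^sup>2) \<le> J (\<lambda>z. ((d1 z + d2 z) / 2)\<^sup>2)"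
    unfolding J_def
  proof (rule antiperiodic_gauss_inequality[OF dim, where c = 1 and K = K])
    fix z :: "'a \<times> 'a" and \<theta>
    show "\<bar>(a1 z - a2 z) / 2\<bar> \<le> K * norm z" using bound(1,2)[of z] unfolding abs_le_iff by (auto simp: field_simps)
    show "\<bar>(d1 z + d2 z) / 2\<bar> \<le> K * norm z" using bound(5,6)[of z] unfolding abs_le_iff by (auto simp: field_simps)
    show "(a1 (pair_rotation (1 * (\<theta> + pi)) z) - a2 (pair_rotation (1 * (\<theta> + pi)) z)) / 2 =
        - ((a1 (pair_rotation (1 * \<theta>) z) - a2 (pair_rotation (1 * \<theta>) z)) / 2)"
      using half_turn[of \<theta> z] by (simp add: a1_def a2_def field_simps)
    assume z: "independent_pair z"
    show "((\<lambda>\<theta>. (a1 (pair_rotation (1 * \<theta>) z) - a2 (pair_rotation (1 * \<theta>) z)) / 2) has_real_derivative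
        (d1 (pair_rotation (1 * \<theta>) z) + d2 (pair_rotation (1 * \<theta>) z)) / 2) (at \<theta>)"
      using DERIV_cdivide[OF DERIV_diff[OF dF(1,2)[OF z, of 1 \<theta>]], of 2] by simp
    show "continuous_on UNIV (\<lambda>\<theta>. (d1 (pair_rotation (1 * \<theta>) z) + d2 (pair_rotation (1 * \<theta>) z)) / 2)"
      by (intro continuous_intros cD[OF z]) auto
  qed auto
  \<comment> \<open>The difference of the even parts turns into its negative already after a quarter turn. It is
    followed at half speed, and the derivative gains a factor \<open>1 / 2\<close>.\<close>
  have even_part: "J (\<lambda>z. ((a1 z + a2 z) / 2 - (b1 z + b2 z) / 2)\<^sup>2) \<le>
      J (\<lambda>z. (((d1 z - d2 z) / 2 + (e1 z - e2 z) / 2) / 2)\<^sup>2)"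
    unfolding J_def
  proof (rule antiperiodic_gauss_inequality[OF dim, where c = "1/2" and K = "2 * K"])
    fix z :: "'a \<times> 'a" and \<theta>
    show "\<bar>(a1 z + a2 z) / 2 - (b1 z + b2 z) / 2\<bar> \<le> 2 * K * norm z"
      using bound(1-4)[of z] unfolding abs_le_iff by (auto simp: field_simps)
    show "\<bar>((d1 z - d2 z) / 2 + (e1 z - e2 z) / 2) / 2\<bar> \<le> 2 * K * norm z"
      using bound(5-8)[of z] unfolding abs_le_iff by (auto simp: field_simps)
    have "1 / 2 * (\<theta> + pi) = 1 / 2 * \<theta> + pi / 2" by simp
    then have "pair_rotation (1 / 2 * (\<theta> + pi)) z =
        (snd (pair_rotation (1 / 2 * \<theta>) z), - fst (pair_rotation (1 / 2 * \<theta>) z))"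
      using quarter_turn[of "1 / 2 * \<theta>" z] by metis
    then show "(a1 (pair_rotation (1 / 2 * (\<theta> + pi)) z) + a2 (pair_rotation (1 / 2 * (\<theta> + pi)) z)) / 2 -
          (b1 (pair_rotation (1 / 2 * (\<theta> + pi)) z) + b2 (pair_rotation (1 / 2 * (\<theta> + pi)) z)) / 2 =
        - ((a1 (pair_rotation (1 / 2 * \<theta>) z) + a2 (pair_rotation (1 / 2 * \<theta>) z)) / 2 -
          (b1 (pair_rotation (1 / 2 * \<theta>) z) + b2 (pair_rotation (1 / 2 * \<theta>) z)) / 2)"
      by (simp only: a1_def a2_def b1_def b2_def fst_conv snd_conv minus_minus) simp
    assume z: "independent_pair z"
    show "((\<lambda>\<theta>. (a1 (pair_rotation (1 / 2 * \<theta>) z) + a2 (pair_rotation (1 / 2 * \<theta>) z)) / 2 -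
          (b1 (pair_rotation (1 / 2 * \<theta>) z) + b2 (pair_rotation (1 / 2 * \<theta>) z)) / 2) has_real_derivative
        ((d1 (pair_rotation (1 / 2 * \<theta>) z) - d2 (pair_rotation (1 / 2 * \<theta>) z)) / 2 +
          (e1 (pair_rotation (1 / 2 * \<theta>) z) - e2 (pair_rotation (1 / 2 * \<theta>) z)) / 2) / 2) (at \<theta>)"
      by (rule DERIV_cong[OF DERIV_diff[OF DERIV_cdivide[OF DERIV_add[OF dF(1,2)[OF z, of "1/2" \<theta>]], of 2]
            DERIV_cdivide[OF DERIV_add[OF dF(3,4)[OF z, of "1/2" \<theta>]], of 2]]]) (simp add: field_simps)
    show "continuous_on UNIV (\<lambda>\<theta>. ((d1 (pair_rotation (1 / 2 * \<theta>) z) - d2 (pair_rotation (1 / 2 * \<theta>) z)) / 2 +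
          (e1 (pair_rotation (1 / 2 * \<theta>) z) - e2 (pair_rotation (1 / 2 * \<theta>) z)) / 2) / 2)"
      by (intro continuous_intros cD[OF z]) auto
  qed auto
  define JJ where "JJ h k = J (\<lambda>z. h z * k z)" for h k :: "'a \<times> 'a \<Rightarrow> real"
  have hb: "has_bochner_integral lborel (\<lambda>z. h z * k z * gauss z) (JJ h k)"
    if "h \<in> {a1, a2, b1, b2, d1, d2, e1, e2}" "k \<in> {a1, a2, b1, b2, d1, d2, e1, e2}" for h k
  proof -
    have "h \<in> borel_measurable borel" "k \<in> borel_measurable borel"
      "\<And>z. \<bar>h z\<bar> \<le> K * norm z" "\<And>z. \<bar>k z\<bar> \<le> K * norm z"
      using that meas bound by auto
    then show ?thesis
      unfolding JJ_def J_def has_bochner_integral_iff using integrable_gauss_product by blast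
  qed
  have mean': "(LINT y|lborel. F (- y) * gauss y) = 0"
  proof -
    have "distr lborel borel uminus = (lborel :: 'a measure)"
      using lborel_affine[of "-1" "0 :: 'a"] by (simp add: density_1)
    then have "(LINT y|lborel. F y * gauss y) = (LINT y|distr lborel borel uminus. F y * gauss (y :: 'a))"
      by simp
    also have "\<dots> = (LINT y|lborel. F (- y) * gauss (- y))" by (rule integral_distr) measurable
    finally show ?thesis using mean by (simp add: gauss_def)
  qed
  have cross: "JJ a1 b1 = 0" "JJ a1 b2 = 0" "JJ a2 b1 = 0" "JJ a2 b2 = 0"
    unfolding JJ_def J_def
    using integral_gauss_split_eq_0[OF _ mean, of F] integral_gauss_split_eq_0[OF _ mean', of F]
      integral_gauss_split_eq_0[OF _ mean, of "\<lambda>x. F (- x)"] integral_gauss_split_eq_0[OF _ mean', of "\<lambda>x. F (- x)"]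
      hb[of a1 b1] hb[of a1 b2] hb[of a2 b1] hb[of a2 b2]
    by (simp_all add: has_bochner_integral_iff a1_def a2_def b1_def b2_def)
  \<comment> \<open>A quarter turn takes \<open>y\<close> to the place of \<open>x\<close>, so that all integrals reduce to those of \<open>a1\<close>, \<open>a2\<close>
    and of \<open>d1\<close>, \<open>d2\<close>.\<close>
  have turns: "JJ b1 b1 = JJ a1 a1" "JJ b2 b2 = JJ a2 a2" "JJ a2 a2 = JJ b1 b1" "JJ b1 b2 = JJ a1 a2"
    "JJ e1 e1 = JJ d1 d1" "JJ e2 e2 = JJ d2 d2" "JJ d2 d2 = JJ e1 e1" "JJ e1 e2 = JJ d1 d2"
    unfolding JJ_def
    using turn[OF borel_measurable_times[OF meas(1) meas(1)]] turn[OF borel_measurable_times[OF meas(2) meas(2)]] 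
       turn[OF borel_measurable_times[OF meas(3) meas(3)]] turn[OF borel_measurable_times[OF meas(1) meas(2)]] 
       turn[OF borel_measurable_times[OF meas(5) meas(5)]] turn[OF borel_measurable_times[OF meas(6) meas(6)]] 
       turn[OF borel_measurable_times[OF meas(7) meas(7)]] turn[OF borel_measurable_times[OF meas(5) meas(6)]]
    by (simp_all add: a1_def a2_def b1_def b2_def d1_def d2_def e1_def e2_def d_def neg)
  have i: "integrable lborel (\<lambda>z. h z * k z * gauss z)" "JJ h k = (LINT z|lborel. h z * k z * gauss z)"
    if "h \<in> {a1, a2, b1, b2, d1, d2, e1, e2}" "k \<in> {a1, a2, b1, b2, d1, d2, e1, e2}" for h k
    using hb[OF that] by (simp_all add: has_bochner_integral_iff)
  have odd_left: "J (\<lambda>z. ((a1 z - a2 z) / 2)\<^sup>2) = (JJ a1 a1 + JJ a2 a2 - 2 * JJ a1 a2) / 4"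
  proof -
    have "J (\<lambda>z. ((a1 z - a2 z) / 2)\<^sup>2) =
        (LINT z|lborel. (a1 z * a1 z * gauss z + a2 z * a2 z * gauss z - 2 * (a1 z * a2 z * gauss z)) / 4)"
      unfolding J_def
      by (intro Bochner_Integration.integral_cong) (auto simp: power2_eq_square field_simps)
    then show ?thesis by (simp add: i)
  qed
  have odd_right: "J (\<lambda>z. ((d1 z + d2 z) / 2)\<^sup>2) = (JJ d1 d1 + JJ d2 d2 + 2 * JJ d1 d2) / 4"
  proof -
    have "J (\<lambda>z. ((d1 z + d2 z) / 2)\<^sup>2) =
        (LINT z|lborel. (d1 z * d1 z * gauss z + d2 z * d2 z * gauss z + 2 * (d1 z * d2 z * gauss z)) / 4)"
      unfolding J_def
      by (intro Bochner_Integration.integral_cong) (auto simp: power2_eq_square field_simps)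
    then show ?thesis by (simp add: i)
  qed
  have even_left: "J (\<lambda>z. ((a1 z + a2 z) / 2 - (b1 z + b2 z) / 2)\<^sup>2) =
      (JJ a1 a1 + JJ a2 a2 + 2 * JJ a1 a2 + (JJ b1 b1 + JJ b2 b2 + 2 * JJ b1 b2)
        - 2 * (JJ a1 b1 + JJ a1 b2 + JJ a2 b1 + JJ a2 b2)) / 4"
  proof -
    have "J (\<lambda>z. ((a1 z + a2 z) / 2 - (b1 z + b2 z) / 2)\<^sup>2) =
        (LINT z|lborel. (a1 z * a1 z * gauss z + a2 z * a2 z * gauss z + 2 * (a1 z * a2 z * gauss z)
          + (b1 z * b1 z * gauss z + b2 z * b2 z * gauss z + 2 * (b1 z * b2 z * gauss z))
          - 2 * (a1 z * b1 z * gauss z + a1 z * b2 z * gauss z + a2 z * b1 z * gauss z + a2 z * b2 z * gauss z)) / 4)"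
      unfolding J_def
      by (intro Bochner_Integration.integral_cong) (auto simp: power2_eq_square field_simps)
    then show ?thesis by (simp add: i)
  qed
  have even_right: "J (\<lambda>z. (((d1 z - d2 z) / 2 + (e1 z - e2 z) / 2) / 2)\<^sup>2) \<le>
      ((JJ d1 d1 + JJ d2 d2 - 2 * JJ d1 d2) + (JJ e1 e1 + JJ e2 e2 - 2 * JJ e1 e2)) / 8"
  proof -
    let ?S = "\<lambda>z. ((d1 z * d1 z * gauss z + d2 z * d2 z * gauss z - 2 * (d1 z * d2 z * gauss z))
          + (e1 z * e1 z * gauss z + e2 z * e2 z * gauss z - 2 * (e1 z * e2 z * gauss z))) / 8"
    have le: "(((d1 z - d2 z) / 2 + (e1 z - e2 z) / 2) / 2)\<^sup>2 * gauss z \<le> ?S z" for z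
    proof -
      define p q where "p = (d1 z - d2 z) / 2" and "q = (e1 z - e2 z) / 2"
      have "((p + q) / 2)\<^sup>2 \<le> (p\<^sup>2 + q\<^sup>2) / 2"
        using zero_le_power2[of "p - q"] by (simp add: power2_eq_square field_simps)
      then have "((p + q) / 2)\<^sup>2 * gauss z \<le> (p\<^sup>2 + q\<^sup>2) / 2 * gauss z"
        using gauss_pos[of z] by (intro mult_right_mono) auto
      also have "\<dots> = ?S z"
        by (simp add: p_def q_def power2_eq_square field_simps)
      finally show ?thesis by (simp add: p_def q_def)
    qed
    have "J (\<lambda>z. (((d1 z - d2 z) / 2 + (e1 z - e2 z) / 2) / 2)\<^sup>2) \<le> (LINT z|lborel. ?S z)"
      unfolding J_def
    proof (rule integral_mono')
      fix z :: "'a \<times> 'a"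
      have "0 \<le> (((d1 z - d2 z) / 2 + (e1 z - e2 z) / 2) / 2)\<^sup>2 * gauss z"
        using gauss_pos[of z] by simp
      then show "0 \<le> ?S z" using le[of z] by (rule order_trans)
    qed (simp add: i, rule le)
    then show ?thesis by (simp add: i)
  qed
  have "0 \<le> J (\<lambda>z. ((d1 z - d2 z) / 2)\<^sup>2)"
    unfolding J_def by (intro integral_nonneg_AE AE_I2 mult_nonneg_nonneg less_imp_le[OF gauss_pos]) simp
  also have "\<dots> = (JJ d1 d1 + JJ d2 d2 - 2 * JJ d1 d2) / 4"
  proof -
    have "J (\<lambda>z. ((d1 z - d2 z) / 2)\<^sup>2) =
        (LINT z|lborel. (d1 z * d1 z * gauss z + d2 z * d2 z * gauss z - 2 * (d1 z * d2 z * gauss z)) / 4)"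
      unfolding J_def
      by (intro Bochner_Integration.integral_cong) (auto simp: power2_eq_square field_simps)
    then show ?thesis by (simp add: i)
  qed
  finally have "JJ d1 d2 \<le> JJ d1 d1" by (simp add: turns)
  moreover have "JJ a1 a1 - JJ a1 a2 \<le> JJ d1 d1 + JJ d1 d2"
    using odd_part unfolding odd_left odd_right by (simp add: turns)
  moreover have "JJ a1 a1 + JJ a1 a2 \<le> (JJ d1 d1 - JJ d1 d2) / 2"
    using order_trans[OF even_part even_right] unfolding even_left
    by (simp add: turns cross field_simps)
  ultimately have "JJ a1 a1 \<le> JJ d1 d1" by (simp add: field_simps)
  then show ?thesis
    by (simp add: JJ_def J_def a1_def d1_def d_def power2_eq_square)
qed

section \<open>The Poincare inequality on the sphere\<close>

text \<open>The divergence theorem for the field \<open>(L \<bullet> \<omega>) L\<close>, whose divergence on the unit sphere is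
  \<open>L \<bullet> L - (L \<bullet> \<omega>)^2\<close>.\<close>

lemma sphere_integral_inner_square:
  fixes L :: "'n::finite space"
  shows "(real CARD('n) + 1) * sphere_integral (\<lambda>p. (L \<bullet> p)\<^sup>2) = (L \<bullet> L) * sphere_integral (\<lambda>p :: 'n space. 1)"
proof -
  define W where "W x = (L \<bullet> sgn x) *\<^sub>R L" for x :: "'n space"
  have W: "C_on (Suc 0) (- {0}) W"
    unfolding W_def by (intro C_on_intros C_on_sgn_punctured) auto
  have hom: "homogeneous0 W"
    unfolding homogeneous0_def W_def by (simp add: sgn_div_norm)
  have div: "divergence W p = L \<bullet> L - (L \<bullet> p)\<^sup>2" if p: "norm p = 1" for p
  proof -
    have p0: "p \<noteq> 0" using p by auto
    have "(W has_derivative (\<lambda>v. (L \<bullet> (inverse (norm p) *\<^sub>R (v - (sgn p \<bullet> v) *\<^sub>R sgn p))) *\<^sub>R L)) (at p)"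
      unfolding W_def
      by (intro has_derivative_scaleR_left has_derivative_inner_right has_derivative_sgn p0)
    from frechet_derivative_at[OF this, symmetric]
    have "dir_deriv b W p = (L \<bullet> b - (p \<bullet> b) * (L \<bullet> p)) *\<^sub>R L" for b
      using p by (simp add: sgn_div_norm inner_diff_right)
    then have "divergence W p = (\<Sum>b\<in>Basis. (L \<bullet> b) * (L \<bullet> b)) - (L \<bullet> p) * (\<Sum>b\<in>Basis. (L \<bullet> b) * (p \<bullet> b))"
      by (simp add: divergence_def left_diff_distrib right_diff_distrib sum_subtractf sum_distrib_left ac_simps)
    then show ?thesis
      by (simp add: euclidean_inner[of L L] euclidean_inner[of L p] power2_eq_square)
  qed
  have c: "continuous_on (sphere 0 1) (\<lambda>p. (L \<bullet> p)\<^sup>2)" by (intro continuous_intros)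
  have "sphere_integral (divergence W) = sphere_integral (\<lambda>p. (L \<bullet> L) * 1 - (L \<bullet> p)\<^sup>2)"
    by (intro sphere_integral_cong) (simp add: div)
  also have "\<dots> = (L \<bullet> L) * sphere_integral (\<lambda>p :: 'n space. 1) - sphere_integral (\<lambda>p. (L \<bullet> p)\<^sup>2)"
    by (subst sphere_integral_diff[OF _ c]) (auto simp: sphere_integral_cmult simp del: mult_1_right)
  finally have 1: "sphere_integral (divergence W) = \<dots>" .
  have "sphere_integral (\<lambda>p. W p \<bullet> p) = sphere_integral (\<lambda>p. (L \<bullet> p)\<^sup>2)"
    by (intro sphere_integral_cong) (simp add: W_def sgn_div_norm power2_eq_square)
  with 1 sphere_divergence[OF W hom] show ?thesis by (simp add: algebra_simps)
qed

definition radial_moment :: "nat \<Rightarrow> nat \<Rightarrow> real" where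
  "radial_moment n k = radial_integral n (\<lambda>\<rho>. \<rho> ^ k * exp (- \<rho>\<^sup>2 / 2))"

lemma integrable_radial_moment:
  "integrable lborel (\<lambda>\<rho>. \<rho> ^ k * exp (- \<rho>\<^sup>2 / 2) * \<rho> ^ n * indicator {0<..} (\<rho>::real))"
proof -
  have "integrable lborel (\<lambda>\<rho>. sqrt (2 * pi) * (std_normal_density \<rho> * \<rho> ^ (k + n)))"
    by (intro integrable_mult_right integrable_std_normal_moment)
  then have "integrable lborel (\<lambda>\<rho>. indicator {0<..} \<rho> *\<^sub>R (sqrt (2 * pi) * (std_normal_density \<rho> * \<rho> ^ (k + n))))"
    by (intro integrable_mult_indicator) auto
  then show ?thesis
    by (simp add: std_normal_density_def power_add ac_simps)
qed

lemma radial_moment_pos: "0 < radial_moment n k"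
proof -
  let ?f = "\<lambda>\<rho>. \<rho> ^ k * exp (- \<rho>\<^sup>2 / 2) * \<rho> ^ n * indicator {0<..} (\<rho>::real)"
  have nonneg: "0 \<le> ?f \<rho>" for \<rho> by (auto simp: indicator_def)
  have "integral\<^sup>L lborel ?f \<noteq> 0"
  proof
    assume "integral\<^sup>L lborel ?f = 0"
    then have "AE \<rho> in lborel. ?f \<rho> = 0"
      using integral_nonneg_eq_0_iff_AE[OF integrable_radial_moment AE_I2[OF nonneg]] by simp
    then have "AE \<rho> in lborel. \<rho> \<notin> {1<..<2::real}"
      by eventually_elim (auto simp: indicator_def)
    then have "{1<..<2::real} \<in> null_sets lborel"
      by (subst AE_iff_null_sets) auto
    then show False by (auto simp: null_sets_def)
  qed
  moreover have "0 \<le> integral\<^sup>L lborel ?f" using nonneg by (intro integral_nonneg_AE) auto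
  ultimately show ?thesis by (simp add: radial_moment_def radial_integral_def)
qed

lemma has_bochner_integral_gauss_polar:
  fixes h :: "'n::finite space \<Rightarrow> real"
  assumes "continuous_on (sphere 0 1) h"
  shows "has_bochner_integral lborel (\<lambda>x. h (sgn x) * norm x ^ k * gauss x)
    (sphere_integral h * radial_moment CARD('n) k)"
  unfolding radial_moment_def gauss_def mult.assoc
  by (rule has_bochner_integral_polar[OF assms _ integrable_radial_moment]) measurable

text \<open>The extension \<open>F x = |x| f (x / |x|)\<close> has mean zero for the Gaussian weight, and its squared gradient
  is \<open>f^2 + |grad f|^2\<close>, constant on rays. In polar coordinates the Gaussian Poincare inequality
  becomes \<open>(n + 1) \<integral> f^2 \<le> \<integral> (f^2 + |grad f|^2)\<close>, the factor \<open>n + 1\<close> being the mean of \<open>|x|^2\<close>.\<close>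

theorem sphere_poincare:
  fixes f :: "'n::finite space \<Rightarrow> real"
  assumes f: "C_on (Suc k) (- {0}) f" and hom: "homogeneous0 f" and mean: "sphere_integral f = 0"
  shows "real CARD('n) * sphere_integral (\<lambda>p. (f p)\<^sup>2) \<le>
    sphere_integral (\<lambda>p. \<Sum>b\<in>Basis. (dir_deriv b f p)\<^sup>2)"
proof -
  let ?S = "sphere (0 :: 'n space) 1" and ?B = "Basis :: 'n space set"
  let ?I1 = "sphere_integral (\<lambda>p :: 'n space. 1)"
  define g where "g b p = dir_deriv b f p" for b p
  have cf: "continuous_on (- {0}) f" and cg: "continuous_on (- {0}) (g b)" for b
    unfolding g_def using C_on_imp_continuous_on[OF f] C_on_imp_continuous_on[OF C_on_dir_deriv[OF f]] by auto
  have cS: "continuous_on ?S f" "continuous_on ?S (g b)" for b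
    by (rule continuous_on_subset[OF cf] continuous_on_subset[OF cg]; force)+
  define F where "F x = norm x * f x" for x
  \<comment> \<open>\<open>G\<close> is the gradient of \<open>F\<close>. The value of \<open>D\<close> at the origin is a convention that concerns a null
    set.\<close>
  define G where "G x = f (sgn x) *\<^sub>R sgn x + (\<Sum>b\<in>Basis. g b (sgn x) *\<^sub>R b)" for x
  define D where "D x v = (if x = 0 then 0 else G x \<bullet> v)" for x v
  have G: "G x \<bullet> v = (sgn x \<bullet> v) * f x + norm x * dir_deriv v f x" if x: "x \<noteq> 0" for x v
  proof -
    have lin: "linear (\<lambda>v. dir_deriv v f (sgn x))"
      using C_on_imp_differentiable[OF f, of "sgn x"] x has_derivative_linear by (auto simp: sgn_zero_iff)
    have "norm x * dir_deriv v f x = dir_deriv v f (sgn x)"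
      using dir_deriv_homogeneous0[OF f hom x] x by simp
    also have "\<dots> = (\<Sum>b\<in>Basis. (v \<bullet> b) * dir_deriv b f (sgn x))"
      using linear_sum[OF lin, of "\<lambda>b. (v \<bullet> b) *\<^sub>R b" ?B] linear_scale[OF lin]
      by (simp add: euclidean_representation)
    also have "\<dots> = (\<Sum>b\<in>Basis. g b (sgn x) *\<^sub>R b) \<bullet> v"
      by (simp add: inner_sum_left g_def inner_commute[of v] mult.commute)
    finally show ?thesis
      using homogeneous0D[OF hom x] by (simp add: G_def inner_add_left mult.commute)
  qed
  have der: "(F has_derivative D x) (at x)" if x: "x \<noteq> 0" for x
  proof -
    have "((\<lambda>x. norm x * f x) has_derivative (\<lambda>v. norm x * dir_deriv v f x + (v \<bullet> sgn x) * f x)) (at x)"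
      using C_on_imp_differentiable[OF f, of x] has_derivative_norm[OF x] x
      by (intro has_derivative_mult) auto
    moreover have "(\<lambda>v. norm x * dir_deriv v f x + (v \<bullet> sgn x) * f x) = D x"
      using x by (auto simp: D_def G inner_commute)
    ultimately show ?thesis by (simp add: F_def[abs_def])
  qed
  have sgn_in: "sgn x \<in> ?S" if "x \<noteq> 0" for x :: "'n space" using that by (simp add: norm_sgn)
  have csgn: "continuous_on A (\<lambda>x. h (sgn x))" if "continuous_on ?S h" "0 \<notin> A"
    for A and h :: "'n space \<Rightarrow> real"
  proof (rule continuous_on_compose2[OF that(1)])
    show "continuous_on A sgn" using that(2) by (intro continuous_intros) blast
    show "sgn ` A \<subseteq> ?S" using that(2) sgn_in by (metis image_subsetI)
  qed
  have cG: "continuous_on (- {0}) G"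
    unfolding G_def by (intro continuous_intros csgn cS) auto
  have cGS: "continuous_on ?S G" by (rule continuous_on_subset[OF cG]) auto
  obtain K where K: "\<And>p. p \<in> ?S \<Longrightarrow> norm (f p) \<le> K" "\<And>p. p \<in> ?S \<Longrightarrow> norm (G p) \<le> K"
  proof -
    have "bounded (f ` ?S)" "bounded (G ` ?S)"
      by (intro compact_imp_bounded compact_continuous_image cS cGS; simp)+
    then obtain K1 K2 where "\<forall>p\<in>?S. norm (f p) \<le> K1" "\<forall>p\<in>?S. norm (G p) \<le> K2"
      by (auto simp: bounded_iff)
    then show ?thesis using that[of "max K1 K2"] by fastforce
  qed
  have "sgn (sgn x) = sgn x" for x :: "'n space"
    by (cases "x = 0") (simp_all add: sgn_div_norm)
  then have G_sgn: "G (sgn x) = G x" for x by (simp add: G_def)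
  have bF: "\<bar>F x\<bar> \<le> K * norm x" for x
  proof (cases "x = 0")
    case False
    then show ?thesis
      using mult_left_mono[OF K(1)[OF sgn_in[OF False]], of "norm x"] homogeneous0D[OF hom False]
      by (simp add: F_def abs_mult mult.commute)
  qed (simp add: F_def)
  have K0: "0 \<le> K"
  proof -
    obtain b where "b \<in> ?B" using nonempty_Basis by blast
    then have "norm (f b) \<le> K" by (intro K) simp
    then show ?thesis by (rule order_trans[OF norm_ge_zero])
  qed
  have bD: "\<bar>D x v\<bar> \<le> K * norm v" for x v
  proof (cases "x = 0")
    case False
    have "\<bar>G x \<bullet> v\<bar> \<le> norm (G x) * norm v" by (rule Cauchy_Schwarz_ineq2)
    also have "\<dots> \<le> K * norm v"
      using K(2)[OF sgn_in[OF False]] by (intro mult_right_mono) (auto simp: G_sgn)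
    finally show ?thesis using False by (simp add: D_def)
  qed (use K0 in \<open>simp add: D_def\<close>)
  have cF: "continuous_on UNIV F"
  proof -
    have "isCont F x" for x
    proof (cases "x = 0")
      case True
      have "(F \<longlongrightarrow> 0) (at 0)"
        by (rule tendsto_0_le[where K = K and f = "\<lambda>x. norm x"])
          (use bF in \<open>auto intro!: tendsto_eq_intros simp: mult.commute\<close>)
      then show ?thesis using True by (simp add: isCont_def F_def)
    qed (use has_derivative_continuous[OF der] in auto)
    then show ?thesis by (simp add: continuous_at_imp_continuous_on)
  qed
  have cD: "continuous_on ((- {0}) \<times> UNIV) (\<lambda>z. D (fst z) (snd z))"
  proof -
    have "continuous_on ((- {0}) \<times> UNIV) (\<lambda>z :: 'n space \<times> 'n space. G (fst z) \<bullet> snd z)"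
      by (intro continuous_intros continuous_on_compose2[OF cG]) auto
    then show ?thesis by (rule continuous_on_eq) (auto simp: D_def)
  qed
  have F_polar: "F x = f (sgn x) * norm x ^ 1" for x
    using homogeneous0D[OF hom, of x] by (cases "x = 0") (auto simp: F_def)
  have "(LINT x|lborel. F x * gauss x) = 0"
    using has_bochner_integral_gauss_polar[OF cS(1), of 1] mean
    by (simp add: F_polar has_bochner_integral_iff)
  then have poincare: "(LINT z|(lborel :: ('n space \<times> 'n space) measure). (F (fst z))\<^sup>2 * gauss z) \<le> (LINT z|lborel. (D (fst z) (snd z))\<^sup>2 * gauss z)"
    by (intro gaussian_poincare[OF _ cF bF der _ cD bD]) (auto simp: D_def)
  have mF: "(\<lambda>z :: 'n space \<times> 'n space. F (fst z)) \<in> borel_measurable borel"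
    by (intro borel_measurable_continuous_onI continuous_on_compose2[OF cF] continuous_intros) auto
  have mD: "(\<lambda>z. D (fst z) (snd z)) \<in> borel_measurable borel"
  proof -
    have "(\<lambda>z. indicator ((- {0}) \<times> UNIV) z *\<^sub>R D (fst z) (snd z)) \<in> borel_measurable borel"
      by (intro borel_measurable_continuous_on_indicator cD) (auto simp: borel_open open_Times open_Compl)
    moreover have "(\<lambda>z. indicator ((- {0}) \<times> UNIV) z *\<^sub>R D (fst z) (snd z)) = (\<lambda>z. D (fst z) (snd z))"
      by (auto simp: D_def indicator_def fun_eq_iff)
    ultimately show ?thesis by simp
  qed
  have nz: "K * norm (fst z) \<le> K * norm z" "K * norm (snd z) \<le> K * norm z" for z :: "'n space \<times> 'n space"
    using norm_fst_le[of "fst z" "snd z"] norm_snd_le[of "snd z" "fst z"] K0 by (auto intro!: mult_left_mono)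
  have iF: "integrable lborel (\<lambda>z :: 'n space \<times> 'n space. (F (fst z))\<^sup>2 * gauss z)" and iD: "integrable lborel (\<lambda>z. (D (fst z) (snd z))\<^sup>2 * gauss z)"
    using integrable_gauss_product[OF mF mF, of K] integrable_gauss_product[OF mD mD, of K]
      order_trans[OF bF nz(1)] order_trans[OF bD nz(2)]
    by (simp_all add: power2_eq_square)
  let ?R = "radial_moment CARD('n)"
  have c2: "continuous_on ?S (\<lambda>p. (f p)\<^sup>2)" "continuous_on ?S (\<lambda>p. G p \<bullet> G p)"
    by (intro continuous_intros cS cGS)+
  have left: "(LINT z|(lborel :: ('n space \<times> 'n space) measure). (F (fst z))\<^sup>2 * gauss z) = sphere_integral (\<lambda>p. (f p)\<^sup>2) * ?R 2 * (?I1 * ?R 0)"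
  proof -
    have "(LINT z|(lborel :: ('n space \<times> 'n space) measure). (F (fst z))\<^sup>2 * gauss z) =
        (LINT x|lborel. LINT y|lborel. (F x)\<^sup>2 * gauss (x, y :: 'n space))"
      using lborel_pair.integral_fst'[of "\<lambda>z :: 'n space \<times> 'n space. (F (fst z))\<^sup>2 * gauss z"] iF by (simp add: lborel_prod)
    also have "\<dots> = (LINT x|lborel. ((f (sgn x))\<^sup>2 * norm x ^ 2 * gauss x) * (LINT y|lborel. gauss (y :: 'n space)))"
      by (simp add: gauss_Pair F_polar power_mult_distrib mult.assoc)
    also have "(LINT y|lborel. gauss (y :: 'n space)) = ?I1 * ?R 0"
      using has_bochner_integral_gauss_polar[of "\<lambda>_ :: 'n space. 1" 0] by (simp add: has_bochner_integral_iff)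
    finally show ?thesis
      using has_bochner_integral_gauss_polar[OF c2(1), of 2] by (simp add: has_bochner_integral_iff)
  qed
  have inner: "(LINT y|lborel. (L \<bullet> y)\<^sup>2 * gauss y) = (L \<bullet> L) * (?I1 / (real CARD('n) + 1) * ?R 2)" for L :: "'n space"
  proof -
    have square: "(L \<bullet> sgn y)\<^sup>2 * norm y ^ 2 = (L \<bullet> y)\<^sup>2" for y
      by (cases "y = 0") (simp_all add: sgn_div_norm power_mult_distrib power_inverse)
    have "continuous_on ?S (\<lambda>p. (L \<bullet> p)\<^sup>2)" by (intro continuous_intros)
    from has_bochner_integral_gauss_polar[OF this, of 2]
    have "(LINT y|lborel. (L \<bullet> y)\<^sup>2 * gauss y) = sphere_integral (\<lambda>p. (L \<bullet> p)\<^sup>2) * ?R 2"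
      by (simp only: square has_bochner_integral_iff)
    also have "sphere_integral (\<lambda>p. (L \<bullet> p)\<^sup>2) = (L \<bullet> L) * ?I1 / (real CARD('n) + 1)"
      using sphere_integral_inner_square[of L] by (simp add: field_simps)
    finally show ?thesis by simp
  qed
  have right: "(LINT z|lborel. (D (fst z) (snd z))\<^sup>2 * gauss z) =
      sphere_integral (\<lambda>p. G p \<bullet> G p) * ?R 0 * (?I1 / (real CARD('n) + 1) * ?R 2)"
  proof -
    have "(LINT z|lborel. (D (fst z) (snd z))\<^sup>2 * gauss z) =
        (LINT x|lborel. LINT y|lborel. (D x y)\<^sup>2 * gauss (x, y))"
      using lborel_pair.integral_fst'[of "\<lambda>z. (D (fst z) (snd z))\<^sup>2 * gauss z"] iD by (simp add: lborel_prod)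
    also have "\<dots> = (LINT x|lborel. ((G (sgn x) \<bullet> G (sgn x)) * norm x ^ 0 * gauss x) * (?I1 / (real CARD('n) + 1) * ?R 2))"
    proof (rule integral_cong_AE)
      show "AE x in lborel. (LINT y|lborel. (D x y)\<^sup>2 * gauss (x, y)) =
        (G (sgn x) \<bullet> G (sgn x)) * norm x ^ 0 * gauss x * (?I1 / (real CARD('n) + 1) * ?R 2)"
        using AE_lborel_singleton[of "0 :: 'n space"]
      proof eventually_elim
        case (elim x)
        have "(LINT y|lborel. (D x y)\<^sup>2 * gauss (x, y)) = (LINT y|lborel. gauss x * ((G x \<bullet> y)\<^sup>2 * gauss y))"
          using elim by (simp add: D_def gauss_Pair ac_simps)
        then show ?case by (simp add: inner G_sgn)
      qed
      show "(\<lambda>x. LINT y|lborel. (D x y)\<^sup>2 * gauss (x, y)) \<in> borel_measurable lborel"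
        using lborel_pair.integrable_fst'[of "\<lambda>z. (D (fst z) (snd z))\<^sup>2 * gauss z"] iD
        by (intro borel_measurable_integrable) (simp add: lborel_prod)
      show "(\<lambda>x. (G (sgn x) \<bullet> G (sgn x)) * norm x ^ 0 * gauss x * (?I1 / (real CARD('n) + 1) * ?R 2)) \<in> borel_measurable lborel"
        by (intro borel_measurable_integrable integrable_mult_left
            integrable.intros[OF has_bochner_integral_gauss_polar[OF c2(2)]])
    qed
    also have "\<dots> = (LINT x|lborel. (G (sgn x) \<bullet> G (sgn x)) * norm x ^ 0 * gauss x) * (?I1 / (real CARD('n) + 1) * ?R 2)"
      by (rule integral_mult_left_zero)
    finally show ?thesis
      using has_bochner_integral_gauss_polar[OF c2(2), of 0] by (simp only: has_bochner_integral_iff)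
  qed
  have "G p \<bullet> G p = (f p)\<^sup>2 + (\<Sum>b\<in>Basis. (g b p)\<^sup>2)" if p: "norm p = 1" for p
  proof -
    have p0: "p \<noteq> 0" "sgn p = p" using p by (auto simp: sgn_div_norm)
    have "G p \<bullet> p = f p"
      using G[of p p] p p0 dir_deriv_radial[OF f hom p0(1)] by (simp add: dot_square_norm)
    moreover have "G p \<bullet> (\<Sum>b\<in>Basis. g b p *\<^sub>R b) = (\<Sum>b\<in>Basis. (g b p)\<^sup>2)"
    proof -
      have "p \<bullet> (\<Sum>b\<in>Basis. g b p *\<^sub>R b) = 0"
        using G[of p p] p p0 dir_deriv_radial[OF f hom p0(1)]
        by (simp add: G_def inner_add_left inner_add_right dot_square_norm inner_commute)
      moreover have "(\<Sum>b\<in>Basis. g b p *\<^sub>R b) \<bullet> (\<Sum>b\<in>Basis. g b p *\<^sub>R b) = (\<Sum>b\<in>Basis. (g b p)\<^sup>2)"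
        by (simp add: inner_sum_right inner_sum_left_Basis power2_eq_square)
      ultimately show ?thesis by (simp add: G_def p0 inner_add_left)
    qed
    ultimately show ?thesis
      using p0 by (subst (2) G_def) (simp add: inner_add_right power2_eq_square)
  qed
  then have "sphere_integral (\<lambda>p. G p \<bullet> G p) = sphere_integral (\<lambda>p. (f p)\<^sup>2 + (\<Sum>b\<in>Basis. (g b p)\<^sup>2))"
    by (intro sphere_integral_cong) auto
  also have "\<dots> = sphere_integral (\<lambda>p. (f p)\<^sup>2) + sphere_integral (\<lambda>p. \<Sum>b\<in>Basis. (g b p)\<^sup>2)"
    by (intro sphere_integral_add c2 continuous_intros cS)
  finally have GG: "sphere_integral (\<lambda>p. G p \<bullet> G p) = \<dots>" .
  define c where "c = ?I1 * ?R 0 * ?R 2"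
  have c: "0 < c" using sphere_integral_1_pos[where 'n = 'n] radial_moment_pos by (simp add: c_def)
  have "c * sphere_integral (\<lambda>p. (f p)\<^sup>2) \<le> c * (sphere_integral (\<lambda>p. G p \<bullet> G p) / (real CARD('n) + 1))"
    using poincare unfolding left right by (simp add: c_def ac_simps)
  then have "sphere_integral (\<lambda>p. (f p)\<^sup>2) \<le> sphere_integral (\<lambda>p. G p \<bullet> G p) / (real CARD('n) + 1)"
    using c by (rule mult_left_le_imp_le)
  then show ?thesis
    unfolding GG by (simp add: field_simps g_def)
qed

section \<open>Moving frames and determinants\<close>

subsection \<open>Orthonormal frames of a hemisphere\<close>

abbreviation horizontal :: "'n::finite \<Rightarrow> 'n space" where
  "horizontal i \<equiv> (axis i 1, 0)"

lemma sum_Basis_space: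
  "(\<Sum>b\<in>Basis. g b) = (\<Sum>i\<in>UNIV. g (horizontal i)) + g (0 :: real ^ 'n::finite, 1 :: real)"
proof -
  have "(\<Sum>b\<in>Basis. g b) = (\<Sum>b\<in>(\<lambda>u. (u, 0)) ` (Basis :: (real ^ 'n) set). g b)
      + (\<Sum>b\<in>(\<lambda>u. (0, u)) ` (Basis :: real set). g b)"
    unfolding Basis_prod_def by (rule sum.union_disjoint) auto
  also have "(\<Sum>b\<in>(\<lambda>u. (u, 0)) ` (Basis :: (real ^ 'n) set). g b) = (\<Sum>b\<in>(Basis :: (real ^ 'n) set). g (b, 0))"
    by (subst sum.reindex) (auto intro: inj_onI)
  also have "(Basis :: (real ^ 'n) set) = (\<lambda>i. axis i 1) ` UNIV"
    by (auto simp: Basis_vec_def)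
  also have "(\<Sum>b\<in>(\<lambda>i. axis i 1) ` UNIV. g (b, 0)) = (\<Sum>i\<in>UNIV. g (horizontal i))"
    by (subst sum.reindex) (auto intro!: inj_onI simp: axis_eq_axis)
  finally show ?thesis by simp
qed

text \<open>The reflection that exchanges the pole \<open>(0, 1)\<close> and the point \<open>- \<sigma> \<omega>\<close>. It carries the
  horizontal coordinate vectors to an orthonormal basis of the tangent space at \<open>\<omega>\<close>, smoothly
  in \<open>\<omega>\<close> on the hemisphere.\<close>

definition reflect :: "real \<Rightarrow> 'n::finite space \<Rightarrow> 'n space \<Rightarrow> 'n space" where
  "reflect \<sigma> \<omega> x = x - (((\<omega> + (0, \<sigma>)) \<bullet> x) / (1 + \<sigma> * snd \<omega>)) *\<^sub>R (\<omega> + (0, \<sigma>))"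

definition frame :: "real \<Rightarrow> 'n::finite space \<Rightarrow> 'n \<Rightarrow> 'n space" where
  "frame \<sigma> \<omega> i = reflect \<sigma> \<omega> (horizontal i)"

context
  fixes \<sigma> :: real and \<omega> :: "'n::finite space"
  assumes \<sigma>: "\<sigma> = 1 \<or> \<sigma> = -1" and \<omega>: "norm \<omega> = 1" and pos: "0 < 1 + \<sigma> * snd \<omega>"
begin

lemma axis_square: "(\<omega> + (0, \<sigma>)) \<bullet> (\<omega> + (0, \<sigma>)) = 2 * (1 + \<sigma> * snd \<omega>)"
proof -
  have "\<omega> \<bullet> \<omega> = 1" using \<omega> by (simp add: dot_square_norm)
  moreover have "\<omega> \<bullet> (0, \<sigma>) = \<sigma> * snd \<omega>" by (simp add: inner_prod_def)
  moreover have "(0 :: real ^ 'n, \<sigma>) \<bullet> (0, \<sigma>) = 1" using \<sigma> by (auto simp: inner_prod_def)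
  ultimately show ?thesis by (simp add: inner_add_left inner_add_right inner_commute)
qed

lemma reflect_inner: "reflect \<sigma> \<omega> x \<bullet> reflect \<sigma> \<omega> y = x \<bullet> y"
proof -
  define k m where "k = \<omega> + (0, \<sigma>)" and "m = 1 + \<sigma> * snd \<omega>"
  have m: "m \<noteq> 0" and kk: "k \<bullet> k = 2 * m" using pos axis_square by (auto simp: k_def m_def)
  have "reflect \<sigma> \<omega> x \<bullet> reflect \<sigma> \<omega> y = (x - ((k \<bullet> x) / m) *\<^sub>R k) \<bullet> (y - ((k \<bullet> y) / m) *\<^sub>R k)"
    by (simp add: reflect_def k_def m_def)
  also have "\<dots> = x \<bullet> y - 2 * ((k \<bullet> x) * (k \<bullet> y) / m) + (k \<bullet> x) * (k \<bullet> y) / (m * m) * (k \<bullet> k)"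
    by (simp add: inner_diff_left inner_diff_right inner_commute algebra_simps)
  also have "\<dots> = x \<bullet> y" using m by (simp add: kk)
  finally show ?thesis .
qed

lemma reflect_self_adjoint: "reflect \<sigma> \<omega> x \<bullet> y = x \<bullet> reflect \<sigma> \<omega> y"
  by (simp add: reflect_def inner_diff_left inner_diff_right inner_commute)

lemma reflect_pole: "reflect \<sigma> \<omega> (0, 1) = - \<sigma> *\<^sub>R \<omega>"
proof -
  have "(\<omega> + (0, \<sigma>)) \<bullet> (0, 1) = \<sigma> * (1 + \<sigma> * snd \<omega>)"
    using \<sigma> by (auto simp: inner_prod_def)
  then have "reflect \<sigma> \<omega> (0, 1) = (0, 1) - \<sigma> *\<^sub>R (\<omega> + (0, \<sigma>))"
    using pos by (simp add: reflect_def)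
  also have "\<dots> = - \<sigma> *\<^sub>R \<omega>" using \<sigma> by (auto simp: prod_eq_iff)
  finally show ?thesis .
qed

lemma frame_orthonormal: "frame \<sigma> \<omega> i \<bullet> frame \<sigma> \<omega> j = (if i = j then 1 else 0)"
  unfolding frame_def reflect_inner by (simp add: inner_prod_def inner_axis_axis)

lemma frame_tangent: "frame \<sigma> \<omega> i \<bullet> \<omega> = 0"
proof -
  have "frame \<sigma> \<omega> i \<bullet> (- \<sigma> *\<^sub>R \<omega>) = 0"
    unfolding frame_def reflect_pole[symmetric] reflect_inner by (simp add: inner_prod_def)
  then show ?thesis using \<sigma> by auto
qed

lemma frame_expansion: "x = (\<Sum>j\<in>UNIV. (x \<bullet> frame \<sigma> \<omega> j) *\<^sub>R frame \<sigma> \<omega> j) + (x \<bullet> \<omega>) *\<^sub>R \<omega>"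
proof (rule euclidean_eqI)
  fix b :: "'n space"
  let ?R = "reflect \<sigma> \<omega>"
  have "x \<bullet> b = ?R x \<bullet> ?R b" by (simp add: reflect_inner)
  also have "\<dots> = (\<Sum>c\<in>Basis. (?R x \<bullet> c) * (?R b \<bullet> c))" by (rule euclidean_inner)
  also have "\<dots> = (\<Sum>c\<in>Basis. (x \<bullet> ?R c) * (b \<bullet> ?R c))" by (simp add: reflect_self_adjoint)
  also have "\<dots> = (\<Sum>j\<in>UNIV. (x \<bullet> frame \<sigma> \<omega> j) * (b \<bullet> frame \<sigma> \<omega> j)) + (x \<bullet> \<omega>) * (b \<bullet> \<omega>)"
    using \<sigma> by (auto simp: sum_Basis_space frame_def reflect_pole)
  also have "\<dots> = ((\<Sum>j\<in>UNIV. (x \<bullet> frame \<sigma> \<omega> j) *\<^sub>R frame \<sigma> \<omega> j) + (x \<bullet> \<omega>) *\<^sub>R \<omega>) \<bullet> b"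
    by (simp add: inner_add_right inner_sum_right inner_commute[of _ b])
  finally show "x \<bullet> b = \<dots>" .
qed

text \<open>The trace of a bilinear form does not depend on the orthonormal basis, and the reflection carries
  the standard basis to the frame completed by \<open>\<omega>\<close>, up to sign.\<close>

lemma frame_trace:
  assumes B: "bounded_bilinear B"
  shows "(\<Sum>b\<in>Basis. B b b) = (\<Sum>i\<in>UNIV. B (frame \<sigma> \<omega> i) (frame \<sigma> \<omega> i)) + B \<omega> \<omega>"
proof -
  let ?R = "reflect \<sigma> \<omega>"
  have exp: "B u v = (\<Sum>c\<in>Basis. \<Sum>d\<in>Basis. ((u \<bullet> c) * (v \<bullet> d)) *\<^sub>R B c d)" for u v
  proof -
    have "B u v = B (\<Sum>c\<in>Basis. (u \<bullet> c) *\<^sub>R c) (\<Sum>d\<in>Basis. (v \<bullet> d) *\<^sub>R d)"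
      by (simp add: euclidean_representation)
    also have "\<dots> = (\<Sum>c\<in>Basis. \<Sum>d\<in>Basis. ((u \<bullet> c) * (v \<bullet> d)) *\<^sub>R B c d)"
      by (simp only: bounded_bilinear.sum_left[OF B] bounded_bilinear.sum_right[OF B]
          bounded_bilinear.scaleR_left[OF B] bounded_bilinear.scaleR_right[OF B] scaleR_scaleR)
        (simp add: scaleR_sum_right mult.commute, rule sum.swap)
    finally show ?thesis .
  qed
  have gram: "(\<Sum>b\<in>Basis. (?R b \<bullet> c) * (?R b \<bullet> d)) = c \<bullet> d" for c d
  proof -
    have "(\<Sum>b\<in>Basis. (?R b \<bullet> c) * (?R b \<bullet> d)) = (\<Sum>b\<in>Basis. (?R c \<bullet> b) * (?R d \<bullet> b))"
      using reflect_self_adjoint by (intro sum.cong refl arg_cong2[where f = "(*)"]) (metis inner_commute)+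
    also have "\<dots> = c \<bullet> d" using euclidean_inner[of "?R c" "?R d"] reflect_inner by metis
    finally show ?thesis .
  qed
  have "(\<Sum>b\<in>Basis. B (?R b) (?R b)) = (\<Sum>c\<in>Basis. \<Sum>d\<in>Basis. \<Sum>b\<in>Basis. ((?R b \<bullet> c) * (?R b \<bullet> d)) *\<^sub>R B c d)"
    by (subst exp, subst sum.swap, rule sum.cong[OF refl], subst sum.swap) simp
  also have "\<dots> = (\<Sum>c\<in>Basis. \<Sum>d\<in>Basis. (c \<bullet> d) *\<^sub>R B c d)"
    by (simp only: scaleR_sum_left[symmetric] gram)
  also have "\<dots> = (\<Sum>c\<in>Basis. B c c)"
    by (intro sum.cong refl) (simp add: inner_Basis if_distrib[of "\<lambda>t. t *\<^sub>R _"] cong: if_cong)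
  finally have "(\<Sum>c\<in>Basis. B c c) = (\<Sum>b\<in>Basis. B (?R b) (?R b))" ..
  also have "\<dots> = (\<Sum>i\<in>UNIV. B (frame \<sigma> \<omega> i) (frame \<sigma> \<omega> i)) + B (- \<sigma> *\<^sub>R \<omega>) (- \<sigma> *\<^sub>R \<omega>)"
    by (simp only: sum_Basis_space frame_def reflect_pole)
  also have "B (- \<sigma> *\<^sub>R \<omega>) (- \<sigma> *\<^sub>R \<omega>) = B \<omega> \<omega>"
    using \<sigma> by (auto simp: bounded_bilinear.minus_left[OF B] bounded_bilinear.minus_right[OF B])
  finally show ?thesis .
qed

end

subsection \<open>Determinants\<close>

text \<open>In an orthonormal basis that starts with the direction of \<open>u\<close> the matrix is diagonal, with a
  single entry that differs from one.\<close>

lemma det_rank_one_perturbation: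
  fixes u :: "real ^ 'n::finite"
  shows "det (\<chi> i j. (if i = j then 1 else 0) - c * (u $ i * u $ j)) = 1 - c * (u \<bullet> u)"
proof (cases "u = 0")
  case True
  then have "(\<chi> i j. (if i = j then 1 else 0) - c * (u $ i * u $ j)) = mat 1"
    by (simp add: mat_def vec_eq_iff)
  then show ?thesis using True by simp
next
  case False
  obtain k :: 'n where True by simp
  have "norm (sgn u) = 1" using False by (simp add: norm_sgn)
  then obtain Q :: "real ^ 'n ^ 'n" where Q: "orthogonal_matrix Q" "Q *v axis k 1 = sgn u"
    using orthogonal_matrix_exists_basis by metis
  have QQ: "transpose Q ** Q = mat 1" using Q(1) by (simp add: orthogonal_matrix)
  have Qk: "Q $ i $ k * norm u = u $ i" for i
  proof -
    have "Q $ i $ k = sgn u $ i"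
      using arg_cong[OF Q(2), of "\<lambda>v. v $ i"] by (simp add: matrix_vector_mul_component inner_axis)
    then show ?thesis using False by (simp add: sgn_div_norm)
  qed
  let ?A = "(\<chi> i j. (if i = j then 1 else 0) - c * (u $ i * u $ j)) :: real ^ 'n ^ 'n"
  let ?D = "(\<chi> i j. if i = j then (if i = k then 1 - c * (u \<bullet> u) else 1) else 0) :: real ^ 'n ^ 'n"
  have "Q ** ?D = ?A ** Q"
  proof -
    have uQ: "(\<Sum>l\<in>UNIV. u $ l * Q $ l $ j) = (if j = k then norm u else 0)" for j
    proof -
      have "norm u * (\<Sum>l\<in>UNIV. Q $ l $ k * Q $ l $ j) = (\<Sum>l\<in>UNIV. u $ l * Q $ l $ j)"
        unfolding Qk[symmetric] by (simp add: sum_distrib_left ac_simps)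
      moreover have "(\<Sum>l\<in>UNIV. Q $ l $ k * Q $ l $ j) = (if k = j then 1 else 0)"
        using arg_cong[OF QQ, of "\<lambda>M. M $ k $ j"] by (simp add: matrix_matrix_mult_def transpose_def mat_def)
      ultimately show ?thesis by auto
    qed
    have AQ: "(?A ** Q) $ i $ j = Q $ i $ j - c * (u $ i * (\<Sum>l\<in>UNIV. u $ l * Q $ l $ j))" for i j
      by (simp add: matrix_matrix_mult_def left_diff_distrib sum_subtractf sum_distrib_left mult.assoc
          if_distrib[of "\<lambda>t. t * _"] if_distrib[of "\<lambda>t. _ * t"] cong: if_cong)
    have QD: "(Q ** ?D) $ i $ j = Q $ i $ j * (if j = k then 1 - c * (u \<bullet> u) else 1)" for i j
      by (simp add: matrix_matrix_mult_def if_distrib[of "\<lambda>t. _ * t"] cong: if_cong)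
    have uu: "u \<bullet> u = norm u * norm u" by (simp add: dot_square_norm power2_eq_square)
    have "(Q ** ?D) $ i $ j = (?A ** Q) $ i $ j" for i j
      unfolding AQ QD unfolding uQ uu Qk[symmetric, of i]
      by (cases "j = k") (simp_all add: right_diff_distrib ac_simps)
    then show ?thesis by (intro vec_eq_iff[THEN iffD2] allI)
  qed
  from arg_cong[OF this, of det] have "det Q * det ?D = det ?A * det Q" by (simp only: det_mul)
  moreover have "det Q \<noteq> 0" using det_orthogonal_matrix[OF Q(1)] by auto
  ultimately have "det ?A = det ?D" by (simp add: mult.commute)
  also have "\<dots> = (\<Prod>i\<in>UNIV. ?D $ i $ i)" by (rule det_diagonal) simp
  also have "\<dots> = 1 - c * (u \<bullet> u)" by (simp add: prod.delta)
  finally show ?thesis .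
qed

lemma has_jet2_prod_equal:
  fixes m :: "'i \<Rightarrow> real \<Rightarrow> real"
  assumes "finite I" and a: "a \<noteq> 0" and m: "\<And>i. i \<in> I \<Longrightarrow> has_jet2 (m i) a b (C i)"
  shows "has_jet2 (\<lambda>s. \<Prod>i\<in>I. m i s) (a ^ card I) (a ^ card I * (card I * (b / a)))
    (a ^ card I * ((\<Sum>i\<in>I. C i / a) + (real (card I) * real (card I) - card I) * (b / a)\<^sup>2))"
  using assms(1) m
proof (induction I)
  case empty
  then show ?case using has_jet2_const[of 1] by simp
next
  case (insert i I)
  have "has_jet2 (\<lambda>s. m i s * (\<Prod>i\<in>I. m i s)) (a * a ^ card I)
      (a * (a ^ card I * (card I * (b / a))) + b * a ^ card I)
      (a * (a ^ card I * ((\<Sum>i\<in>I. C i / a) + (real (card I) * real (card I) - card I) * (b / a)\<^sup>2)) +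
        2 *\<^sub>R (b * (a ^ card I * (card I * (b / a)))) + C i * a ^ card I)"
    by (intro has_jet2_mult) (use insert in auto)
  moreover have "a * (a ^ card I * (card I * (b / a))) + b * a ^ card I =
      a ^ card (insert i I) * (card (insert i I) * (b / a))"
    using insert a by (simp add: field_simps)
  moreover have "a * (a ^ card I * ((\<Sum>i\<in>I. C i / a) + (real (card I) * real (card I) - card I) * (b / a)\<^sup>2)) +
        2 *\<^sub>R (b * (a ^ card I * (card I * (b / a)))) + C i * a ^ card I =
      a ^ card (insert i I) * ((\<Sum>i\<in>insert i I. C i / a) +
        (real (card (insert i I)) * real (card (insert i I)) - card (insert i I)) * (b / a)\<^sup>2)"
    using insert a by (simp add: field_simps power2_eq_square)
  ultimately show ?case using insert by simp
qed

lemma has_jet2_prod_vanishing: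
  fixes m :: "'i \<Rightarrow> real \<Rightarrow> real"
  assumes "finite I" and ij: "i \<in> I" "j \<in> I" "i \<noteq> j"
    and vanish: "has_jet2 (m i) 0 0 c" "has_jet2 (m j) 0 0 d"
    and m: "\<And>l. l \<in> I \<Longrightarrow> \<exists>a b c. has_jet2 (m l) a b c"
  shows "has_jet2 (\<lambda>s. \<Prod>i\<in>I. m i s) 0 0 0"
proof -
  have rest: "\<exists>a b c. has_jet2 (\<lambda>s. \<Prod>l\<in>J. m l s) a b c" if "finite J" "J \<subseteq> I" for J
    using that
  proof (induction J)
    case empty
    then show ?case using has_jet2_const[of 1] by auto
  next
    case (insert l J)
    then obtain a b c a' b' c' where "has_jet2 (\<lambda>s. \<Prod>l\<in>J. m l s) a b c" "has_jet2 (m l) a' b' c'"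
      using m by blast
    from has_jet2_mult[OF this(2,1)] insert show ?case by auto
  qed
  obtain a b e where 1: "has_jet2 (\<lambda>s. \<Prod>l\<in>I - {i, j}. m l s) a b e"
    using rest[of "I - {i, j}"] assms(1) by auto
  have "has_jet2 (\<lambda>s. (m i s * m j s) * (\<Prod>l\<in>I - {i, j}. m l s)) 0 0 0"
    using has_jet2_mult[OF has_jet2_mult[OF vanish] 1] by simp
  moreover have "(\<Prod>l\<in>I. m l s) = (m i s * m j s) * (\<Prod>l\<in>I - {i, j}. m l s)" for s
  proof -
    have "(\<Prod>l\<in>I. m l s) = m i s * (\<Prod>l\<in>I - {i}. m l s)"
      using assms by (intro prod.remove) auto
    also have "(\<Prod>l\<in>I - {i}. m l s) = m j s * (\<Prod>l\<in>I - {i} - {j}. m l s)"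
      using assms by (intro prod.remove) auto
    also have "I - {i} - {j} = I - {i, j}" by auto
    finally show ?thesis by (simp add: mult.assoc)
  qed
  ultimately show ?thesis by simp
qed

lemma has_jet2_sum_zero:
  fixes m :: "'i \<Rightarrow> real \<Rightarrow> real"
  assumes "\<And>i. i \<in> I \<Longrightarrow> has_jet2 (m i) 0 0 0"
  shows "has_jet2 (\<lambda>s. \<Sum>i\<in>I. m i s) 0 0 0"
  using assms
proof (induction I rule: infinite_finite_induct)
  case (insert i I)
  then show ?case using has_jet2_add[of "m i" 0 0 0 "\<lambda>s. \<Sum>i\<in>I. m i s" 0 0 0] by simp
qed (auto intro: has_jet2_const)

text \<open>A permutation other than the identity moves at least two indices, so its term in the Leibniz
  expansion has two factors that vanish to first order.\<close>

lemma has_jet2_det_scalar: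
  fixes M :: "real \<Rightarrow> real ^ 'n ^ 'n::finite"
  assumes a: "a \<noteq> 0"
    and M: "\<And>i j. has_jet2 (\<lambda>s. M s $ i $ j) (if i = j then a else 0) (if i = j then b else 0) (C i j)"
  shows "has_jet2 (\<lambda>s. det (M s)) (a ^ CARD('n)) (a ^ CARD('n) * (CARD('n) * (b / a)))
    (a ^ CARD('n) * ((\<Sum>i\<in>UNIV. C i i / a) + (real CARD('n) * real CARD('n) - CARD('n)) * (b / a)\<^sup>2))"
proof -
  let ?P = "{p. p permutes (UNIV :: 'n set)}"
  have id: "id \<in> ?P" by (simp add: permutes_id)
  have "has_jet2 (\<lambda>s. \<Sum>p\<in>?P - {id}. of_int (sign p) * (\<Prod>i\<in>UNIV. M s $ i $ p i)) 0 0 0"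
  proof (rule has_jet2_sum_zero)
    fix p assume p: "p \<in> ?P - {id}"
    then obtain i where i: "p i \<noteq> i" by (auto simp: fun_eq_iff)
    then have pi: "p (p i) \<noteq> p i" using p by (auto dest: permutes_inj injD)
    have ex: "\<exists>a b c. has_jet2 (\<lambda>s. M s $ l $ p l) a b c" for l using M by blast
    have "has_jet2 (\<lambda>s. \<Prod>i\<in>UNIV. M s $ i $ p i) 0 0 0"
      by (rule has_jet2_prod_vanishing[of UNIV i "p i" _ "C i (p i)" "C (p i) (p (p i))", OF _ _ _ _ _ _ ex])
        (use i pi M[of i "p i"] M[of "p i" "p (p i)"] in auto)
    from has_jet2_mult[OF has_jet2_const this]
    show "has_jet2 (\<lambda>s. of_int (sign p) * (\<Prod>i\<in>UNIV. M s $ i $ p i)) 0 0 0" by simp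
  qed
  moreover have "has_jet2 (\<lambda>s. \<Prod>i\<in>(UNIV :: 'n set). M s $ i $ i) (a ^ CARD('n)) (a ^ CARD('n) * (CARD('n) * (b / a)))
    (a ^ CARD('n) * ((\<Sum>i\<in>UNIV. C i i / a) + (real CARD('n) * real CARD('n) - CARD('n)) * (b / a)\<^sup>2))"
    using M[of i i for i] by (intro has_jet2_prod_equal a) auto
  moreover have "det (M s) = (\<Prod>i\<in>UNIV. M s $ i $ i) + (\<Sum>p\<in>?P - {id}. of_int (sign p) * (\<Prod>i\<in>UNIV. M s $ i $ p i))" for s
    unfolding det_def using id by (subst sum.remove[of _ id]) (auto simp: sign_id)
  ultimately show ?thesis using has_jet2_add by fastforce
qed

section \<open>Differentials of maps of the sphere\<close>

text \<open>The derivative within the sphere is determined in tangential directions, since the curve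
  \<open>r (p + t v) / |p + t v|\<close> stays on the sphere and has velocity \<open>v\<close> at \<open>t = 0\<close>.\<close>

lemma differential_eq:
  fixes g Y :: "'n::finite space \<Rightarrow> 'n space"
  assumes r: "0 < r" and p: "p \<in> sphere 0 r" and g: "(g has_derivative g') (at p)"
    and eq: "\<And>q. q \<in> sphere 0 r \<Longrightarrow> Y q = g q" and v: "v \<in> tangent_space p"
  shows "differential r Y p v = g' v"
proof -
  define \<gamma> where "\<gamma> t = r *\<^sub>R sgn (p + t *\<^sub>R v)" for t :: real
  have np: "norm p = r" and vp: "v \<bullet> p = 0" using p v by (auto simp: tangent_space_def)
  have nz: "p + t *\<^sub>R v \<noteq> 0" for t
  proof
    assume "p + t *\<^sub>R v = 0"
    then have "(p + t *\<^sub>R v) \<bullet> p = 0" by simp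
    then show False using np r vp by (simp add: inner_add_left dot_square_norm)
  qed
  have \<gamma>0: "\<gamma> 0 = p" using np r by (simp add: \<gamma>_def sgn_div_norm)
  have \<gamma>S: "\<gamma> t \<in> sphere 0 r" for t
    using nz[of t] r by (simp add: \<gamma>_def norm_sgn)
  have "((\<lambda>t. p + t *\<^sub>R v) has_derivative (\<lambda>t. t *\<^sub>R v)) (at 0)"
    by (auto intro!: derivative_eq_intros)
  moreover have "(sgn has_derivative (\<lambda>w. inverse (norm p) *\<^sub>R (w - (sgn p \<bullet> w) *\<^sub>R sgn p))) (at (p + 0 *\<^sub>R v))"
    using has_derivative_sgn[of p] nz[of 0] by simp
  ultimately have "((\<lambda>t. sgn (p + t *\<^sub>R v)) has_derivative
      (\<lambda>t. inverse (norm p) *\<^sub>R (t *\<^sub>R v - (sgn p \<bullet> (t *\<^sub>R v)) *\<^sub>R sgn p))) (at 0)"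
    by (rule has_derivative_compose)
  moreover have "sgn p \<bullet> v = 0" using vp by (simp add: sgn_div_norm inner_commute)
  ultimately have "(\<gamma> has_derivative (\<lambda>t. t *\<^sub>R v)) (at 0)"
    unfolding \<gamma>_def using np r by (auto intro!: derivative_eq_intros)
  then have d\<gamma>: "(\<gamma> has_derivative (\<lambda>t. t *\<^sub>R v)) (at 0 within UNIV)" .
  have Yg: "(Y has_derivative g') (at p within sphere 0 r)"
    by (rule has_derivative_transform[OF p _ has_derivative_at_withinI[OF g]]) (use eq in auto)
  then have YD: "(Y has_derivative differential r Y p) (at p within sphere 0 r)"
    unfolding differential_def using frechet_derivative_works differentiableI by blast
  have comp: "((\<lambda>t. Y (\<gamma> t)) has_derivative (\<lambda>t. D (t *\<^sub>R v))) (at 0)"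
    if "(Y has_derivative D) (at p within sphere 0 r)" for D
  proof (rule has_derivative_in_compose[OF d\<gamma>])
    show "(Y has_derivative D) (at (\<gamma> 0) within range \<gamma>)"
      unfolding \<gamma>0 by (rule has_derivative_subset[OF that]) (use \<gamma>S in auto)
  qed
  have "(\<lambda>t. differential r Y p (t *\<^sub>R v)) = (\<lambda>t. g' (t *\<^sub>R v))"
    by (rule has_derivative_unique[OF comp[OF YD] comp[OF Yg]])
  from fun_cong[OF this, of 1] show ?thesis by simp
qed

lemma C_on_slice:
  fixes u :: "real \<times> 'a::euclidean_space \<Rightarrow> 'b::euclidean_space"
  assumes "C_on k (I \<times> U) u" "open I" "open U" "s \<in> I"
  shows "C_on k U (\<lambda>x. u (s, x))"
  by (rule C_on_compose[of U "I \<times> U"])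
    (use assms in \<open>auto intro!: open_Times C_on_Pair C_on_const C_on_ident\<close>)

lemma dir_deriv_slice:
  fixes u :: "real \<times> 'a::euclidean_space \<Rightarrow> 'b::real_normed_vector"
  assumes "C_on (Suc k) U u" "(s, x) \<in> U"
  shows "dir_deriv v (\<lambda>x. u (s, x)) x = dir_deriv (0, v) u (s, x)"
proof -
  have "((\<lambda>x. (s, x)) has_derivative (\<lambda>v. (0, v))) (at x)"
    by (auto intro!: derivative_eq_intros)
  from has_derivative_compose[OF this C_on_imp_differentiable[OF assms]]
  have "((\<lambda>x. u (s, x)) has_derivative (\<lambda>v. dir_deriv (0, v) u (s, x))) (at x)" .
  from frechet_derivative_at[OF this, symmetric] show ?thesis by simp
qed

section \<open>The second variation of the weighted area of a sphere\<close>

locale sphere_variation =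
  fixes r \<epsilon> :: real and X N :: "real \<Rightarrow> 'n::finite space \<Rightarrow> 'n space" and f :: "real \<Rightarrow> 'n space \<Rightarrow> real"
  assumes r: "0 < r" and var: "normal_variation r (\<lambda>p. p) \<epsilon> X N f"
begin

subsection \<open>The variation as a homogeneous map\<close>

text \<open>A map of the space-time cylinder, constant on rays in the space variable, so that the time
  derivatives of the variation can be taken at any point and commute with those in space.\<close>

definition ext :: "real \<times> 'n space \<Rightarrow> 'n space" where
  "ext z = X (fst z) (r *\<^sub>R sgn (snd z))"

abbreviation cyl :: "(real \<times> 'n space) set" where
  "cyl \<equiv> {-\<epsilon><..<\<epsilon>} \<times> (- {0})"

lemma eps: "0 < \<epsilon>" and smooth_X: "smooth_on ({-\<epsilon><..<\<epsilon>} \<times> sphere 0 r) (\<lambda>(s, p). X s p)"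
  and X_0: "p \<in> sphere 0 r \<Longrightarrow> X 0 p = p"
  and deriv_X: "s \<in> {-\<epsilon><..<\<epsilon>} \<Longrightarrow> p \<in> sphere 0 r \<Longrightarrow>
    ((\<lambda>s. X s p) has_vector_derivative f s p *\<^sub>R N s p) (at s)"
  and normal_N: "s \<in> {-\<epsilon><..<\<epsilon>} \<Longrightarrow> unit_normal r (X s) (N s)"
  using var unfolding normal_variation_def by blast+

lemma open_cyl: "open cyl"
  by (intro open_Times) (auto simp: open_Compl)

lemma scaled_sgn_in_sphere: "x \<noteq> 0 \<Longrightarrow> r *\<^sub>R sgn x \<in> sphere 0 r" for x :: "'n space"
  using r by (simp add: norm_sgn)

lemma C_on_ext: "C_on k cyl ext"
proof (rule C_on_locally)
  fix z assume z: "z \<in> cyl"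
  define \<psi> where "\<psi> z = (fst z, r *\<^sub>R sgn (snd z))" for z :: "real \<times> 'n space"
  have \<psi>: "C_on k cyl \<psi>" for k
    unfolding \<psi>_def using open_cyl
    by (intro C_on_intros C_on_sgn) auto
  have mem: "\<psi> y \<in> {-\<epsilon><..<\<epsilon>} \<times> sphere 0 r" if "y \<in> cyl" for y
    using that scaled_sgn_in_sphere[of "snd y"] by (simp add: \<psi>_def mem_Times_iff)
  from bspec[OF smooth_X[unfolded smooth_on_def] mem[OF z]]
  obtain U g where U: "open U" "\<psi> z \<in> U" "\<forall>k. C_on k U g"
    "\<forall>y\<in>U \<inter> ({-\<epsilon><..<\<epsilon>} \<times> sphere 0 r). g y = (\<lambda>(s, p). X s p) y"
    by (elim exE conjE)
  define V where "V = cyl \<inter> \<psi> -` U"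
  have oV: "open V"
    unfolding V_def by (rule continuous_open_preimage[OF C_on_imp_continuous_on[OF \<psi>[of 0]] open_cyl U(1)])
  have "C_on k V (\<lambda>y. g (\<psi> y))"
    by (rule C_on_compose[OF oV U(1) C_on_subset[OF \<psi>] spec[OF U(3)]]) (auto simp: V_def)
  moreover have "g (\<psi> y) = ext y" if "y \<in> V" for y
    using bspec[OF U(4), of "\<psi> y"] mem[of y] that unfolding V_def
    by (simp add: \<psi>_def ext_def)
  ultimately have "C_on k V ext" using C_on_cong[OF oV, of "\<lambda>y. g (\<psi> y)" ext] by simp
  then show "\<exists>V. open V \<and> z \<in> V \<and> C_on k V ext"
    using oV z U(2) unfolding V_def by blast
qed

definition velocity :: "real \<times> 'n space \<Rightarrow> 'n space" where
  "velocity = dir_deriv (1, 0) ext"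

definition acceleration :: "real \<times> 'n space \<Rightarrow> 'n space" where
  "acceleration = dir_deriv (1, 0) velocity"

lemma C_on_velocity: "C_on k cyl velocity"
  unfolding velocity_def by (rule C_on_dir_deriv[OF C_on_ext])

lemma C_on_acceleration: "C_on k cyl acceleration"
  unfolding acceleration_def by (rule C_on_dir_deriv[OF C_on_velocity])

lemma radial_invariance_dir_deriv:
  assumes "C_on (Suc 0) cyl u" "\<And>s x. s \<in> {-\<epsilon><..<\<epsilon>} \<Longrightarrow> x \<noteq> 0 \<Longrightarrow> u (s, sgn x) = (u (s, x) :: 'b::real_normed_vector)"
    and s: "s \<in> {-\<epsilon><..<\<epsilon>}" and x: "x \<noteq> 0"
  shows "dir_deriv (1, 0) u (s, sgn x) = dir_deriv (1, 0) u (s, x)"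
proof -
  have "((\<lambda>s. u (s, sgn x)) has_vector_derivative dir_deriv (1, 0) u (s, sgn x)) (at s)"
    by (rule has_vector_derivative_slice[OF assms(1)]) (use s x in \<open>simp add: sgn_zero_iff\<close>)
  then have "((\<lambda>s. u (s, x)) has_vector_derivative dir_deriv (1, 0) u (s, sgn x)) (at s)"
    by (rule has_vector_derivative_transform_within_open[where S = "{-\<epsilon><..<\<epsilon>}"])
      (use s assms(2)[OF _ x] in auto)
  moreover have "((\<lambda>s. u (s, x)) has_vector_derivative dir_deriv (1, 0) u (s, x)) (at s)"
    by (rule has_vector_derivative_slice[OF assms(1)]) (use s x in simp)
  ultimately show ?thesis by (rule vector_derivative_unique_at)
qed

lemma sgn_sgn: "sgn (sgn x) = sgn x" for x :: "'n space"
  by (cases "x = 0") (simp_all add: sgn_div_norm)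

lemma ext_radial: "ext (s, sgn x) = ext (s, x)"
  by (simp add: ext_def sgn_sgn)

lemma velocity_radial: "s \<in> {-\<epsilon><..<\<epsilon>} \<Longrightarrow> x \<noteq> 0 \<Longrightarrow> velocity (s, sgn x) = velocity (s, x)"
  unfolding velocity_def by (rule radial_invariance_dir_deriv[OF C_on_ext ext_radial])

lemma acceleration_radial: "s \<in> {-\<epsilon><..<\<epsilon>} \<Longrightarrow> x \<noteq> 0 \<Longrightarrow> acceleration (s, sgn x) = acceleration (s, x)"
  unfolding acceleration_def by (rule radial_invariance_dir_deriv[OF C_on_velocity velocity_radial])

lemma ext_0: "x \<noteq> 0 \<Longrightarrow> ext (0, x) = r *\<^sub>R sgn x"
  using X_0[OF scaled_sgn_in_sphere] by (simp add: ext_def)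

lemma zero_mem: "0 \<in> {-\<epsilon><..<\<epsilon>}"
  using eps by simp

lemma dir_deriv_ext_0:
  assumes "x \<noteq> 0"
  shows "dir_deriv (0, v) ext (0, x) = r *\<^sub>R (inverse (norm x) *\<^sub>R (v - (sgn x \<bullet> v) *\<^sub>R sgn x))"
proof -
  have "dir_deriv (0, v) ext (0, x) = dir_deriv v (\<lambda>x. ext (0, x)) x"
    by (rule dir_deriv_slice[OF C_on_ext, symmetric]) (use assms zero_mem in simp)
  also have "\<dots> = dir_deriv v (\<lambda>x. r *\<^sub>R sgn x) x"
    by (subst frechet_derivative_cong_open[of "- {0}" x _ "\<lambda>x. r *\<^sub>R sgn x"])
      (use assms ext_0 in \<open>auto simp: open_Compl\<close>)
  also have "\<dots> = r *\<^sub>R (inverse (norm x) *\<^sub>R (v - (sgn x \<bullet> v) *\<^sub>R sgn x))"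
    using frechet_derivative_at[OF has_derivative_scaleR_right[OF has_derivative_sgn[OF assms]], of r, symmetric]
    by simp
  finally show ?thesis .
qed

lemma velocity_eq:
  assumes "s \<in> {-\<epsilon><..<\<epsilon>}" "x \<noteq> 0"
  shows "velocity (s, x) = f s (r *\<^sub>R sgn x) *\<^sub>R N s (r *\<^sub>R sgn x)"
proof (rule vector_derivative_unique_at)
  show "((\<lambda>s. ext (s, x)) has_vector_derivative velocity (s, x)) (at s)"
    unfolding velocity_def by (rule has_vector_derivative_slice[OF C_on_ext]) (use assms in simp)
  show "((\<lambda>s. ext (s, x)) has_vector_derivative f s (r *\<^sub>R sgn x) *\<^sub>R N s (r *\<^sub>R sgn x)) (at s)"
    unfolding ext_def using deriv_X[OF assms(1) scaled_sgn_in_sphere[OF assms(2)]] by simp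
qed

text \<open>The derivative of \<^const>\<open>ext\<close> in the direction \<open>v\<close> depends only on the tangential part of \<open>v\<close>, on
  which it is a multiple of the differential of \<open>X s\<close>.\<close>

lemma velocity_orthogonal:
  assumes s: "s \<in> {-\<epsilon><..<\<epsilon>}" and x: "x \<noteq> 0"
  shows "velocity (s, x) \<bullet> dir_deriv (0, v) ext (s, x) = 0"
proof -
  define W where "W x = ext (s, x)" for x
  define p where "p = r *\<^sub>R sgn x"
  have W: "C_on k (- {0}) W" for k
    unfolding W_def by (rule C_on_slice[OF C_on_ext]) (use s in \<open>auto simp: open_Compl\<close>)
  have hom: "homogeneous0 W" unfolding homogeneous0_def W_def using ext_radial by blast
  have pS: "p \<in> sphere 0 r" using scaled_sgn_in_sphere[OF x] by (simp add: p_def)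
  then have p0: "p \<noteq> 0" using r by auto
  have "norm p = r" "sgn p = sgn x" using pS r by (auto simp: p_def sgn_scaleR sgn_sgn)
  then have scale: "dir_deriv v W x = (inverse (norm x) * r) *\<^sub>R dir_deriv v W p" for v
    using dir_deriv_homogeneous0[OF W hom x, of v] dir_deriv_homogeneous0[OF W hom p0, of v] r
    by simp
  have lin: "linear (\<lambda>v. dir_deriv v W p)"
    using C_on_imp_differentiable[OF W, of p] p0 has_derivative_linear by auto
  define v' where "v' = v - ((v \<bullet> p) / r\<^sup>2) *\<^sub>R p"
  have "p \<bullet> p = r\<^sup>2" using pS by (simp add: dot_square_norm)
  then have tan: "v' \<in> tangent_space p"
    using r by (simp add: tangent_space_def v'_def inner_diff_left)
  have "dir_deriv v' W p = dir_deriv v W p"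
    unfolding v'_def using linear_diff[OF lin] linear_scale[OF lin] dir_deriv_radial[OF W hom p0] by simp
  moreover have "differential r (X s) p v' = dir_deriv v' W p"
  proof (rule differential_eq[OF r pS _ _ tan])
    show "(W has_derivative (\<lambda>v. dir_deriv v W p)) (at p)"
      using C_on_imp_differentiable[OF W, of p] p0 by simp
    show "X s q = W q" if "q \<in> sphere 0 r" for q
      using that r by (auto simp: W_def ext_def sgn_div_norm)
  qed
  ultimately have "N s p \<bullet> dir_deriv v W p = 0"
    using normal_N[OF s] pS tan unfolding unit_normal_def by metis
  moreover have "dir_deriv (0, v) ext (s, x) = dir_deriv v W x"
    unfolding W_def by (rule dir_deriv_slice[OF C_on_ext, symmetric]) (use s x in simp)
  ultimately show ?thesis
    unfolding velocity_eq[OF s x] scale p_def by simp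
qed

text \<open>The speed with respect to the outward normal, extended to be constant on rays. It agrees with
  \<open>f 0\<close> up to the orientation of \<open>N\<close>.\<close>

definition speed :: "'n space \<Rightarrow> real" where
  "speed x = velocity (0, x) \<bullet> sgn x"

lemma velocity_0: "x \<noteq> 0 \<Longrightarrow> velocity (0, x) = speed x *\<^sub>R sgn x"
proof -
  assume x: "x \<noteq> 0"
  define V u where "V = velocity (0, x)" and "u = V - (V \<bullet> sgn x) *\<^sub>R sgn x"
  have ss: "sgn x \<bullet> sgn x = 1" using x by (simp add: dot_square_norm norm_sgn)
  then have us: "sgn x \<bullet> u = 0" by (simp add: u_def inner_diff_right inner_commute)
  have "V \<bullet> (r *\<^sub>R (inverse (norm x) *\<^sub>R (u - (sgn x \<bullet> u) *\<^sub>R sgn x))) = 0"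
    using velocity_orthogonal[OF zero_mem x, of u] dir_deriv_ext_0[OF x, of u] by (simp add: V_def)
  then have "V \<bullet> u = 0" using us r x by simp
  then have "u \<bullet> u = 0" using us by (simp add: u_def inner_diff_left inner_commute)
  then show ?thesis by (simp add: u_def V_def speed_def)
qed

lemma C_on_at_0:
  "C_on k (- {0}) (\<lambda>x. velocity (0, x))" "C_on k (- {0}) (\<lambda>x. acceleration (0, x))"
  by (rule C_on_slice[OF C_on_velocity] C_on_slice[OF C_on_acceleration];
      use zero_mem in \<open>auto simp: open_Compl\<close>)+

lemma C_on_speed: "C_on k (- {0}) speed"
  unfolding speed_def by (intro C_on_inner C_on_at_0 C_on_sgn_punctured) (auto simp: open_Compl)

lemma homogeneous0_speed: "homogeneous0 speed"
  unfolding homogeneous0_def speed_def using velocity_radial[OF zero_mem] by (simp add: sgn_sgn)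

lemma homogeneous0_acceleration: "homogeneous0 (\<lambda>x. acceleration (0, x))"
  unfolding homogeneous0_def using acceleration_radial[OF zero_mem] by blast

subsection \<open>The area density relative to the round sphere\<close>

text \<open>The image of a frame vector under the differential. Expanded in the standard basis, it is visibly a
  smooth function of the point, although the direction of differentiation varies with the point.\<close>

definition tangent_image :: "real \<Rightarrow> real \<times> 'n space \<Rightarrow> 'n \<Rightarrow> 'n space" where
  "tangent_image \<sigma> z i = (\<Sum>b\<in>Basis. (frame \<sigma> (snd z) i \<bullet> b) *\<^sub>R dir_deriv (0, b) ext z)"

definition gram :: "real \<Rightarrow> real \<times> 'n space \<Rightarrow> real ^ 'n ^ 'n" where
  "gram \<sigma> z = (\<chi> i j. tangent_image \<sigma> z i \<bullet> tangent_image \<sigma> z j)"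

definition weighted_density :: "real \<Rightarrow> real \<times> 'n space \<Rightarrow> real" where
  "weighted_density \<sigma> z = exp (- (ext z \<bullet> ext z) / 2) * sqrt (det (gram \<sigma> z))"

definition chart_domain :: "real \<Rightarrow> (real \<times> 'n space) set" where
  "chart_domain \<sigma> = cyl \<inter> {z. 0 < 1 + \<sigma> * snd (snd z)}"

text \<open>The frame is smooth on \<open>chart_domain\<close>, and the square root of the Gram determinant is smooth where
  the determinant is positive.\<close>

definition regular_domain :: "real \<Rightarrow> (real \<times> 'n space) set" where
  "regular_domain \<sigma> = chart_domain \<sigma> \<inter> {z. 0 < det (gram \<sigma> z)}"

lemma open_chart_domain: "open (chart_domain \<sigma>)"
  unfolding chart_domain_def by (intro open_Int open_cyl open_Collect_less continuous_intros)

lemma linear_dir_deriv_ext: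
  assumes "z \<in> cyl"
  shows "linear (\<lambda>v. dir_deriv v ext z)"
  by (rule has_derivative_linear[OF C_on_imp_differentiable[OF C_on_ext assms]])

lemma dir_deriv_ext_expand:
  assumes "z \<in> cyl"
  shows "(\<Sum>b\<in>Basis. (v \<bullet> b) *\<^sub>R dir_deriv (0, b) ext z) = dir_deriv (0, v) ext z"
proof -
  note lin = linear_dir_deriv_ext[OF assms]
  have "(0, v) = (\<Sum>b\<in>Basis. (v \<bullet> b) *\<^sub>R (0 :: real, b))"
    by (simp add: sum_prod euclidean_representation)
  then have "dir_deriv (0, v) ext z = (\<Sum>b\<in>Basis. dir_deriv ((v \<bullet> b) *\<^sub>R (0, b)) ext z)"
    using linear_sum[OF lin, of "\<lambda>b. (v \<bullet> b) *\<^sub>R (0 :: real, b)" Basis] by (simp del: scaleR_Pair)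
  then show ?thesis by (simp add: linear_scale[OF lin] del: scaleR_Pair)
qed

lemma C_on_det_gram: "C_on k (chart_domain \<sigma>) (\<lambda>z. det (gram \<sigma> z))"
proof -
  note o = open_chart_domain[of \<sigma>]
  have sub: "chart_domain \<sigma> \<subseteq> cyl" by (auto simp: chart_domain_def)
  have "C_on k (chart_domain \<sigma>) (\<lambda>z. frame \<sigma> (snd z) i)" for i
    unfolding frame_def reflect_def divide_inverse using o
    by (intro C_on_intros) (auto simp: chart_domain_def)
  then have "C_on k (chart_domain \<sigma>) (\<lambda>z. tangent_image \<sigma> z i)" for i
    unfolding tangent_image_def using o
    by (intro C_on_sum C_on_scaleR C_on_inner C_on_const C_on_subset[OF C_on_dir_deriv[OF C_on_ext] sub])
  then show ?thesis
    using o by (intro C_on_det) (auto simp: gram_def intro: C_on_inner)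
qed

lemma open_regular_domain: "open (regular_domain \<sigma>)"
proof -
  have "regular_domain \<sigma> = chart_domain \<sigma> \<inter> (\<lambda>z. det (gram \<sigma> z)) -` {0<..}"
    by (auto simp: regular_domain_def)
  then show ?thesis
    using continuous_open_preimage[OF C_on_imp_continuous_on[OF C_on_det_gram[of 0 \<sigma>]] open_chart_domain, of "{0<..}"]
    by simp
qed

lemma regular_domain_subset: "regular_domain \<sigma> \<subseteq> chart_domain \<sigma>" "regular_domain \<sigma> \<subseteq> cyl"
  by (auto simp: regular_domain_def chart_domain_def)

lemma C_on_weighted_density: "C_on k (regular_domain \<sigma>) (weighted_density \<sigma>)"
  unfolding weighted_density_def divide_inverse using open_regular_domain
  by (intro C_on_intros C_on_subset[OF C_on_ext regular_domain_subset(2)]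
      C_on_subset[OF C_on_det_gram regular_domain_subset(1)]) (auto simp: regular_domain_def)

lemma hemisphere_in_chart_domain:
  assumes "s \<in> {-\<epsilon><..<\<epsilon>}" "\<omega> \<in> closed_hemisphere \<sigma>"
  shows "(s, \<omega>) \<in> chart_domain \<sigma>" "norm \<omega> = 1" "0 < 1 + \<sigma> * snd \<omega>" "\<omega> \<noteq> 0" "(s, \<omega>) \<in> cyl"
  using assms by (auto simp: chart_domain_def closed_hemisphere_def)

lemma tangent_image_eq: "z \<in> cyl \<Longrightarrow> tangent_image \<sigma> z i = dir_deriv (0, frame \<sigma> (snd z) i) ext z"
  unfolding tangent_image_def by (rule dir_deriv_ext_expand)

lemma tangent_image_0:
  assumes \<sigma>: "\<sigma> = 1 \<or> \<sigma> = -1" and \<omega>: "\<omega> \<in> closed_hemisphere \<sigma>"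
  shows "tangent_image \<sigma> (0, \<omega>) i = r *\<^sub>R frame \<sigma> \<omega> i"
proof -
  note h = hemisphere_in_chart_domain[OF zero_mem \<omega>]
  have "sgn \<omega> = \<omega>" using h(2) by (simp add: sgn_div_norm)
  then show ?thesis
    using tangent_image_eq[OF h(5)] dir_deriv_ext_0[OF h(4)] frame_tangent[OF \<sigma> h(2,3)] h(2)
    by (simp add: inner_commute)
qed

lemma det_gram_0:
  assumes \<sigma>: "\<sigma> = 1 \<or> \<sigma> = -1" and \<omega>: "\<omega> \<in> closed_hemisphere \<sigma>"
  shows "det (gram \<sigma> (0, \<omega>)) = (r ^ CARD('n))\<^sup>2"
proof -
  note h = hemisphere_in_chart_domain[OF zero_mem \<omega>]
  have "gram \<sigma> (0, \<omega>) = (\<chi> i j. if i = j then r\<^sup>2 else 0)"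
    by (simp add: gram_def vec_eq_iff tangent_image_0[OF assms] frame_orthonormal[OF \<sigma> h(2,3)] power2_eq_square)
  moreover have "det (\<chi> i j. if i = j then r\<^sup>2 else 0 :: real ^ 'n ^ 'n) = (\<Prod>i\<in>(UNIV :: 'n set). r\<^sup>2)"
    by (subst det_diagonal) auto
  ultimately show ?thesis by (simp add: power_mult[symmetric] mult.commute)
qed

lemma regular_tube:
  assumes \<sigma>: "\<sigma> = 1 \<or> \<sigma> = -1"
  obtains \<delta> where "0 < \<delta>" "{-\<delta>..\<delta>} \<times> closed_hemisphere \<sigma> \<subseteq> regular_domain \<sigma>"
proof -
  let ?K = "{0 :: real} \<times> (closed_hemisphere \<sigma> :: 'n space set)"
  have "compact ?K" by (intro compact_Times compact_closed_hemisphere) simp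
  moreover have "?K \<subseteq> regular_domain \<sigma>"
    using hemisphere_in_chart_domain(1)[OF zero_mem] det_gram_0[OF \<sigma>] r
    by (auto simp: regular_domain_def)
  ultimately obtain e where e: "0 < e" "(\<Union>x\<in>?K. ball x e) \<subseteq> regular_domain \<sigma>"
    using compact_subset_open_imp_ball_epsilon_subset[OF _ open_regular_domain] by metis
  have "{- (e / 2)..e / 2} \<times> closed_hemisphere \<sigma> \<subseteq> (\<Union>x\<in>?K. ball x e)"
  proof
    fix z assume z: "z \<in> {- (e / 2)..e / 2} \<times> (closed_hemisphere \<sigma> :: 'n space set)"
    have "dist (0, snd z) z = \<bar>fst z\<bar>" by (simp add: dist_prod_def dist_real_def)
    also have "\<dots> < e" using z e(1) by (auto simp: mem_Times_iff)
    finally show "z \<in> (\<Union>x\<in>?K. ball x e)" using z by (auto simp: mem_Times_iff)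
  qed
  with e show ?thesis by (intro that[of "e / 2"]) auto
qed

subsection \<open>The area integral\<close>

text \<open>The metric in the chart is the Gram matrix in the orthonormal frame, transformed by the matrix that
  expresses the horizontal coordinate vectors in the frame. That matrix is a rank-one perturbation
  of the identity with determinant \<open>|snd \<omega>|\<close>. Together with the scaling of derivatives along rays,
  the change of frame produces the gnomonic density.\<close>

lemma sqrt_det_induced_metric:
  assumes s: "s \<in> {-\<epsilon><..<\<epsilon>}" and \<sigma>: "\<sigma> = 1 \<or> \<sigma> = -1"
  shows "sqrt (det (induced_metric (X s) (hemisphere_chart r \<sigma>) w)) =
    sqrt (det (gram \<sigma> (s, unit_chart \<sigma> w))) * gnomonic_density w"
proof -
  define \<omega> where "\<omega> = unit_chart \<sigma> w"
  define m where "m = sqrt (1 + (norm w)\<^sup>2)"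
  define W where "W x = ext (s, x)" for x
  have m: "0 < m" by (simp add: m_def)
  have abs\<sigma>: "\<bar>\<sigma>\<bar> = 1" using \<sigma> by auto
  note h = hemisphere_in_chart_domain[OF s unit_chart_in_hemisphere[OF abs\<sigma>, of w], folded \<omega>_def]
  have W: "C_on k (- {0}) W" for k
    unfolding W_def by (rule C_on_slice[OF C_on_ext]) (use s in \<open>auto simp: open_Compl\<close>)
  have hom: "homogeneous0 W" unfolding homogeneous0_def W_def using ext_radial by blast
  have ray: "\<sigma> *\<^sub>R (u, 1) = sqrt (1 + (norm u)\<^sup>2) *\<^sub>R unit_chart \<sigma> u" for u :: "real ^ 'n"
    using less_imp_neq[OF gnomonic_denominator_pos[of u], symmetric] by (simp add: hemisphere_chart_def)
  have nz: "\<sigma> *\<^sub>R (u, 1 :: real) \<noteq> 0" for u :: "real ^ 'n"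
    using \<sigma> by (auto simp: zero_prod_def)
  \<comment> \<open>As \<open>W\<close> is constant on rays, the chart may be replaced by an affine map.\<close>
  have comp: "X s \<circ> hemisphere_chart r \<sigma> = (\<lambda>u. W (\<sigma> *\<^sub>R (u, 1)))"
  proof
    fix u :: "real ^ 'n"
    have "sgn (\<sigma> *\<^sub>R (u, 1 :: real)) = unit_chart \<sigma> u"
      unfolding ray using gnomonic_denominator_pos[of u] norm_unit_chart[OF abs\<sigma>, of u]
      by (simp add: sgn_scaleR) (simp add: sgn_div_norm)
    then show "(X s \<circ> hemisphere_chart r \<sigma>) u = W (\<sigma> *\<^sub>R (u, 1))"
      by (simp add: W_def ext_def chart_eq_scaleR_unit_chart[of r])
  qed
  have norm_y: "norm (\<sigma> *\<^sub>R (w, 1 :: real)) = m" and sgn_y: "sgn (\<sigma> *\<^sub>R (w, 1 :: real)) = \<omega>"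
  proof -
    show "norm (\<sigma> *\<^sub>R (w, 1 :: real)) = m"
      unfolding ray using norm_unit_chart[OF abs\<sigma>, of w] m by (simp add: m_def)
    show "sgn (\<sigma> *\<^sub>R (w, 1 :: real)) = \<omega>"
      unfolding ray using m h(2) by (simp add: sgn_scaleR m_def[symmetric] \<omega>_def[symmetric]) (simp add: sgn_div_norm)
  qed
  define e where "e i = dir_deriv (horizontal i) W \<omega>" for i
  have linW: "linear (\<lambda>v. dir_deriv v W \<omega>)"
    using C_on_imp_differentiable[OF W, of \<omega>] h(4) has_derivative_linear by auto
  have "frechet_derivative (X s \<circ> hemisphere_chart r \<sigma>) (at w) (axis i 1) = (\<sigma> / m) *\<^sub>R e i" for i
  proof -
    have "((\<lambda>u. \<sigma> *\<^sub>R (u, 1 :: real)) has_derivative (\<lambda>v. \<sigma> *\<^sub>R (v, 0))) (at w)"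
      by (auto intro!: derivative_eq_intros)
    from has_derivative_compose[OF this C_on_imp_differentiable[OF W]] nz
    have "((\<lambda>u. W (\<sigma> *\<^sub>R (u, 1))) has_derivative (\<lambda>v. dir_deriv (\<sigma> *\<^sub>R (v, 0)) W (\<sigma> *\<^sub>R (w, 1)))) (at w)"
      by blast
    from frechet_derivative_at[OF this, symmetric]
    have "frechet_derivative (X s \<circ> hemisphere_chart r \<sigma>) (at w) (axis i 1)
        = dir_deriv (\<sigma> *\<^sub>R horizontal i) W (\<sigma> *\<^sub>R (w, 1))"
      unfolding comp by simp
    also have "\<dots> = inverse m *\<^sub>R dir_deriv (\<sigma> *\<^sub>R horizontal i) W \<omega>"
      using dir_deriv_homogeneous0[OF W hom nz[of w], of "\<sigma> *\<^sub>R horizontal i"]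
      unfolding norm_y sgn_y .
    also have "\<dots> = (\<sigma> / m) *\<^sub>R e i"
      unfolding linear_scale[OF linW] e_def by (simp add: divide_inverse mult.commute)
    finally show ?thesis .
  qed
  then have metric: "induced_metric (X s) (hemisphere_chart r \<sigma>) w = (\<chi> i j. inverse (m\<^sup>2) * (e i \<bullet> e j))"
    using \<sigma> by (auto simp: induced_metric_def vec_eq_iff power2_eq_square divide_inverse)
  define P where "P = (\<chi> i j. horizontal i \<bullet> frame \<sigma> \<omega> j)"
  have e: "e i = (\<Sum>j\<in>UNIV. (P $ i $ j) *\<^sub>R tangent_image \<sigma> (s, \<omega>) j)" for i
  proof -
    have "e i = dir_deriv ((\<Sum>j\<in>UNIV. (horizontal i \<bullet> frame \<sigma> \<omega> j) *\<^sub>R frame \<sigma> \<omega> j) + (horizontal i \<bullet> \<omega>) *\<^sub>R \<omega>) W \<omega>"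
      unfolding e_def using frame_expansion[OF \<sigma> h(2,3), of "horizontal i"] by metis
    also have "\<dots> = (\<Sum>j\<in>UNIV. (horizontal i \<bullet> frame \<sigma> \<omega> j) *\<^sub>R dir_deriv (frame \<sigma> \<omega> j) W \<omega>)"
      unfolding linear_add[OF linW] linear_sum[OF linW] linear_scale[OF linW]
      by (simp add: dir_deriv_radial[OF W hom h(4)])
    also have "\<dots> = (\<Sum>j\<in>UNIV. (P $ i $ j) *\<^sub>R tangent_image \<sigma> (s, \<omega>) j)"
      unfolding tangent_image_eq[OF h(5)] W_def P_def
      by (simp add: dir_deriv_slice[OF C_on_ext h(5)])
    finally show ?thesis .
  qed
  have factor: "(\<chi> i j. inverse (m\<^sup>2) * (e i \<bullet> e j)) = inverse (m\<^sup>2) *\<^sub>R (P ** gram \<sigma> (s, \<omega>) ** transpose P)"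
  proof -
    have "e i \<bullet> e j = (P ** gram \<sigma> (s, \<omega>) ** transpose P) $ i $ j" for i j
      unfolding e inner_sum_left inner_sum_right matrix_matrix_mult_def transpose_def gram_def
      by (simp add: sum_distrib_left sum_distrib_right ac_simps)
    then show ?thesis by (simp add: vec_eq_iff)
  qed
  have det: "det (induced_metric (X s) (hemisphere_chart r \<sigma>) w) =
      (inverse (m\<^sup>2)) ^ CARD('n) * ((det P)\<^sup>2 * det (gram \<sigma> (s, \<omega>)))"
  proof -
    have scale: "det (c *\<^sub>R B) = c ^ CARD('n) * det B" for c and B :: "real ^ 'n ^ 'n"
    proof -
      have "c *\<^sub>R B = (\<chi> i. c *s (B $ i))" by (simp add: vec_eq_iff)
      then show ?thesis using det_rows_mul[of "\<lambda>_. c" "\<lambda>i. B $ i"] by simp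
    qed
    show ?thesis
      unfolding metric factor scale by (simp add: det_mul det_transpose power2_eq_square)
  qed
  have "det P = \<sigma> * snd \<omega>"
  proof -
    define c where "c = 1 / (1 + \<sigma> * snd \<omega>)"
    have "P = (\<chi> i j. (if i = j then 1 else 0) - c * (fst \<omega> $ i * fst \<omega> $ j))"
      by (auto simp: P_def frame_def reflect_def vec_eq_iff inner_diff_right inner_prod_def inner_axis
          inner_axis' inner_axis_axis c_def) (simp_all add: axis_def mult.commute)
    then have "det P = 1 - c * (fst \<omega> \<bullet> fst \<omega>)" by (simp only: det_rank_one_perturbation)
    also have "fst \<omega> \<bullet> fst \<omega> = (1 + \<sigma> * snd \<omega>) * (1 - \<sigma> * snd \<omega>)"
    proof -
      have "\<omega> \<bullet> \<omega> = 1" using h(2) by (simp add: dot_square_norm)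
      then have "fst \<omega> \<bullet> fst \<omega> = 1 - snd \<omega> * snd \<omega>" by (simp add: inner_prod_def)
      then show ?thesis using \<sigma> by (auto simp: algebra_simps)
    qed
    finally show ?thesis using h(3) by (simp add: c_def)
  qed
  moreover have "snd \<omega> = \<sigma> / m" by (simp add: \<omega>_def hemisphere_chart_def m_def)
  ultimately have "det P = 1 / m" using \<sigma> by auto
  then have "det (induced_metric (X s) (hemisphere_chart r \<sigma>) w) =
      ((1 / m) ^ (CARD('n) + 1))\<^sup>2 * det (gram \<sigma> (s, \<omega>))"
    unfolding det by (simp add: power_mult_distrib power_divide power_mult[symmetric] power_inverse divide_inverse mult.commute)
  then show ?thesis
    using m by (simp add: real_sqrt_mult gnomonic_density_def m_def[symmetric] \<omega>_def[symmetric] mult.commute)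
qed

lemma area_integral_eq:
  assumes s: "s \<in> {-\<epsilon><..<\<epsilon>}"
    and cont: "\<And>\<sigma>. \<sigma> = 1 \<or> \<sigma> = -1 \<Longrightarrow>
      continuous_on (closed_hemisphere \<sigma>) (\<lambda>\<omega>. h (r *\<^sub>R \<omega>) * sqrt (det (gram \<sigma> (s, \<omega>))))"
  shows "area_integral r (X s) h =
    (\<Sum>\<sigma>\<in>{1, -1}. hemisphere_integral \<sigma> (\<lambda>\<omega>. h (r *\<^sub>R \<omega>) * sqrt (det (gram \<sigma> (s, \<omega>)))))"
  unfolding area_integral_def
proof (rule sum.cong[OF refl])
  fix \<sigma> :: real assume "\<sigma> \<in> {1, -1}"
  then have \<sigma>: "\<sigma> = 1 \<or> \<sigma> = -1" by auto
  let ?k = "\<lambda>\<omega>. h (r *\<^sub>R \<omega>) * sqrt (det (gram \<sigma> (s, \<omega>)))"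
  have "(LINT w|lborel. h (hemisphere_chart r \<sigma> w) * sqrt (det (induced_metric (X s) (hemisphere_chart r \<sigma>) w)))
      = (LINT w|lborel. gnomonic_density w *\<^sub>R ?k (unit_chart \<sigma> w))"
    by (simp add: sqrt_det_induced_metric[OF s \<sigma>] chart_eq_scaleR_unit_chart[of r] ac_simps)
  also have "\<dots> = hemisphere_integral \<sigma> ?k"
    unfolding hemisphere_integral_def gnomonic_measure_def
  proof (rule integral_density[symmetric])
    have "continuous_on UNIV (\<lambda>w. ?k (unit_chart \<sigma> w))"
      by (rule continuous_on_compose2[OF cont[OF \<sigma>] continuous_chart])
        (use unit_chart_in_hemisphere[of \<sigma>] \<sigma> in auto)
    then show "(\<lambda>w. ?k (unit_chart \<sigma> w)) \<in> borel_measurable lborel"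
      by (simp add: borel_measurable_continuous_onI)
  qed (use gnomonic_density_pos less_imp_le in auto)
  finally show "(LINT w|lborel. h (hemisphere_chart r \<sigma> w) *
      sqrt (det (induced_metric (X s) (hemisphere_chart r \<sigma>) w))) = hemisphere_integral \<sigma> ?k" .
qed

lemma ext_unit: "norm \<omega> = 1 \<Longrightarrow> ext (s, \<omega>) = X s (r *\<^sub>R \<omega>)"
  by (simp add: ext_def sgn_div_norm)

lemma continuous_slice:
  assumes "C_on k U u" "\<And>\<omega>. \<omega> \<in> A \<Longrightarrow> (s, \<omega>) \<in> U"
  shows "continuous_on A (\<lambda>\<omega>. u (s, \<omega>))"
  by (rule continuous_on_compose2[OF C_on_imp_continuous_on[OF assms(1)]])
    (use assms(2) in \<open>auto intro!: continuous_intros\<close>)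

lemma weighted_area_eq:
  assumes s: "s \<in> {-\<epsilon><..<\<epsilon>}"
  shows "weighted_area r X s = (4 * pi) powr (- real CARD('n) / 2) *
    (\<Sum>\<sigma>\<in>{1, -1}. hemisphere_integral \<sigma> (\<lambda>\<omega>. weighted_density \<sigma> (s, \<omega>)))"
proof -
  let ?h = "\<lambda>p. exp (- (norm (X s p))\<^sup>2 / 2)"
  have eq: "?h (r *\<^sub>R \<omega>) * sqrt (det (gram \<sigma> (s, \<omega>))) = weighted_density \<sigma> (s, \<omega>)"
    if "\<omega> \<in> closed_hemisphere \<sigma>" for \<sigma> \<omega>
    using ext_unit[OF hemisphere_in_chart_domain(2)[OF s that], of s]
    by (simp add: weighted_density_def dot_square_norm)
  have "area_integral r (X s) ?h =
      (\<Sum>\<sigma>\<in>{1, -1}. hemisphere_integral \<sigma> (\<lambda>\<omega>. ?h (r *\<^sub>R \<omega>) * sqrt (det (gram \<sigma> (s, \<omega>)))))"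
  proof (rule area_integral_eq[OF s])
    fix \<sigma> :: real assume \<sigma>: "\<sigma> = 1 \<or> \<sigma> = -1"
    have "continuous_on (closed_hemisphere \<sigma>) (\<lambda>\<omega>. weighted_density \<sigma> (s, \<omega>))"
      unfolding weighted_density_def
      by (intro continuous_intros continuous_slice[OF C_on_ext] continuous_slice[OF C_on_det_gram]
          hemisphere_in_chart_domain[OF s]) auto
    then show "continuous_on (closed_hemisphere \<sigma>) (\<lambda>\<omega>. ?h (r *\<^sub>R \<omega>) * sqrt (det (gram \<sigma> (s, \<omega>))))"
      by (rule continuous_on_eq) (simp only: eq)
  qed
  also have "\<dots> = (\<Sum>\<sigma>\<in>{1, -1}. hemisphere_integral \<sigma> (\<lambda>\<omega>. weighted_density \<sigma> (s, \<omega>)))"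
    by (intro sum.cong refl hemisphere_integral_cong eq) auto
  finally show ?thesis by (simp add: weighted_area_def)
qed

lemma weighted_area_derivatives:
  shows "deriv (weighted_area r X) 0 = (4 * pi) powr (- real CARD('n) / 2) *
      (\<Sum>\<sigma>\<in>{1, -1}. hemisphere_integral \<sigma> (\<lambda>\<omega>. dir_deriv (1, 0) (weighted_density \<sigma>) (0, \<omega>)))"
    and "deriv (deriv (weighted_area r X)) 0 = (4 * pi) powr (- real CARD('n) / 2) *
      (\<Sum>\<sigma>\<in>{1, -1}. hemisphere_integral \<sigma> (\<lambda>\<omega>. dir_deriv (1, 0) (dir_deriv (1, 0) (weighted_density \<sigma>)) (0, \<omega>)))"
proof -
  let ?c = "(4 * pi) powr (- real CARD('n) / 2)"
  obtain d1 where d1: "0 < d1" "{-d1..d1} \<times> closed_hemisphere 1 \<subseteq> regular_domain 1"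
    using regular_tube[of 1] by auto
  obtain d2 where d2: "0 < d2" "{-d2..d2} \<times> closed_hemisphere (-1) \<subseteq> regular_domain (-1)"
    using regular_tube[of "-1"] by auto
  define d where "d = min d1 d2"
  have d: "0 < d" using d1 d2 by (simp add: d_def)
  have sub: "{-d..d} \<times> closed_hemisphere \<sigma> \<subseteq> regular_domain \<sigma>" if "\<sigma> \<in> {1, -1}" for \<sigma>
    using that d1(2) d2(2) by (force simp: d_def)
  have d_eps: "s \<in> {-\<epsilon><..<\<epsilon>}" if "s \<in> {-d<..<d}" for s
  proof -
    have "(s, unit_chart 1 (0 :: real ^ 'n)) \<in> {-d..d} \<times> closed_hemisphere 1"
      using that unit_chart_in_hemisphere[of 1] by auto
    then have "(s, unit_chart 1 (0 :: real ^ 'n)) \<in> cyl"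
      using sub[of 1] regular_domain_subset(2) by blast
    then show ?thesis by simp
  qed
  define T1 where "T1 s = ?c * (\<Sum>\<sigma>\<in>{1, -1}. hemisphere_integral \<sigma> (\<lambda>\<omega>. dir_deriv (1, 0) (weighted_density \<sigma>) (s, \<omega>)))" for s
  have der: "((\<lambda>s. ?c * (\<Sum>\<sigma>\<in>{1, -1}. hemisphere_integral \<sigma> (\<lambda>\<omega>. q \<sigma> (s, \<omega>)))) has_real_derivative
      ?c * (\<Sum>\<sigma>\<in>{1, -1}. hemisphere_integral \<sigma> (\<lambda>\<omega>. dir_deriv (1, 0) (q \<sigma>) (s, \<omega>)))) (at s)"
    if "\<And>\<sigma>. C_on (Suc 0) (regular_domain \<sigma>) (q \<sigma>)" "s \<in> {-d<..<d}" for q s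
    by (intro DERIV_cmult DERIV_sum has_real_derivative_hemisphere_integral[OF that(1) sub _ that(2)]) auto
  have T: "(weighted_area r X has_real_derivative T1 s) (at s)" if s: "s \<in> {-d<..<d}" for s
  proof (rule has_field_derivative_transform_within_open[OF _ _ s])
    show "((\<lambda>s. ?c * (\<Sum>\<sigma>\<in>{1, -1}. hemisphere_integral \<sigma> (\<lambda>\<omega>. weighted_density \<sigma> (s, \<omega>)))) has_real_derivative T1 s) (at s)"
      unfolding T1_def by (rule der[OF C_on_weighted_density s])
  qed (use weighted_area_eq d_eps in auto)
  then have T': "deriv (weighted_area r X) s = T1 s" if "s \<in> {-d<..<d}" for s
    using that DERIV_imp_deriv by blast
  show "deriv (weighted_area r X) 0 = ?c * (\<Sum>\<sigma>\<in>{1, -1}. hemisphere_integral \<sigma> (\<lambda>\<omega>. dir_deriv (1, 0) (weighted_density \<sigma>) (0, \<omega>)))"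
    using T'[of 0] d by (simp add: T1_def)
  have T1: "(T1 has_real_derivative ?c * (\<Sum>\<sigma>\<in>{1, -1}. hemisphere_integral \<sigma>
      (\<lambda>\<omega>. dir_deriv (1, 0) (dir_deriv (1, 0) (weighted_density \<sigma>)) (0, \<omega>)))) (at 0)"
    unfolding T1_def by (rule der[OF C_on_dir_deriv[OF C_on_weighted_density]]) (use d in auto)
  have "(deriv (weighted_area r X) has_real_derivative ?c * (\<Sum>\<sigma>\<in>{1, -1}. hemisphere_integral \<sigma>
      (\<lambda>\<omega>. dir_deriv (1, 0) (dir_deriv (1, 0) (weighted_density \<sigma>)) (0, \<omega>)))) (at 0)"
    by (rule has_field_derivative_transform_within_open[OF T1, of "{-d<..<d}"]) (use d T' in auto)
  then show "deriv (deriv (weighted_area r X)) 0 = ?c * (\<Sum>\<sigma>\<in>{1, -1}. hemisphere_integral \<sigma>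
      (\<lambda>\<omega>. dir_deriv (1, 0) (dir_deriv (1, 0) (weighted_density \<sigma>)) (0, \<omega>)))"
    by (rule DERIV_imp_deriv)
qed

subsection \<open>Jets at the round sphere\<close>

abbreviation normal_acceleration :: "'n space \<Rightarrow> real" where
  "normal_acceleration p \<equiv> acceleration (0, p) \<bullet> p"

abbreviation gradient_square :: "'n space \<Rightarrow> real" where
  "gradient_square p \<equiv> \<Sum>b\<in>Basis. (dir_deriv b speed p)\<^sup>2"

lemma has_jet2_ext:
  assumes "norm \<omega> = 1"
  shows "has_jet2 (\<lambda>s. ext (s, \<omega>)) (r *\<^sub>R \<omega>) (speed \<omega> *\<^sub>R \<omega>) (acceleration (0, \<omega>))"
proof -
  have w: "\<omega> \<noteq> 0" "sgn \<omega> = \<omega>" using assms by (auto simp: sgn_div_norm)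
  show ?thesis
    using has_jet2_along[OF open_cyl _ C_on_ext, of \<omega>] w zero_mem ext_0[OF w(1)] velocity_0[OF w(1)]
    by (simp add: velocity_def acceleration_def)
qed

lemma has_jet2_weight:
  assumes "norm \<omega> = 1"
  shows "has_jet2 (\<lambda>s. exp (- (ext (s, \<omega>) \<bullet> ext (s, \<omega>)) / 2)) (exp (- r\<^sup>2 / 2))
    (exp (- r\<^sup>2 / 2) * (- r * speed \<omega>))
    (exp (- r\<^sup>2 / 2) * (r\<^sup>2 * (speed \<omega>)\<^sup>2 - (speed \<omega>)\<^sup>2 - r * normal_acceleration \<omega>))"
proof -
  have ww: "\<omega> \<bullet> \<omega> = 1" using assms by (simp add: dot_square_norm)
  have 1: "has_jet2 (\<lambda>s. ext (s, \<omega>) \<bullet> ext (s, \<omega>)) (r\<^sup>2) (2 * r * speed \<omega>)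
      (2 * r * normal_acceleration \<omega> + 2 * (speed \<omega>)\<^sup>2)"
    using has_jet2_inner[OF has_jet2_ext[OF assms] has_jet2_ext[OF assms]] ww
    by (simp add: power2_eq_square inner_commute algebra_simps)
  have 2: "((\<lambda>x. exp (- x / 2)) has_real_derivative - exp (- x / 2) / 2) (at x)"
    "((\<lambda>x. - exp (- x / 2) / 2) has_real_derivative exp (- x / 2) / 4) (at x)" for x :: real
    by (auto intro!: derivative_eq_intros)
  have 3: "- exp (- r\<^sup>2 / 2) / 2 * (2 * r * speed \<omega>) = exp (- r\<^sup>2 / 2) * (- r * speed \<omega>)"
    "- exp (- r\<^sup>2 / 2) / 2 * (2 * r * normal_acceleration \<omega> + 2 * (speed \<omega>)\<^sup>2) +
      exp (- r\<^sup>2 / 2) / 4 * (2 * r * speed \<omega>) * (2 * r * speed \<omega>) =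
      exp (- r\<^sup>2 / 2) * (r\<^sup>2 * (speed \<omega>)\<^sup>2 - (speed \<omega>)\<^sup>2 - r * normal_acceleration \<omega>)"
    by (simp_all add: power2_eq_square algebra_simps add_divide_distrib)
  show ?thesis
    using has_jet2_compose[OF 1 open_UNIV UNIV_I 2(1) 2(2)] unfolding 3 .
qed

text \<open>Time and space derivatives commute, so the derivatives of the tangent vector are those of the
  velocity \<open>u \<omega>\<close> and of the acceleration along the frame vector.\<close>

lemma has_jet2_tangent_image:
  assumes \<sigma>: "\<sigma> = 1 \<or> \<sigma> = -1" and \<omega>: "\<omega> \<in> closed_hemisphere \<sigma>"
  shows "has_jet2 (\<lambda>s. tangent_image \<sigma> (s, \<omega>) i) (r *\<^sub>R frame \<sigma> \<omega> i)
    (dir_deriv (frame \<sigma> \<omega> i) speed \<omega> *\<^sub>R \<omega> + speed \<omega> *\<^sub>R frame \<sigma> \<omega> i)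
    (dir_deriv (frame \<sigma> \<omega> i) (\<lambda>x. acceleration (0, x)) \<omega>)"
proof -
  note h = hemisphere_in_chart_domain[OF zero_mem \<omega>]
  define E where "E = frame \<sigma> \<omega> i"
  have sg: "sgn \<omega> = \<omega>" using h(2) by (simp add: sgn_div_norm)
  have E\<omega>: "\<omega> \<bullet> E = 0" using frame_tangent[OF \<sigma> h(2,3)] by (simp add: E_def inner_commute)
  have comm: "dir_deriv (1, 0) (dir_deriv (0, E) u) z = dir_deriv (0, E) (dir_deriv (1, 0) u) z"
    if "C_on (Suc (Suc 0)) cyl u" "z \<in> cyl" for z and u :: "real \<times> 'n space \<Rightarrow> 'n space"
    by (rule dir_deriv_commute[OF open_cyl that(2,1)])
  have v0: "dir_deriv (0, E) ext (0, \<omega>) = r *\<^sub>R E"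
    using dir_deriv_ext_0[OF h(4)] h(2) sg E\<omega> by simp
  have v1: "dir_deriv (1, 0) (dir_deriv (0, E) ext) (0, \<omega>) = dir_deriv E speed \<omega> *\<^sub>R \<omega> + speed \<omega> *\<^sub>R E"
  proof -
    have "dir_deriv (1, 0) (dir_deriv (0, E) ext) (0, \<omega>) = dir_deriv (0, E) velocity (0, \<omega>)"
      unfolding velocity_def by (rule comm[OF C_on_ext h(5)])
    also have "\<dots> = dir_deriv E (\<lambda>x. velocity (0, x)) \<omega>"
      by (rule dir_deriv_slice[OF C_on_velocity h(5), symmetric])
    also have "\<dots> = dir_deriv E (\<lambda>x. speed x *\<^sub>R sgn x) \<omega>"
      by (subst frechet_derivative_cong_open[of "- {0}" \<omega> _ "\<lambda>x. speed x *\<^sub>R sgn x"])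
        (use h(4) velocity_0 in \<open>auto simp: open_Compl\<close>)
    also have "\<dots> = speed \<omega> *\<^sub>R (inverse (norm \<omega>) *\<^sub>R (E - (sgn \<omega> \<bullet> E) *\<^sub>R sgn \<omega>)) + dir_deriv E speed \<omega> *\<^sub>R sgn \<omega>"
      using frechet_derivative_at[OF has_derivative_scaleR[OF C_on_imp_differentiable[OF C_on_speed]
            has_derivative_sgn[OF h(4)]], symmetric] h(4) by simp
    finally show ?thesis using h(2) sg E\<omega> by simp
  qed
  have v2: "dir_deriv (1, 0) (dir_deriv (1, 0) (dir_deriv (0, E) ext)) (0, \<omega>) =
      dir_deriv E (\<lambda>x. acceleration (0, x)) \<omega>"
  proof -
    have "dir_deriv (1, 0) (dir_deriv (1, 0) (dir_deriv (0, E) ext)) (0, \<omega>) =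
        dir_deriv (1, 0) (dir_deriv (0, E) velocity) (0, \<omega>)"
      unfolding velocity_def
      by (subst frechet_derivative_cong_open[OF open_cyl h(5) comm[OF C_on_ext]]) auto
    also have "\<dots> = dir_deriv (0, E) acceleration (0, \<omega>)"
      unfolding acceleration_def by (rule comm[OF C_on_velocity h(5)])
    also have "\<dots> = dir_deriv E (\<lambda>x. acceleration (0, x)) \<omega>"
      by (rule dir_deriv_slice[OF C_on_acceleration h(5), symmetric])
    finally show ?thesis .
  qed
  have "has_jet2 (\<lambda>s. dir_deriv (0, E) ext (s, \<omega>)) (r *\<^sub>R E)
      (dir_deriv E speed \<omega> *\<^sub>R \<omega> + speed \<omega> *\<^sub>R E) (dir_deriv E (\<lambda>x. acceleration (0, x)) \<omega>)"
    using has_jet2_along[OF open_cyl h(5) C_on_dir_deriv[OF C_on_ext, where v = "(0, E)"]] unfolding v0 v1 v2 .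
  moreover have "\<forall>\<^sub>F s in nhds 0. s \<in> {-\<epsilon><..<\<epsilon>}"
    using zero_mem by (intro eventually_nhds_in_open) auto
  then have "\<forall>\<^sub>F s in nhds 0. dir_deriv (0, E) ext (s, \<omega>) = tangent_image \<sigma> (s, \<omega>) i"
    by eventually_elim (use h(4) in \<open>simp add: tangent_image_eq E_def\<close>)
  ultimately show ?thesis unfolding E_def by (rule has_jet2_cong)
qed

text \<open>The Gram matrix is \<open>r^2\<close> times the identity at \<open>s = 0\<close> and its first derivative is \<open>2 r u\<close> times the
  identity, so that its second derivative enters only through the trace, which contains the
  divergence of the acceleration and the squared gradient of the speed.\<close>

lemma has_jet2_area_density:
  assumes \<sigma>: "\<sigma> = 1 \<or> \<sigma> = -1" and \<omega>: "\<omega> \<in> closed_hemisphere \<sigma>"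
  shows "has_jet2 (\<lambda>s. sqrt (det (gram \<sigma> (s, \<omega>)))) (r ^ CARD('n))
    (r ^ CARD('n) * (real CARD('n) / r * speed \<omega>))
    (r ^ CARD('n) * (divergence (\<lambda>x. acceleration (0, x)) \<omega> / r + gradient_square \<omega> / r\<^sup>2 +
      (real CARD('n) * real CARD('n) - real CARD('n)) / r\<^sup>2 * (speed \<omega>)\<^sup>2))"
proof -
  note h = hemisphere_in_chart_domain[OF zero_mem \<omega>]
  let ?n = "real CARD('n)"
  define E where "E = frame \<sigma> \<omega>"
  define a where "a = speed \<omega>"
  define d where "d i = dir_deriv (E i) speed \<omega>" for i
  define B where "B i = dir_deriv (E i) (\<lambda>x. acceleration (0, x)) \<omega>" for i
  have EE: "E i \<bullet> E j = (if i = j then 1 else 0)" and E\<omega>: "E i \<bullet> \<omega> = 0" "\<omega> \<bullet> E i = 0" for i j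
    using frame_orthonormal[OF \<sigma> h(2,3)] frame_tangent[OF \<sigma> h(2,3)] by (simp_all add: E_def inner_commute)
  have ww: "\<omega> \<bullet> \<omega> = 1" using h(2) by (simp add: dot_square_norm)
  define C where "C i j = r * (E i \<bullet> B j) + 2 * ((d i *\<^sub>R \<omega> + a *\<^sub>R E i) \<bullet> (d j *\<^sub>R \<omega> + a *\<^sub>R E j)) + r * (B i \<bullet> E j)" for i j
  have gram: "has_jet2 (\<lambda>s. gram \<sigma> (s, \<omega>) $ i $ j) (if i = j then r\<^sup>2 else 0) (if i = j then 2 * r * a else 0) (C i j)" for i j
    using has_jet2_inner[OF has_jet2_tangent_image[OF assms, of i] has_jet2_tangent_image[OF assms, of j]]
    by (auto simp: gram_def C_def E_def[symmetric] d_def[symmetric] B_def[symmetric] a_def[symmetric]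
        inner_add_left inner_add_right EE E\<omega> power2_eq_square algebra_simps split: if_splits)
  have sumC: "(\<Sum>i\<in>UNIV. C i i) = 2 * r * divergence (\<lambda>x. acceleration (0, x)) \<omega> + 2 * gradient_square \<omega> + 2 * ?n * a\<^sup>2"
  proof -
    have bl: "bounded_linear (\<lambda>v. dir_deriv v (\<lambda>x. acceleration (0, x)) \<omega>)" "bounded_linear (\<lambda>v. dir_deriv v speed \<omega>)"
      using C_on_imp_differentiable[OF C_on_at_0(2), of \<omega>] C_on_imp_differentiable[OF C_on_speed, of \<omega>] h(4)
      by (auto intro: has_derivative_bounded_linear)
    have "divergence (\<lambda>x. acceleration (0, x)) \<omega> = (\<Sum>i\<in>UNIV. B i \<bullet> E i)"
      using frame_trace[OF \<sigma> h(2,3) bounded_bilinear.comp1[OF bounded_bilinear_inner bl(1)]]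
        dir_deriv_radial[OF C_on_at_0(2) homogeneous0_acceleration h(4)]
      by (simp add: divergence_def B_def E_def)
    moreover have "gradient_square \<omega> = (\<Sum>i\<in>UNIV. (d i)\<^sup>2)"
      using frame_trace[OF \<sigma> h(2,3) bounded_bilinear.comp[OF bounded_bilinear_mult bl(2) bl(2)]]
        dir_deriv_radial[OF C_on_speed homogeneous0_speed h(4)]
      by (simp add: power2_eq_square d_def E_def)
    moreover have "C i i = 2 * r * (B i \<bullet> E i) + 2 * (d i)\<^sup>2 + 2 * a\<^sup>2" for i
      by (simp add: C_def inner_add_left inner_add_right EE E\<omega> ww inner_commute power2_eq_square algebra_simps)
    ultimately show ?thesis
      by (simp add: sum.distrib sum_distrib_left)
  qed
  define \<alpha> where "\<alpha> = (r\<^sup>2) ^ CARD('n)"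
  have \<alpha>: "0 < \<alpha>" "sqrt \<alpha> = r ^ CARD('n)"
    using r by (simp_all add: \<alpha>_def real_sqrt_power)
  then have \<alpha>2: "\<alpha> = r ^ CARD('n) * r ^ CARD('n)"
    by (simp add: \<alpha>_def power_mult_distrib[symmetric] power2_eq_square)
  define S where "S = (\<Sum>i\<in>UNIV. C i i / r\<^sup>2) + (?n * ?n - ?n) * (2 * r * a / r\<^sup>2)\<^sup>2"
  have det: "has_jet2 (\<lambda>s. det (gram \<sigma> (s, \<omega>))) \<alpha> (\<alpha> * (?n * (2 * r * a / r\<^sup>2))) (\<alpha> * S)"
    using has_jet2_det_scalar[OF _ gram] r unfolding \<alpha>_def S_def by simp
  have g: "(sqrt has_real_derivative inverse (sqrt x) / 2) (at x)" if "x \<in> {0<..}" for x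
    using that by (auto intro!: derivative_eq_intros)
  have g': "((\<lambda>x. inverse (sqrt x) / 2) has_real_derivative - (inverse (sqrt \<alpha>) / (4 * \<alpha>))) (at \<alpha>)"
  proof -
    have "((\<lambda>x. inverse (sqrt x) / 2) has_real_derivative
        - (inverse (sqrt \<alpha>) * (inverse (sqrt \<alpha>) / 2) * inverse (sqrt \<alpha>)) / 2) (at \<alpha>)"
      by (intro DERIV_cdivide DERIV_inverse' g) (use \<alpha>(1) in auto)
    moreover have "inverse (sqrt \<alpha>) * (inverse (sqrt \<alpha>) / 2) * inverse (sqrt \<alpha>) / 2 = inverse (sqrt \<alpha>) / (4 * \<alpha>)"
      unfolding \<alpha>(2) \<alpha>2 using r by (simp add: field_simps)
    ultimately show ?thesis by (simp only: minus_divide_left[symmetric] mult_minus_left)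
  qed
  from has_jet2_compose[OF det open_greaterThan _ g g'] \<alpha>
  have jet: "has_jet2 (\<lambda>s. sqrt (det (gram \<sigma> (s, \<omega>)))) (sqrt \<alpha>) (inverse (sqrt \<alpha>) / 2 * (\<alpha> * (?n * (2 * r * a / r\<^sup>2))))
      (inverse (sqrt \<alpha>) / 2 * (\<alpha> * S) + - (inverse (sqrt \<alpha>) / (4 * \<alpha>)) * (\<alpha> * (?n * (2 * r * a / r\<^sup>2))) * (\<alpha> * (?n * (2 * r * a / r\<^sup>2))))"
    by simp
  have b: "inverse (sqrt \<alpha>) / 2 * (\<alpha> * (?n * (2 * r * a / r\<^sup>2))) = r ^ CARD('n) * (?n / r * a)"
    unfolding \<alpha>(2) \<alpha>2 using r by (simp add: field_simps power2_eq_square)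
  have c: "inverse (sqrt \<alpha>) / 2 * (\<alpha> * S) + - (inverse (sqrt \<alpha>) / (4 * \<alpha>)) * (\<alpha> * (?n * (2 * r * a / r\<^sup>2))) * (\<alpha> * (?n * (2 * r * a / r\<^sup>2)))
      = r ^ CARD('n) * (S / 2 - (?n * a / r)\<^sup>2)"
    unfolding \<alpha>(2) \<alpha>2 using r by (simp add: field_simps power2_eq_square)
  have S2: "S / 2 - (?n * a / r)\<^sup>2 = divergence (\<lambda>x. acceleration (0, x)) \<omega> / r + gradient_square \<omega> / r\<^sup>2 +
      (?n * ?n - ?n) / r\<^sup>2 * a\<^sup>2"
    unfolding S_def sum_divide_distrib[symmetric] sumC using r
    by (simp add: field_simps power2_eq_square)
  show ?thesis
    using jet unfolding b c S2 unfolding \<alpha>(2) a_def .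
qed

lemma weighted_density_derivatives:
  assumes \<sigma>: "\<sigma> = 1 \<or> \<sigma> = -1" and \<omega>: "\<omega> \<in> closed_hemisphere \<sigma>"
  defines "K \<equiv> exp (- r\<^sup>2 / 2) * r ^ CARD('n)"
  shows "dir_deriv (1, 0) (weighted_density \<sigma>) (0, \<omega>) = K * (real CARD('n) / r - r) * speed \<omega>"
    and "dir_deriv (1, 0) (dir_deriv (1, 0) (weighted_density \<sigma>)) (0, \<omega>) =
      K * (divergence (\<lambda>x. acceleration (0, x)) \<omega> / r + gradient_square \<omega> / r\<^sup>2 +
        ((real CARD('n) / r - r)\<^sup>2 - 1 - real CARD('n) / r\<^sup>2) * (speed \<omega>)\<^sup>2 - r * normal_acceleration \<omega>)"
proof -
  note h = hemisphere_in_chart_domain[OF zero_mem \<omega>]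
  have mem: "(0, \<omega>) \<in> regular_domain \<sigma>"
    using h(1) det_gram_0[OF \<sigma> \<omega>] r by (simp add: regular_domain_def)
  note u = has_jet2_unique[OF has_jet2_along[OF open_regular_domain mem C_on_weighted_density]
      has_jet2_mult[OF has_jet2_weight[OF h(2)] has_jet2_area_density[OF \<sigma> \<omega>], folded weighted_density_def]]
  from u show "dir_deriv (1, 0) (weighted_density \<sigma>) (0, \<omega>) = K * (real CARD('n) / r - r) * speed \<omega>"
    by (simp add: K_def algebra_simps)
  have "e * (P * (D / r + G / r\<^sup>2 + (n * n - n) / r\<^sup>2 * a\<^sup>2)) + 2 *\<^sub>R ((e * (- r * a)) * (P * (n / r * a))) +
      (e * (r\<^sup>2 * a\<^sup>2 - a\<^sup>2 - r * h)) * P =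
      e * P * (D / r + G / r\<^sup>2 + ((n / r - r)\<^sup>2 - 1 - n / r\<^sup>2) * a\<^sup>2 - r * h)" for e P D G n a h :: real
    using r by (simp add: power2_eq_square field_simps)
  with u show "dir_deriv (1, 0) (dir_deriv (1, 0) (weighted_density \<sigma>)) (0, \<omega>) =
      K * (divergence (\<lambda>x. acceleration (0, x)) \<omega> / r + gradient_square \<omega> / r\<^sup>2 +
        ((real CARD('n) / r - r)\<^sup>2 - 1 - real CARD('n) / r\<^sup>2) * (speed \<omega>)\<^sup>2 - r * normal_acceleration \<omega>)"
    unfolding K_def by (simp only:)
qed

subsection \<open>The volume constraint\<close>

text \<open>At \<open>s = 0\<close> the unit normal is one of the two radial unit vectors, with the same sign everywhere
  because the sphere is connected.\<close>

lemma N_0: "\<exists>\<tau>. (\<tau> = 1 \<or> \<tau> = -1) \<and> (\<forall>p\<in>sphere 0 r. N 0 p = (\<tau> / r) *\<^sub>R p)"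
proof -
  have N: "unit_normal r (X 0) (N 0)" by (rule normal_N[OF zero_mem])
  have pt: "N 0 p = ((N 0 p \<bullet> p / r) / r) *\<^sub>R p \<and> (N 0 p \<bullet> p / r = 1 \<or> N 0 p \<bullet> p / r = -1)"
    if p: "p \<in> sphere 0 r" for p
  proof -
    define u where "u = N 0 p"
    have pp: "p \<bullet> p = r\<^sup>2" using p by (simp add: dot_square_norm)
    have orth: "u \<bullet> v = 0" if "v \<in> tangent_space p" for v
    proof -
      have "differential r (X 0) p v = v"
        by (rule differential_eq[OF r p has_derivative_ident X_0 that])
      then show ?thesis using N p that unfolding unit_normal_def u_def by metis
    qed
    define v where "v = u - ((u \<bullet> p) / r\<^sup>2) *\<^sub>R p"
    have vp: "v \<bullet> p = 0" using r by (simp add: v_def inner_diff_left pp)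
    then have "u \<bullet> v = 0" by (intro orth) (simp add: tangent_space_def)
    then have "v \<bullet> v = 0" using vp by (simp add: v_def inner_diff_left inner_commute)
    then have u: "u = ((u \<bullet> p) / r\<^sup>2) *\<^sub>R p" by (simp add: v_def)
    have "norm u = 1" using N p unfolding unit_normal_def u_def by blast
    then have "\<bar>u \<bullet> p\<bar> / r\<^sup>2 * r = 1" using u p r by (metis abs_divide abs_power2 mem_sphere_0 norm_scaleR)
    then have "\<bar>u \<bullet> p / r\<bar> = 1" using r by (simp add: power2_eq_square abs_divide)
    then have "u \<bullet> p / r = 1 \<or> u \<bullet> p / r = -1" by (simp only: abs_if split: if_splits) auto
    moreover have "((u \<bullet> p / r) / r) *\<^sub>R p = u" using u by (simp add: power2_eq_square)
    ultimately show ?thesis unfolding u_def by simp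
  qed
  have "(\<lambda>p. N 0 p \<bullet> p / r) constant_on (sphere 0 r)"
  proof (rule continuous_finite_range_constant)
    show "connected (sphere (0 :: 'n space) r)" by (rule connected_sphere) simp
    show "continuous_on (sphere 0 r) (\<lambda>p. N 0 p \<bullet> p / r)"
      using N r unfolding unit_normal_def by (intro continuous_intros) auto
    show "finite ((\<lambda>p. N 0 p \<bullet> p / r) ` sphere 0 r)"
    proof (rule finite_subset[of _ "{1, -1}"])
      show "(\<lambda>p. N 0 p \<bullet> p / r) ` sphere 0 r \<subseteq> {1, -1}"
        using conjunct2[OF pt] by (intro image_subsetI) (simp only: insert_iff empty_iff simp_thms)
    qed simp
  qed
  then obtain \<tau> where \<tau>: "\<And>p. p \<in> sphere 0 r \<Longrightarrow> N 0 p \<bullet> p / r = \<tau>"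
    unfolding constant_on_def by blast
  obtain p :: "'n space" where "p \<in> sphere 0 r"
    using scaled_sgn_in_sphere[of "(0, 1)"] by (auto simp: zero_prod_def)
  then have "\<tau> = 1 \<or> \<tau> = -1" using pt \<tau> by blast
  moreover have "N 0 p = (\<tau> / r) *\<^sub>R p" if "p \<in> sphere 0 r" for p
    using pt[OF that] \<tau>[OF that] by simp
  ultimately show ?thesis by blast
qed

lemma weighted_volume_eq:
  "\<exists>c. c \<noteq> 0 \<and> (\<forall>s\<in>{-\<epsilon><..<\<epsilon>}. weighted_volume r X N s = c * sphere_integral (\<lambda>\<omega>. ext (s, \<omega>) \<bullet> \<omega>))"
proof -
  obtain \<tau> where \<tau>: "\<tau> = 1 \<or> \<tau> = -1" "\<And>p. p \<in> sphere 0 r \<Longrightarrow> N 0 p = (\<tau> / r) *\<^sub>R p"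
    using N_0 by blast
  define c where "c = \<tau> * exp (- r\<^sup>2 / 2) * r ^ CARD('n)"
  have "weighted_volume r X N s = c * sphere_integral (\<lambda>\<omega>. ext (s, \<omega>) \<bullet> \<omega>)" if s: "s \<in> {-\<epsilon><..<\<epsilon>}" for s
  proof -
    let ?h = "\<lambda>p. (X s p \<bullet> N 0 p) * exp (- (norm (X 0 p))\<^sup>2 / 2)"
    have eq: "?h (r *\<^sub>R \<omega>) * sqrt (det (gram \<sigma> (0, \<omega>))) = c * (ext (s, \<omega>) \<bullet> \<omega>)"
      if "\<sigma> = 1 \<or> \<sigma> = -1" "\<omega> \<in> closed_hemisphere \<sigma>" for \<sigma> \<omega>
    proof -
      note h = hemisphere_in_chart_domain[OF zero_mem that(2)]
      have S: "r *\<^sub>R \<omega> \<in> sphere 0 r" using h(2) r by simp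
      show ?thesis
        using \<tau>(2)[OF S] X_0[OF S] det_gram_0[OF that] r h(2)
        by (simp add: ext_unit c_def)
    qed
    have "weighted_volume r X N s =
        (\<Sum>\<sigma>\<in>{1, -1}. hemisphere_integral \<sigma> (\<lambda>\<omega>. ?h (r *\<^sub>R \<omega>) * sqrt (det (gram \<sigma> (0, \<omega>)))))"
      unfolding weighted_volume_def
    proof (rule area_integral_eq[OF zero_mem])
      fix \<sigma> :: real assume \<sigma>: "\<sigma> = 1 \<or> \<sigma> = -1"
      have "continuous_on (closed_hemisphere \<sigma>) (\<lambda>\<omega>. c * (ext (s, \<omega>) \<bullet> \<omega>))"
        by (intro continuous_intros continuous_slice[OF C_on_ext] hemisphere_in_chart_domain[OF s])
      then show "continuous_on (closed_hemisphere \<sigma>) (\<lambda>\<omega>. ?h (r *\<^sub>R \<omega>) * sqrt (det (gram \<sigma> (0, \<omega>))))"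
        by (rule continuous_on_eq) (use eq[OF \<sigma>] in auto)
    qed
    also have "\<dots> = (\<Sum>\<sigma>\<in>{1, -1}. hemisphere_integral \<sigma> (\<lambda>\<omega>. c * (ext (s, \<omega>) \<bullet> \<omega>)))"
      by (intro sum.cong refl hemisphere_integral_cong eq) auto
    also have "\<dots> = c * sphere_integral (\<lambda>\<omega>. ext (s, \<omega>) \<bullet> \<omega>)"
      unfolding sphere_integral_cmult[symmetric] by (simp add: sphere_integral_def)
    finally show ?thesis .
  qed
  moreover have "c \<noteq> 0" using \<tau>(1) r by (auto simp: c_def)
  ultimately show ?thesis by blast
qed

lemma dir_deriv_inner_snd:
  assumes "C_on (Suc k) cyl u" "z \<in> cyl"
  shows "dir_deriv (1, 0) (\<lambda>z. u z \<bullet> snd z) z = dir_deriv (1, 0) u z \<bullet> snd z"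
proof -
  have "((\<lambda>z. u z \<bullet> snd z) has_derivative (\<lambda>v. u z \<bullet> snd v + dir_deriv v u z \<bullet> snd z)) (at z)"
    by (intro has_derivative_inner C_on_imp_differentiable[OF assms] has_derivative_snd has_derivative_ident)
  from frechet_derivative_at[OF this, symmetric] show ?thesis by simp
qed

text \<open>The first and second derivatives of the constant function
  \<open>s \<mapsto> \<integral> ext (s, \<omega>) \<bullet> \<omega>\<close>.\<close>

lemma volume_constraint:
  assumes vol: "\<forall>s\<in>{-\<epsilon><..<\<epsilon>}. weighted_volume r X N s = weighted_volume r X N 0"
  shows "sphere_integral speed = 0" and "sphere_integral normal_acceleration = 0"
proof -
  obtain c where c: "c \<noteq> 0"
    "\<And>s. s \<in> {-\<epsilon><..<\<epsilon>} \<Longrightarrow> weighted_volume r X N s = c * sphere_integral (\<lambda>\<omega>. ext (s, \<omega>) \<bullet> \<omega>)"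
    using weighted_volume_eq by blast
  define J where "J s = sphere_integral (\<lambda>\<omega>. ext (s, \<omega>) \<bullet> \<omega>)" for s
  define J1 where "J1 s = sphere_integral (\<lambda>\<omega>. velocity (s, \<omega>) \<bullet> \<omega>)" for s
  have J: "J s = J 0" if "s \<in> {-\<epsilon><..<\<epsilon>}" for s
    using bspec[OF vol that] c(1) unfolding c(2)[OF that] c(2)[OF zero_mem] J_def by simp
  let ?I = "{- (\<epsilon> / 2)<..<\<epsilon> / 2}"
  have sub: "{- (\<epsilon> / 2)..\<epsilon> / 2} \<times> sphere (0 :: 'n space) 1 \<subseteq> cyl"
    using eps by (auto simp: zero_prod_def)
  have C: "C_on k cyl (\<lambda>z. u z \<bullet> snd z)" if "C_on k cyl u" for k and u :: "real \<times> 'n space \<Rightarrow> 'n space"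
    using that open_cyl by (intro C_on_intros)
  have der: "((\<lambda>s. sphere_integral (\<lambda>\<omega>. u (s, \<omega>) \<bullet> \<omega>)) has_real_derivative
      sphere_integral (\<lambda>\<omega>. dir_deriv (1, 0) u (s, \<omega>) \<bullet> \<omega>)) (at s)"
    if u: "C_on (Suc 0) cyl u" and s: "s \<in> ?I" for u :: "real \<times> 'n space \<Rightarrow> 'n space" and s
  proof -
    have "sphere_integral (\<lambda>\<omega>. dir_deriv (1, 0) (\<lambda>z. u z \<bullet> snd z) (s, \<omega>)) =
        sphere_integral (\<lambda>\<omega>. dir_deriv (1, 0) u (s, \<omega>) \<bullet> \<omega>)"
    proof (rule sphere_integral_cong)
      fix \<omega> :: "'n space" assume "norm \<omega> = 1"
      then have "(s, \<omega>) \<in> cyl" using s eps by auto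
      from dir_deriv_inner_snd[OF u this]
      show "dir_deriv (1, 0) (\<lambda>z. u z \<bullet> snd z) (s, \<omega>) = dir_deriv (1, 0) u (s, \<omega>) \<bullet> \<omega>" by simp
    qed
    then show ?thesis
      using has_real_derivative_sphere_integral[OF C[OF u] sub s] by simp
  qed
  have zero: "D = 0" if "(g has_real_derivative D) (at s)" "s \<in> ?I" "\<And>t. t \<in> ?I \<Longrightarrow> g t = g0" for g g0 D s
  proof -
    have "((\<lambda>t. g0) has_real_derivative D) (at s)"
      by (rule has_field_derivative_transform_within_open[OF that(1) _ that(2) that(3)]) auto
    then show ?thesis by (rule DERIV_unique[OF _ DERIV_const])
  qed
  have J1: "J1 s = 0" if s: "s \<in> ?I" for s
  proof (rule zero[OF _ s])
    show "(J has_real_derivative J1 s) (at s)"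
      unfolding J_def J1_def velocity_def by (rule der[OF C_on_ext s])
    show "J t = J 0" if "t \<in> ?I" for t using that eps by (intro J) auto
  qed
  have "sphere_integral normal_acceleration = 0"
  proof (rule zero)
    show "(J1 has_real_derivative sphere_integral normal_acceleration) (at 0)"
      unfolding J1_def acceleration_def by (rule der[OF C_on_velocity]) (use eps in simp)
  qed (use eps J1 in auto)
  then show "sphere_integral normal_acceleration = 0" .
  have "sphere_integral speed = J1 0"
    unfolding J1_def by (rule sphere_integral_cong) (simp add: speed_def sgn_div_norm)
  then show "sphere_integral speed = 0" using J1 eps by simp
qed

text \<open>The two integrals that involve the acceleration, \<open>\<integral> div A\<close> and \<open>\<integral> A \<bullet> \<omega>\<close>, both vanish under the
  volume constraint, the former by the divergence theorem.\<close>

theorem second_variation: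
  assumes vol: "\<forall>s\<in>{-\<epsilon><..<\<epsilon>}. weighted_volume r X N s = weighted_volume r X N 0"
  defines "K \<equiv> (4 * pi) powr (- real CARD('n) / 2) * (exp (- r\<^sup>2 / 2) * r ^ CARD('n))"
  shows "deriv (weighted_area r X) 0 = 0"
    and "deriv (deriv (weighted_area r X)) 0 = K * (sphere_integral gradient_square / r\<^sup>2 +
      ((real CARD('n) / r - r)\<^sup>2 - 1 - real CARD('n) / r\<^sup>2) * sphere_integral (\<lambda>p. (speed p)\<^sup>2))"
proof -
  let ?n = "real CARD('n)" and ?S = "sphere (0 :: 'n space) 1"
  let ?A = "\<lambda>x. acceleration (0, x)"
  define Q where "Q = (?n / r - r)\<^sup>2 - 1 - ?n / r\<^sup>2"
  define L where "L = exp (- r\<^sup>2 / 2) * r ^ CARD('n)"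
  have punct: "?S \<subseteq> - {0}" by auto
  have c: "continuous_on ?S speed" "continuous_on ?S (divergence ?A)"
    "continuous_on ?S gradient_square" "continuous_on ?S normal_acceleration"
    by (intro continuous_intros continuous_on_subset[OF C_on_imp_continuous_on[OF C_on_speed] punct]
        continuous_divergence[OF C_on_at_0(2)]
        continuous_on_subset[OF C_on_imp_continuous_on[OF C_on_dir_deriv[OF C_on_speed]] punct]
        continuous_on_subset[OF C_on_imp_continuous_on[OF C_on_at_0(2)] punct])+
  have "(\<Sum>\<sigma>\<in>{1, -1}. hemisphere_integral \<sigma> (\<lambda>\<omega>. dir_deriv (1, 0) (weighted_density \<sigma>) (0, \<omega>))) =
      (\<Sum>\<sigma>\<in>{1, -1}. hemisphere_integral \<sigma> (\<lambda>\<omega>. (L * (?n / r - r)) * speed \<omega>))"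
    unfolding L_def
    by (intro sum.cong refl hemisphere_integral_cong weighted_density_derivatives(1)) auto
  also have "\<dots> = (L * (?n / r - r)) * sphere_integral speed"
    unfolding sphere_integral_cmult[symmetric] by (simp add: sphere_integral_def)
  finally show "deriv (weighted_area r X) 0 = 0"
    using weighted_area_derivatives(1) volume_constraint(1)[OF vol] by simp
  let ?q = "\<lambda>\<omega>. divergence ?A \<omega> / r + gradient_square \<omega> / r\<^sup>2 + Q * (speed \<omega>)\<^sup>2 - r * normal_acceleration \<omega>"
  have "(\<Sum>\<sigma>\<in>{1, -1}. hemisphere_integral \<sigma> (\<lambda>\<omega>. dir_deriv (1, 0) (dir_deriv (1, 0) (weighted_density \<sigma>)) (0, \<omega>))) =
      (\<Sum>\<sigma>\<in>{1, -1}. hemisphere_integral \<sigma> (\<lambda>\<omega>. L * ?q \<omega>))"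
    unfolding L_def Q_def
    by (intro sum.cong refl hemisphere_integral_cong weighted_density_derivatives(2)) auto
  also have "\<dots> = L * sphere_integral ?q"
    unfolding sphere_integral_cmult[symmetric] by (simp add: sphere_integral_def)
  also have "sphere_integral ?q = sphere_integral (\<lambda>\<omega>. (1 / r) * divergence ?A \<omega> + (1 / r\<^sup>2) * gradient_square \<omega> +
      Q * (speed \<omega>)\<^sup>2 - r * normal_acceleration \<omega>)"
    by simp
  also have "\<dots> = sphere_integral (\<lambda>\<omega>. (1 / r) * divergence ?A \<omega>) +
      sphere_integral (\<lambda>\<omega>. (1 / r\<^sup>2) * gradient_square \<omega>) + sphere_integral (\<lambda>\<omega>. Q * (speed \<omega>)\<^sup>2)
      - sphere_integral (\<lambda>\<omega>. r * normal_acceleration \<omega>)"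
  proof -
    have "continuous_on ?S (\<lambda>\<omega>. (1 / r) * divergence ?A \<omega>)" "continuous_on ?S (\<lambda>\<omega>. (1 / r\<^sup>2) * gradient_square \<omega>)"
      "continuous_on ?S (\<lambda>\<omega>. Q * (speed \<omega>)\<^sup>2)" "continuous_on ?S (\<lambda>\<omega>. r * normal_acceleration \<omega>)"
      by (intro continuous_on_mult continuous_on_const continuous_on_power c)+
    then show ?thesis by (simp only: sphere_integral_add sphere_integral_diff continuous_on_add)
  qed
  also have "\<dots> = sphere_integral gradient_square / r\<^sup>2 + Q * sphere_integral (\<lambda>p. (speed p)\<^sup>2)"
    unfolding sphere_integral_cmult
    using sphere_divergence[OF C_on_at_0(2) homogeneous0_acceleration] volume_constraint(2)[OF vol] by simp
  finally show "deriv (deriv (weighted_area r X)) 0 = K * (sphere_integral gradient_square / r\<^sup>2 +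
      ((?n / r - r)\<^sup>2 - 1 - ?n / r\<^sup>2) * sphere_integral (\<lambda>p. (speed p)\<^sup>2))"
    using weighted_area_derivatives(2) by (simp add: K_def L_def Q_def mult.assoc)
qed

end

section \<open>Stability\<close>

lemma second_variation_lower_bound:
  fixes r :: real and X :: "real \<Rightarrow> 'n::finite space \<Rightarrow> 'n space"
  assumes r: "0 < r" and X: "volume_preserving_variation r (\<lambda>p. p) X"
  shows "deriv (weighted_area r X) 0 = 0"
    and "1 \<le> (real CARD('n) / r - r)\<^sup>2 \<Longrightarrow> 0 \<le> deriv (deriv (weighted_area r X)) 0"
proof -
  obtain \<epsilon> N f where var: "normal_variation r (\<lambda>p. p) \<epsilon> X N f"
    and vol: "\<forall>s\<in>{-\<epsilon><..<\<epsilon>}. weighted_volume r X N s = weighted_volume r X N 0"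
    using X unfolding volume_preserving_variation_def by blast
  interpret sphere_variation r \<epsilon> X N f by unfold_locales (fact r, fact var)
  show "deriv (weighted_area r X) 0 = 0" by (rule second_variation(1)[OF vol])
  define q G F where "q = (real CARD('n) / r - r)\<^sup>2" and "G = sphere_integral gradient_square"
    and "F = sphere_integral (\<lambda>p. (speed p)\<^sup>2)"
  assume "1 \<le> (real CARD('n) / r - r)\<^sup>2"
  then have q: "0 \<le> q - 1" by (simp add: q_def)
  have G: "real CARD('n) * F \<le> G"
    unfolding F_def G_def
    by (rule sphere_poincare[OF C_on_speed homogeneous0_speed volume_constraint(1)[OF vol]])
  have "continuous_on (sphere 0 1) (\<lambda>p. (speed p)\<^sup>2)"
    by (intro continuous_intros continuous_on_subset[OF C_on_imp_continuous_on[OF C_on_speed]]) auto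
  then have "sphere_integral (\<lambda>p :: 'n space. 0) \<le> F"
    unfolding F_def by (intro sphere_integral_mono) auto
  then have F: "0 \<le> F" by (simp add: sphere_integral_def hemisphere_integral_def)
  have "G / r\<^sup>2 + (q - 1 - real CARD('n) / r\<^sup>2) * F = (G - real CARD('n) * F) / r\<^sup>2 + (q - 1) * F"
    using r by (simp add: field_simps)
  moreover have "0 \<le> (G - real CARD('n) * F) / r\<^sup>2 + (q - 1) * F"
    using G F q by (intro add_nonneg_nonneg divide_nonneg_nonneg mult_nonneg_nonneg) auto
  ultimately show "0 \<le> deriv (deriv (weighted_area r X)) 0"
    unfolding second_variation(2)[OF vol] q_def[symmetric] G_def[symmetric] F_def[symmetric]
    using r by (intro mult_nonneg_nonneg) auto
qed

section \<open>Instability\<close>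

subsection \<open>Boosts of the sphere\<close>

text \<open>The flow of conformal automorphisms of the unit sphere given by the Lorentz boosts along the last
  axis, acting on the projectivized light cone. The velocity of a point is the tangential part of
  the constant field \<open>(0, -1)\<close>, so a translation in the direction \<open>(0, 1)\<close> combined with this flow
  moves every point along the normal.\<close>

definition boost :: "real \<times> 'n::finite space \<Rightarrow> 'n space" where
  "boost z = inverse (cosh (fst z) - snd (snd z) * sinh (fst z)) *\<^sub>R
     (fst (snd z), snd (snd z) * cosh (fst z) - sinh (fst z))"

definition boost_domain :: "(real \<times> 'n::finite space) set" where
  "boost_domain = {z. 0 < cosh (fst z) - snd (snd z) * sinh (fst z)}"

lemma open_boost_domain: "open boost_domain"
  unfolding boost_domain_def by (intro open_Collect_less continuous_intros)

lemma sphere_in_boost_domain: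
  assumes "norm \<omega> = 1"
  shows "(s, \<omega>) \<in> boost_domain"
proof -
  have "\<bar>snd \<omega>\<bar> \<le> 1" using norm_snd_le[of "snd \<omega>" "fst \<omega>"] assms by simp
  then have "\<bar>snd \<omega> * sinh s\<bar> \<le> 1 * \<bar>sinh s\<bar>"
    unfolding abs_mult by (intro mult_right_mono) auto
  moreover have "\<bar>sinh s\<bar> < cosh s"
    using sinh_less_cosh_real[of s] sinh_less_cosh_real[of "- s"] by (simp add: abs_less_iff)
  ultimately have "snd \<omega> * sinh s < cosh s"
    using abs_ge_self[of "snd \<omega> * sinh s"] by linarith
  then show ?thesis by (simp add: boost_domain_def)
qed

lemma C_on_boost: "C_on k boost_domain boost"
  unfolding boost_def using open_boost_domain
  by (intro C_on_intros) (auto simp: boost_domain_def)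

lemma boost_0: "boost (0, x) = x"
  by (simp add: boost_def)

text \<open>A formula on a neighbourhood of the sphere, rather than on the sphere only, so that it can be
  differentiated in the ambient space to show that the position vector of the boosted sphere is
  normal to it.\<close>

lemma boost_inner:
  assumes "(s, x) \<in> boost_domain"
  shows "boost (s, x) \<bullet> boost (s, x) = 1 + (x \<bullet> x - 1) * (inverse (cosh s - snd x * sinh s))\<^sup>2"
proof -
  define D m where "D = cosh s - snd x * sinh s" and "m = snd x * cosh s - sinh s"
  have D: "D \<noteq> 0" using assms by (simp add: boost_domain_def D_def)
  have "m\<^sup>2 = D\<^sup>2 + ((snd x)\<^sup>2 - 1) * ((cosh s)\<^sup>2 - (sinh s)\<^sup>2)"
    by (simp add: m_def D_def power2_eq_square algebra_simps)
  then have m: "m\<^sup>2 = D\<^sup>2 + ((snd x)\<^sup>2 - 1)" by (simp add: cosh_square_eq)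
  have "boost (s, x) \<bullet> boost (s, x) = (inverse D)\<^sup>2 * (fst x \<bullet> fst x + m\<^sup>2)"
    by (simp add: boost_def D_def m_def inner_prod_def power2_eq_square algebra_simps)
  also have "fst x \<bullet> fst x + m\<^sup>2 = D\<^sup>2 + (x \<bullet> x - 1)"
    unfolding m by (simp add: inner_prod_def power2_eq_square)
  finally show ?thesis using D by (simp add: D_def field_simps)
qed

lemma norm_boost: "norm \<omega> = 1 \<Longrightarrow> norm (boost (s, \<omega>)) = 1"
  using boost_inner[OF sphere_in_boost_domain, of \<omega> s]
  by (simp add: dot_square_norm norm_eq_1)

lemma boost_inverse:
  assumes "(s, x) \<in> boost_domain"
  shows "(- s, boost (s, x)) \<in> boost_domain" "boost (- s, boost (s, x)) = x"
proof -
  define D m where "D = cosh s - snd x * sinh s" and "m = snd x * cosh s - sinh s"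
  have D: "0 < D" using assms by (simp add: boost_domain_def D_def)
  have b: "boost (s, x) = (inverse D *\<^sub>R fst x, inverse D * m)"
    by (simp add: boost_def D_def m_def)
  have c: "cosh s * cosh s = sinh s * sinh s + 1" using cosh_square_eq[of s] by (simp add: power2_eq_square)
  have "cosh s * D + m * sinh s = cosh s * cosh s - sinh s * sinh s"
    by (simp add: D_def m_def algebra_simps)
  then have "cosh s * D + m * sinh s = 1" using c by simp
  then have D': "cosh s + inverse D * m * sinh s = inverse D"
    using D by (simp add: field_simps)
  have "m * cosh s + D * sinh s = snd x * (cosh s * cosh s - sinh s * sinh s)"
    by (simp add: D_def m_def algebra_simps)
  then have m': "m * cosh s + D * sinh s = snd x" using c by simp
  have "0 < cosh s + inverse D * m * sinh s" unfolding D' using D by simp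
  then show "(- s, boost (s, x)) \<in> boost_domain"
    by (simp add: boost_domain_def b)
  show "boost (- s, boost (s, x)) = x"
    using D D' m' unfolding boost_def[of "(- s, boost (s, x))"] by (simp add: b prod_eq_iff field_simps)
qed

lemma has_vector_derivative_boost:
  assumes "(s, x) \<in> boost_domain"
  shows "((\<lambda>s. boost (s, x)) has_vector_derivative snd (boost (s, x)) *\<^sub>R boost (s, x) - (0, 1)) (at s)"
proof -
  define D m where "D = (\<lambda>s. cosh s - snd x * sinh s)" and "m = (\<lambda>s. snd x * cosh s - sinh s)"
  have D: "D s \<noteq> 0" using assms by (simp add: boost_domain_def D_def)
  have dD: "(D has_real_derivative - m s) (at s)" and dm: "(m has_real_derivative - D s) (at s)"
    unfolding D_def m_def by (auto intro!: derivative_eq_intros)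
  have di: "((\<lambda>s. inverse (D s)) has_real_derivative inverse (D s) * m s * inverse (D s)) (at s)"
    using DERIV_inverse'[OF dD D] by simp
  have dv: "((\<lambda>s. (fst x, m s)) has_vector_derivative (0, - D s)) (at s)"
    by (rule has_vector_derivative_Pair[OF has_vector_derivative_const
          dm[unfolded has_real_derivative_iff_has_vector_derivative]])
  have der: "((\<lambda>s. inverse (D s) *\<^sub>R (fst x, m s)) has_vector_derivative
      inverse (D s) *\<^sub>R (0, - D s) + (inverse (D s) * m s * inverse (D s)) *\<^sub>R (fst x, m s)) (at s)"
    by (rule has_vector_derivative_scaleR[OF di dv])
  have eq: "inverse (D s) *\<^sub>R (0, - D s) + (inverse (D s) * m s * inverse (D s)) *\<^sub>R (fst x, m s) =
      snd (boost (s, x)) *\<^sub>R boost (s, x) - (0, 1)"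
    using D by (simp add: boost_def D_def[symmetric] m_def[symmetric] prod_eq_iff)
      (simp add: D_def m_def)
  have fn: "(\<lambda>s. boost (s, x)) = (\<lambda>s. inverse (D s) *\<^sub>R (fst x, m s))"
    by (simp add: boost_def D_def m_def)
  show ?thesis by (rule ssubst[OF fn], rule der[unfolded eq])
qed

subsection \<open>Smooth dependence of sphere integrals on a parameter\<close>

lemma C_on_sphere_integral:
  fixes q :: "real \<times> 'n::finite space \<Rightarrow> real"
  assumes "\<And>k. C_on k U q" "\<And>s \<omega>. norm \<omega> = 1 \<Longrightarrow> (s, \<omega>) \<in> U"
  shows "C_on k UNIV (\<lambda>s. sphere_integral (\<lambda>\<omega>. q (s, \<omega>)))"
proof -
  have der: "((\<lambda>s. sphere_integral (\<lambda>p. q (s, p))) has_real_derivative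
      sphere_integral (\<lambda>p. dir_deriv (1, 0) q (s, p))) (at s)"
    if "C_on (Suc 0) U q" for s and q :: "real \<times> 'n space \<Rightarrow> real"
    by (rule has_real_derivative_sphere_integral[OF that, of "\<bar>s\<bar> + 1"])
      (use assms(2) in \<open>auto simp: abs_if\<close>)
  show ?thesis
    using assms(1)
  proof (induction k arbitrary: q)
    case 0
    show ?case
      using der[OF 0] by (auto intro!: continuous_at_imp_continuous_on DERIV_isCont)
  next
    case (Suc k)
    show ?case
      by (rule C_on_realI[OF open_UNIV der[OF Suc.prems] Suc.IH[OF C_on_dir_deriv[OF Suc.prems]]])
  qed
qed

subsection \<open>The destabilizing variation\<close>

lemma sphere_integral_snd: "sphere_integral (\<lambda>p :: 'n::finite space. snd p) = 0"
  using sphere_integral_reflect[of "snd :: 'n space \<Rightarrow> real"] sphere_integral_cmult[of "-1" "snd :: 'n space \<Rightarrow> real"]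
  by simp

text \<open>The spheres with centre \<open>(0, a s)\<close> and radius \<open>\<rho> s\<close>, parametrized by the boosts, move along their
  normals if \<open>a' = \<rho>\<close>. The translation does not contribute to the weighted volume, since the last
  coordinate has mean zero, so the volume stays constant if \<open>\<rho> s\<close> is inversely proportional to the
  mean of \<open>boost (s, \<omega>) \<bullet> \<omega>\<close>.\<close>

lemma boost_variation_exists:
  fixes r :: real
  assumes r: "0 < r"
  obtains \<epsilon> \<rho> \<rho>' a where "0 < \<epsilon>" "a 0 = 0" "\<rho> 0 = r"
    "\<And>k. C_on k {-\<epsilon><..<\<epsilon>} a" "\<And>k. C_on k {-\<epsilon><..<\<epsilon>} \<rho>"
    "\<And>s. s \<in> {-\<epsilon><..<\<epsilon>} \<Longrightarrow> 0 < \<rho> s"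
    "\<And>s. s \<in> {-\<epsilon><..<\<epsilon>} \<Longrightarrow> (a has_real_derivative \<rho> s) (at s)"
    "\<And>s. s \<in> {-\<epsilon><..<\<epsilon>} \<Longrightarrow> (\<rho> has_real_derivative \<rho>' s) (at s)"
    "\<And>s. s \<in> {-\<epsilon><..<\<epsilon>} \<Longrightarrow> \<rho> s * sphere_integral (\<lambda>\<omega> :: 'n::finite space. boost (s, \<omega>) \<bullet> \<omega>)
      = r * sphere_integral (\<lambda>\<omega> :: 'n space. 1)"
proof -
  define G where "G s = sphere_integral (\<lambda>\<omega> :: 'n space. boost (s, \<omega>) \<bullet> \<omega>)" for s
  define I1 where "I1 = sphere_integral (\<lambda>\<omega> :: 'n space. 1)"
  have I1: "0 < I1" unfolding I1_def by (rule sphere_integral_1_pos)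
  have CG: "C_on k UNIV G" for k
  proof -
    have "C_on k boost_domain (\<lambda>z :: real \<times> 'n space. boost z \<bullet> snd z)" for k
      using open_boost_domain by (intro C_on_intros C_on_boost)
    from C_on_sphere_integral[OF this sphere_in_boost_domain]
    show ?thesis unfolding G_def by simp
  qed
  have G0: "G 0 = I1"
    unfolding G_def I1_def by (rule sphere_integral_cong) (simp add: boost_0 dot_square_norm)
  have "open (G -` {0<..})"
    by (intro open_vimage C_on_imp_continuous_on[OF CG[of 0]]) simp
  moreover have "0 \<in> G -` {0<..}" using G0 I1 by simp
  ultimately obtain e where e: "0 < e" "ball 0 e \<subseteq> G -` {0<..}"
    using openE by blast
  define \<epsilon> where "\<epsilon> = e / 2"
  have eps: "0 < \<epsilon>" using e by (simp add: \<epsilon>_def)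
  have Gpos: "0 < G s" if "s \<in> {-\<epsilon>..\<epsilon>}" for s
  proof -
    have "s \<in> ball 0 e" using that e(1) by (auto simp: \<epsilon>_def dist_real_def)
    then show ?thesis using e(2) by auto
  qed
  define \<rho> where "\<rho> s = r * I1 * inverse (G s)" for s
  have C\<rho>: "C_on k {-\<epsilon><..<\<epsilon>} \<rho>" for k
    unfolding \<rho>_def using Gpos
    by (intro C_on_intros C_on_subset[OF CG]) (auto simp: less_imp_neq[symmetric])
  have "continuous_on {-\<epsilon>..\<epsilon>} \<rho>"
    unfolding \<rho>_def using Gpos
    by (intro continuous_intros continuous_on_subset[OF C_on_imp_continuous_on[OF CG[of 0]]]) (auto simp: less_imp_neq[symmetric])
  then obtain g where g: "\<And>s. s \<in> {-\<epsilon>..\<epsilon>} \<Longrightarrow> (g has_vector_derivative \<rho> s) (at s within {-\<epsilon>..\<epsilon>})"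
    using antiderivative_continuous by blast
  define a where "a s = g s - g 0" for s
  have da: "(a has_real_derivative \<rho> s) (at s)" if "s \<in> {-\<epsilon><..<\<epsilon>}" for s
  proof -
    have "(g has_real_derivative \<rho> s) (at s)"
      using g[of s] that by (simp add: at_within_Icc_at has_real_derivative_iff_has_vector_derivative)
    from DERIV_diff[OF this DERIV_const] show ?thesis unfolding a_def by simp
  qed
  have Ca: "C_on k {-\<epsilon><..<\<epsilon>} a" for k
    using C_on_SucD[OF C_on_realI[OF open_greaterThanLessThan da C\<rho>]] .
  have d\<rho>: "(\<rho> has_real_derivative dir_deriv 1 \<rho> s) (at s)" if "s \<in> {-\<epsilon><..<\<epsilon>}" for s
    using has_real_derivative_along_line[OF C\<rho>, of 0 s 1] that by simp
  show ?thesis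
  proof (rule that[of \<epsilon> a \<rho> "\<lambda>s. dir_deriv 1 \<rho> s", OF eps _ _ Ca C\<rho> _ da d\<rho>])
    show "a 0 = 0" by (simp add: a_def)
    show "\<rho> 0 = r" using I1 by (simp add: \<rho>_def G0)
    show "0 < \<rho> s" if "s \<in> {-\<epsilon><..<\<epsilon>}" for s
      using Gpos[of s] that r I1 by (simp add: \<rho>_def)
    show "\<rho> s * sphere_integral (\<lambda>\<omega> :: 'n space. boost (s, \<omega>) \<bullet> \<omega>) = r * sphere_integral (\<lambda>\<omega> :: 'n space. 1)"
      if "s \<in> {-\<epsilon><..<\<epsilon>}" for s
      using Gpos[of s] that by (simp add: \<rho>_def G_def[symmetric] I1_def[symmetric])
  qed
qed

text \<open>The volume constraint forces \<open>\<rho>' 0 = 0\<close>, so the initial speed is \<open>r\<close> times the last coordinate. For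
  this linear function the Poincare inequality is an equality, and the second variation is a
  positive multiple of \<open>(n / r - r)^2 - 1\<close>.\<close>

lemma unstable_variation_exists:
  fixes r :: real
  assumes r: "0 < r" and q: "(real CARD('n::finite) / r - r)\<^sup>2 < 1"
  shows "\<exists>X. volume_preserving_variation r (\<lambda>p :: 'n space. p) X \<and> deriv (deriv (weighted_area r X)) 0 < 0"
proof -
  obtain \<epsilon> \<rho> \<rho>' a where eps: "0 < \<epsilon>" and init: "a 0 = 0" "\<rho> 0 = r"
    and smooth: "\<And>k. C_on k {-\<epsilon><..<\<epsilon>} a" "\<And>k. C_on k {-\<epsilon><..<\<epsilon>} \<rho>"
    and pos: "\<And>s. s \<in> {-\<epsilon><..<\<epsilon>} \<Longrightarrow> 0 < \<rho> s"
    and da: "\<And>s. s \<in> {-\<epsilon><..<\<epsilon>} \<Longrightarrow> (a has_real_derivative \<rho> s) (at s)"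
    and d\<rho>: "\<And>s. s \<in> {-\<epsilon><..<\<epsilon>} \<Longrightarrow> (\<rho> has_real_derivative \<rho>' s) (at s)"
    and vol: "\<And>s. s \<in> {-\<epsilon><..<\<epsilon>} \<Longrightarrow> \<rho> s * sphere_integral (\<lambda>\<omega> :: 'n space. boost (s, \<omega>) \<bullet> \<omega>)
      = r * sphere_integral (\<lambda>\<omega> :: 'n space. 1)"
    by (rule boost_variation_exists[OF r], rule that)
  define N where "N s p = boost (s, inverse r *\<^sub>R p)" for s and p :: "'n space"
  define X where "X s p = (0, a s) + \<rho> s *\<^sub>R N s p" for s p
  define f where "f s p = \<rho>' s + \<rho> s * snd (N s p)" for s p
  let ?I = "{-\<epsilon><..<\<epsilon>}" and ?S = "sphere (0 :: 'n space) r"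
  have unit: "norm (inverse r *\<^sub>R p) = 1" if "p \<in> ?S" for p using that r by simp
  note dom = sphere_in_boost_domain[OF unit]
  define U where "U = {z :: real \<times> 'n space. (fst z, inverse r *\<^sub>R snd z) \<in> boost_domain} \<inter> (?I \<times> UNIV)"
  have oU: "open U"
  proof -
    have "open ((\<lambda>z :: real \<times> 'n space. (fst z, inverse r *\<^sub>R snd z)) -` boost_domain)"
      by (intro open_vimage open_boost_domain continuous_intros)
    then show ?thesis unfolding U_def vimage_def by (intro open_Int open_Times) auto
  qed
  have memU: "(s, p) \<in> U" if "s \<in> ?I" "p \<in> ?S" for s p using that dom[of p s] by (simp add: U_def)
  have CN: "C_on k U (\<lambda>z. N (fst z) (snd z))" for k
    unfolding N_def
    by (rule C_on_compose[OF oU open_boost_domain _ C_on_boost])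
      (use oU in \<open>auto simp: U_def intro!: C_on_intros\<close>)
  have CX: "C_on k U (\<lambda>z. X (fst z) (snd z))" for k
  proof -
    have fst_I: "fst ` U \<subseteq> ?I" by (auto simp: U_def)
    have "C_on k U (\<lambda>z. a (fst z))" "C_on k U (\<lambda>z. \<rho> (fst z))"
      by (rule C_on_compose[OF oU open_greaterThanLessThan C_on_fst[OF oU C_on_ident[OF oU]] _ fst_I];
          rule smooth)+
    then show ?thesis unfolding X_def using oU by (intro C_on_intros CN)
  qed
  have Xslice: "C_on k {p. (s, p) \<in> U} (X s)" "open {p. (s, p) \<in> U}" for k s
  proof -
    show o: "open {p. (s, p) \<in> U}"
      using open_vimage[OF oU, of "\<lambda>p. (s, p)"] by (simp add: vimage_def continuous_intros)
    have "C_on k {p. (s, p) \<in> U} (\<lambda>p. (s, p))" using o by (intro C_on_intros)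
    from C_on_compose[OF o oU this CX] show "C_on k {p. (s, p) \<in> U} (X s)" by auto
  qed
  have diff: "\<exists>A. (\<forall>v\<in>tangent_space p. differential r (X s) p v = \<rho> s *\<^sub>R A (inverse r *\<^sub>R v)) \<and>
      ((\<lambda>x. boost (s, x)) has_derivative A) (at (inverse r *\<^sub>R p))" if s: "s \<in> ?I" and p: "p \<in> ?S" for s p
  proof -
    define A where "A v = dir_deriv (0, v) boost (s, inverse r *\<^sub>R p)" for v
    have "((\<lambda>x. (s, x)) has_derivative (\<lambda>v. (0, v))) (at (inverse r *\<^sub>R p))"
      by (auto intro!: derivative_eq_intros)
    from has_derivative_compose[OF this C_on_imp_differentiable[OF C_on_boost dom[OF p]]]
    have A: "((\<lambda>x. boost (s, x)) has_derivative A) (at (inverse r *\<^sub>R p))" by (simp add: A_def[abs_def])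
    have "((\<lambda>p. inverse r *\<^sub>R p) has_derivative (\<lambda>v. inverse r *\<^sub>R v)) (at p)"
      by (auto intro!: derivative_eq_intros)
    from has_derivative_add[OF has_derivative_const[of "(0, a s)"]
        has_derivative_scaleR_right[OF has_derivative_compose[OF this A], of "\<rho> s"]]
    have "(X s has_derivative (\<lambda>v. \<rho> s *\<^sub>R A (inverse r *\<^sub>R v))) (at p)"
      unfolding X_def N_def by simp
    from differential_eq[OF r p this] A show ?thesis by blast
  qed
  have immersion: "immersion r (X s)" if s: "s \<in> ?I" for s
    unfolding immersion_def
  proof (intro conjI ballI)
    show "smooth_on ?S (X s)"
      unfolding smooth_on_def
    proof
      fix p assume "p \<in> ?S"
      then show "\<exists>V g. open V \<and> p \<in> V \<and> (\<forall>k. C_on k V g) \<and> (\<forall>y\<in>V \<inter> ?S. g y = X s y)"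
        using Xslice memU[OF s] by (intro exI[of _ "{p. (s, p) \<in> U}"] exI[of _ "X s"]) auto
    qed
    fix p assume p: "p \<in> ?S"
    let ?\<omega> = "inverse r *\<^sub>R p"
    obtain A where A: "\<forall>v\<in>tangent_space p. differential r (X s) p v = \<rho> s *\<^sub>R A (inverse r *\<^sub>R v)"
      "((\<lambda>x. boost (s, x)) has_derivative A) (at ?\<omega>)" using diff[OF s p] by blast
    have "((\<lambda>x. (- s, x)) has_derivative (\<lambda>v. (0, v))) (at (boost (s, ?\<omega>)))"
      by (auto intro!: derivative_eq_intros)
    from has_derivative_compose[OF this C_on_imp_differentiable[OF C_on_boost boost_inverse(1)[OF dom[OF p]]]]
    have "((\<lambda>x. boost (- s, x)) has_derivative (\<lambda>v. dir_deriv (0, v) boost (- s, boost (s, ?\<omega>)))) (at (boost (s, ?\<omega>)))" .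
    from has_derivative_compose[OF A(2) this]
    have "((\<lambda>x. boost (- s, boost (s, x))) has_derivative (\<lambda>v. dir_deriv (0, A v) boost (- s, boost (s, ?\<omega>)))) (at ?\<omega>)" .
    then have "((\<lambda>x. x) has_derivative (\<lambda>v. dir_deriv (0, A v) boost (- s, boost (s, ?\<omega>)))) (at ?\<omega>)"
    proof (rule has_derivative_transform_within_open)
      show "open ((\<lambda>x :: 'n space. (s, x)) -` boost_domain)"
        by (intro open_vimage open_boost_domain continuous_intros)
      show "?\<omega> \<in> (\<lambda>x. (s, x)) -` boost_domain" using dom[OF p] by simp
      show "boost (- s, boost (s, x)) = x" if "x \<in> (\<lambda>x. (s, x)) -` boost_domain" for x
        using that by (intro boost_inverse(2)) simp
    qed
    from has_derivative_unique[OF this has_derivative_ident]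
    \<comment> \<open>The boost by \<open>- s\<close> is inverse to the boost by \<open>s\<close>, so the differential is injective.\<close>
    have left_inv: "dir_deriv (0, A v) boost (- s, boost (s, ?\<omega>)) = v" for v by (rule fun_cong)
    show "inj_on (differential r (X s) p) (tangent_space p)"
    proof (rule inj_onI)
      fix v w assume vw: "v \<in> tangent_space p" "w \<in> tangent_space p"
        "differential r (X s) p v = differential r (X s) p w"
      then have "A (inverse r *\<^sub>R v) = A (inverse r *\<^sub>R w)" using A(1) pos[OF s] by simp
      then have "inverse r *\<^sub>R v = inverse r *\<^sub>R w" using left_inv by metis
      then show "v = w" using r by simp
    qed
  qed
  have normal: "unit_normal r (X s) (N s)" if s: "s \<in> ?I" for s
    unfolding unit_normal_def
  proof (intro conjI ballI)
    show "continuous_on ?S (N s)"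
      by (rule continuous_on_compose2[OF C_on_imp_continuous_on[OF CN[of 0]], of ?S "\<lambda>p. (s, p)", simplified])
        (use memU[OF s] in \<open>auto intro!: continuous_intros\<close>)
    fix p assume p: "p \<in> ?S"
    let ?\<omega> = "inverse r *\<^sub>R p"
    show "norm (N s p) = 1" unfolding N_def by (rule norm_boost[OF unit[OF p]])
    fix v assume v: "v \<in> tangent_space p"
    obtain A where A: "\<forall>v\<in>tangent_space p. differential r (X s) p v = \<rho> s *\<^sub>R A (inverse r *\<^sub>R v)"
      "((\<lambda>x. boost (s, x)) has_derivative A) (at ?\<omega>)" using diff[OF s p] by blast
    \<comment> \<open>The squared norm of the boosted point is \<open>1 + (|x|^2 - 1) h x\<close>, whose derivative at the unit sphere
      vanishes in tangential directions.\<close>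
    define h where "h x = (inverse (cosh s - snd x * sinh s))\<^sup>2" for x :: "'n space"
    have "h differentiable at ?\<omega>"
      unfolding h_def using dom[OF p, of s]
      by (intro differentiable_power differentiable_inverse differentiable_diff differentiable_const
          differentiable_mult linear_imp_differentiable) (auto simp: boost_domain_def linear_snd)
    then obtain h' where h': "(h has_derivative h') (at ?\<omega>)" by (auto simp: differentiable_def)
    have "?\<omega> \<bullet> ?\<omega> = 1" using unit[OF p] by (simp only: dot_square_norm) simp
    moreover have "((\<lambda>x. x \<bullet> x - 1) has_derivative (\<lambda>w. ?\<omega> \<bullet> w + w \<bullet> ?\<omega> - 0)) (at ?\<omega>)"
      by (intro has_derivative_diff has_derivative_inner has_derivative_ident has_derivative_const)
    ultimately have 1: "((\<lambda>x. 1 + (x \<bullet> x - 1) * h x) has_derivative (\<lambda>w. (2 * (w \<bullet> ?\<omega>)) * h ?\<omega>)) (at ?\<omega>)"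
      using has_derivative_add[OF has_derivative_const has_derivative_mult[OF _ h']]
      by (fastforce simp: inner_commute)
    have "((\<lambda>x. boost (s, x) \<bullet> boost (s, x)) has_derivative
        (\<lambda>w. boost (s, ?\<omega>) \<bullet> A w + A w \<bullet> boost (s, ?\<omega>))) (at ?\<omega>)"
      by (rule has_derivative_inner[OF A(2) A(2)])
    then have "((\<lambda>x. 1 + (x \<bullet> x - 1) * h x) has_derivative
        (\<lambda>w. boost (s, ?\<omega>) \<bullet> A w + A w \<bullet> boost (s, ?\<omega>))) (at ?\<omega>)"
    proof (rule has_derivative_transform_within_open)
      show "open ((\<lambda>x :: 'n space. (s, x)) -` boost_domain)"
        by (intro open_vimage open_boost_domain continuous_intros)
      show "?\<omega> \<in> (\<lambda>x. (s, x)) -` boost_domain" using dom[OF p] by simp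
      show "boost (s, x) \<bullet> boost (s, x) = 1 + (x \<bullet> x - 1) * h x" if "x \<in> (\<lambda>x. (s, x)) -` boost_domain" for x
        unfolding h_def using that by (intro boost_inner) simp
    qed
    from fun_cong[OF has_derivative_unique[OF this 1], of "inverse r *\<^sub>R v"]
    have "boost (s, ?\<omega>) \<bullet> A (inverse r *\<^sub>R v) = 0"
      using v by (simp add: tangent_space_def inner_commute)
    then show "N s p \<bullet> differential r (X s) p v = 0"
      using A(1) v by (simp add: N_def)
  qed
  have deriv: "((\<lambda>s. X s p) has_vector_derivative f s p *\<^sub>R N s p) (at s)" if s: "s \<in> ?I" and p: "p \<in> ?S" for s p
  proof -
    have "((\<lambda>s. \<rho> s *\<^sub>R N s p) has_vector_derivative
        \<rho> s *\<^sub>R (snd (N s p) *\<^sub>R N s p - (0, 1)) + \<rho>' s *\<^sub>R N s p) (at s)"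
      unfolding N_def
      by (rule has_vector_derivative_scaleR[OF d\<rho>[OF s] has_vector_derivative_boost[OF dom[OF p]]])
    moreover have "((\<lambda>s. (0 :: real ^ 'n, a s)) has_vector_derivative (0, \<rho> s)) (at s)"
      by (intro has_vector_derivative_Pair has_vector_derivative_const
          da[OF s, unfolded has_real_derivative_iff_has_vector_derivative])
    ultimately have "((\<lambda>s. X s p) has_vector_derivative
        (0, \<rho> s) + (\<rho> s *\<^sub>R (snd (N s p) *\<^sub>R N s p - (0, 1)) + \<rho>' s *\<^sub>R N s p)) (at s)"
      unfolding X_def by (intro has_vector_derivative_add)
    moreover have "(0, \<rho> s) + (\<rho> s *\<^sub>R (snd (N s p) *\<^sub>R N s p - (0, 1)) + \<rho>' s *\<^sub>R N s p) = f s p *\<^sub>R N s p"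
      by (simp add: f_def prod_eq_iff algebra_simps)
    ultimately show ?thesis by simp
  qed
  have X0: "X 0 p = p" for p
    using r by (simp add: X_def N_def boost_0 init flip: zero_prod_def)
  have var: "normal_variation r (\<lambda>p. p) \<epsilon> X N f"
    unfolding normal_variation_def
  proof (intro conjI ballI)
    show "smooth_on (?I \<times> ?S) (\<lambda>(s, p). X s p)"
      unfolding smooth_on_def
    proof
      fix z assume "z \<in> ?I \<times> ?S"
      then show "\<exists>V g. open V \<and> z \<in> V \<and> (\<forall>k. C_on k V g) \<and> (\<forall>y\<in>V \<inter> (?I \<times> ?S). g y = (\<lambda>(s, p). X s p) y)"
        using oU CX memU by (intro exI[of _ U] exI[of _ "\<lambda>z. X (fst z) (snd z)"]) auto
    qed
    show "continuous_on (?I \<times> ?S) (\<lambda>(s, p). N s p)"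
      unfolding case_prod_unfold
      by (rule continuous_on_subset[OF C_on_imp_continuous_on[OF CN[of 0]]]) (use memU in auto)
  qed (simp_all add: eps immersion normal X0 deriv)
  interpret sphere_variation r \<epsilon> X N f by unfold_locales (fact r, fact var)
  have constraint: "\<forall>s\<in>?I. weighted_volume r X N s = weighted_volume r X N 0"
  proof -
    obtain c where c: "\<And>s. s \<in> ?I \<Longrightarrow> weighted_volume r X N s = c * sphere_integral (\<lambda>\<omega>. ext (s, \<omega>) \<bullet> \<omega>)"
      using weighted_volume_eq by blast
    have "sphere_integral (\<lambda>\<omega>. ext (s, \<omega>) \<bullet> \<omega>) = r * sphere_integral (\<lambda>\<omega> :: 'n space. 1)" if s: "s \<in> ?I" for s
    proof -
      have cb: "continuous_on (sphere 0 1) (\<lambda>\<omega> :: 'n space. boost (s, \<omega>) \<bullet> \<omega>)"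
        by (intro continuous_intros continuous_on_compose2[OF C_on_imp_continuous_on[OF C_on_boost]])
          (auto simp: sphere_in_boost_domain)
      have "sphere_integral (\<lambda>\<omega>. ext (s, \<omega>) \<bullet> \<omega>) =
          sphere_integral (\<lambda>\<omega> :: 'n space. a s * snd \<omega> + \<rho> s * (boost (s, \<omega>) \<bullet> \<omega>))"
      proof (rule sphere_integral_cong)
        fix \<omega> :: "'n space" assume "norm \<omega> = 1"
        then show "ext (s, \<omega>) \<bullet> \<omega> = a s * snd \<omega> + \<rho> s * (boost (s, \<omega>) \<bullet> \<omega>)"
          using r by (simp add: ext_unit X_def N_def inner_add_left) (simp add: inner_prod_def)
      qed
      also have "\<dots> = a s * sphere_integral (\<lambda>\<omega> :: 'n space. snd \<omega>) + \<rho> s * sphere_integral (\<lambda>\<omega> :: 'n space. boost (s, \<omega>) \<bullet> \<omega>)"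
        unfolding sphere_integral_cmult[symmetric]
        by (intro sphere_integral_add continuous_intros cb)
      finally show ?thesis using vol[OF s] by (simp add: sphere_integral_snd)
    qed
    then show ?thesis using c zero_mem by simp
  qed
  have preserving: "volume_preserving_variation r (\<lambda>p. p) X"
    unfolding volume_preserving_variation_def using var constraint by blast
  define Z where "Z = sphere_integral (\<lambda>p :: 'n space. (snd p)\<^sup>2)"
  let ?n = "real CARD('n)"
  have cs: "continuous_on (sphere 0 1) (snd :: 'n space \<Rightarrow> real)" by (intro continuous_intros)
  have Z: "(?n + 1) * Z = sphere_integral (\<lambda>p :: 'n space. 1)"
    using sphere_integral_inner_square[of "(0 :: real ^ 'n, 1)"] by (simp add: Z_def inner_prod_def)
  have speed_unit: "speed \<omega> = \<rho>' 0 + r * snd \<omega>" if \<omega>: "norm \<omega> = 1" for \<omega>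
  proof -
    have w: "\<omega> \<noteq> 0" "sgn \<omega> = \<omega>" using \<omega> by (auto simp: sgn_div_norm)
    have "N 0 (r *\<^sub>R \<omega>) = \<omega>" using r by (simp add: N_def boost_0)
    then show ?thesis
      using velocity_eq[OF zero_mem w(1)] w \<omega> by (simp add: speed_def f_def init dot_square_norm)
  qed
  have "sphere_integral speed = sphere_integral (\<lambda>p :: 'n space. \<rho>' 0 * 1 + r * snd p)"
    by (rule sphere_integral_cong) (simp add: speed_unit)
  also have "\<dots> = \<rho>' 0 * sphere_integral (\<lambda>p :: 'n space. 1) + r * sphere_integral (\<lambda>p :: 'n space. snd p)"
    unfolding sphere_integral_cmult[symmetric] by (intro sphere_integral_add continuous_intros)
  finally have "\<rho>' 0 = 0"
    using volume_constraint(1)[OF constraint] sphere_integral_1_pos[where 'n = 'n]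
    by (simp add: sphere_integral_snd)
  then have speed_eq: "speed x = r * snd (sgn x)" if "x \<noteq> 0" for x
    using speed_unit[of "sgn x"] homogeneous0D[OF homogeneous0_speed that] that by (simp add: norm_sgn)
  have gradient: "gradient_square \<omega> = r\<^sup>2 * (1 - (snd \<omega>)\<^sup>2)" if \<omega>: "norm \<omega> = 1" for \<omega>
  proof -
    have w: "\<omega> \<noteq> 0" "sgn \<omega> = \<omega>" using \<omega> by (auto simp: sgn_div_norm)
    define L where "L = (0, 1) - snd \<omega> *\<^sub>R \<omega>"
    have "dir_deriv b speed \<omega> = r * (L \<bullet> b)" for b
    proof -
      have "dir_deriv b speed \<omega> = dir_deriv b (\<lambda>x. r * snd (sgn x)) \<omega>"
        by (subst frechet_derivative_cong_open[of "- {0}" \<omega> _ "\<lambda>x. r * snd (sgn x)"])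
          (use w(1) speed_eq in \<open>auto simp: open_Compl\<close>)
      also have "\<dots> = r * snd (inverse (norm \<omega>) *\<^sub>R (b - (sgn \<omega> \<bullet> b) *\<^sub>R sgn \<omega>))"
        using frechet_derivative_at[OF has_derivative_mult_right[OF has_derivative_snd[OF has_derivative_sgn[OF w(1)]]], symmetric]
        by metis
      also have "\<dots> = r * (L \<bullet> b)"
        using w \<omega> by (simp add: L_def inner_diff_left) (simp add: inner_prod_def)
      finally show ?thesis .
    qed
    then have "gradient_square \<omega> = r\<^sup>2 * (\<Sum>b\<in>Basis. (L \<bullet> b) * (L \<bullet> b))"
      by (simp add: sum_distrib_left power2_eq_square ac_simps)
    also have "(\<Sum>b\<in>Basis. (L \<bullet> b) * (L \<bullet> b)) = L \<bullet> L" by (rule euclidean_inner[symmetric])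
    also have "L \<bullet> L = 1 - (snd \<omega>)\<^sup>2"
    proof -
      have "\<omega> \<bullet> \<omega> = 1" using \<omega> by (simp add: dot_square_norm)
      moreover have "(0, 1) \<bullet> \<omega> = snd \<omega>" "(0 :: real ^ 'n, 1 :: real) \<bullet> (0, 1) = 1" by (simp_all add: inner_prod_def)
      ultimately show ?thesis
        unfolding L_def by (simp add: inner_diff_left inner_diff_right inner_commute power2_eq_square)
    qed
    finally show ?thesis .
  qed
  have "sphere_integral gradient_square = sphere_integral (\<lambda>p :: 'n space. r\<^sup>2 * (1 - (snd p)\<^sup>2))"
    by (rule sphere_integral_cong) (simp add: gradient)
  also have "\<dots> = r\<^sup>2 * (sphere_integral (\<lambda>p :: 'n space. 1) - Z)"
    unfolding sphere_integral_cmult Z_def by (subst sphere_integral_diff) (auto intro!: continuous_intros)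
  finally have grad: "sphere_integral gradient_square = r\<^sup>2 * (?n * Z)"
    unfolding Z[symmetric] by (simp add: algebra_simps)
  have "sphere_integral (\<lambda>p. (speed p)\<^sup>2) = sphere_integral (\<lambda>p :: 'n space. r\<^sup>2 * (snd p)\<^sup>2)"
    by (rule sphere_integral_cong) (simp add: speed_unit \<open>\<rho>' 0 = 0\<close> power_mult_distrib)
  then have square: "sphere_integral (\<lambda>p. (speed p)\<^sup>2) = r\<^sup>2 * Z"
    by (simp add: sphere_integral_cmult Z_def)
  have "0 < (?n + 1) * Z" unfolding Z by (rule sphere_integral_1_pos)
  then have Zpos: "0 < Z" by (simp add: zero_less_mult_iff)
  have "r\<^sup>2 * (?n * Z) / r\<^sup>2 + ((?n / r - r)\<^sup>2 - 1 - ?n / r\<^sup>2) * (r\<^sup>2 * Z) = ((?n / r - r)\<^sup>2 - 1) * (r\<^sup>2 * Z)"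
    using r by (simp add: left_diff_distrib)
  also have "\<dots> < 0" using q r Zpos by (intro mult_neg_pos) auto
  finally have "deriv (deriv (weighted_area r X)) 0 < 0"
    unfolding second_variation(2)[OF constraint] grad square using r by (intro mult_pos_neg) auto
  with preserving show ?thesis by blast
qed

section \<open>The stability threshold\<close>

lemma threshold_iff:
  fixes r n :: real
  assumes r: "0 < r" and n: "0 \<le> n"
  shows "1 \<le> (n / r - r)\<^sup>2 \<longleftrightarrow> r \<le> (- 1 + sqrt (1 + 4 * n)) / 2 \<or> (1 + sqrt (1 + 4 * n)) / 2 \<le> r"
proof -
  let ?q = "sqrt (1 + 4 * n)"
  have q2: "?q\<^sup>2 = 1 + 4 * n" and q0: "0 \<le> ?q" and q1: "1 \<le> ?q" using n by auto
  have plus: "(2 * r + 1)\<^sup>2 = 4 * (r + r\<^sup>2) + 1" and minus: "(2 * r - 1)\<^sup>2 = 4 * (r\<^sup>2 - r) + 1"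
    by (simp_all add: power2_eq_square algebra_simps)
  have "1 \<le> (n / r - r)\<^sup>2 \<longleftrightarrow> 1 \<le> \<bar>n / r - r\<bar>"
    using abs_le_square_iff[of 1 "n / r - r"] by simp
  also have "\<dots> \<longleftrightarrow> r + r\<^sup>2 \<le> n \<or> n + r \<le> r\<^sup>2"
    using r by (auto simp: abs_if field_simps power2_eq_square)
  also have "r + r\<^sup>2 \<le> n \<longleftrightarrow> (2 * r + 1)\<^sup>2 \<le> ?q\<^sup>2"
    unfolding q2 plus by auto
  also have "\<dots> \<longleftrightarrow> r \<le> (- 1 + ?q) / 2"
    using r q0 by (subst power_mono_iff) auto
  also have "n + r \<le> r\<^sup>2 \<longleftrightarrow> ?q\<^sup>2 \<le> (2 * r - 1)\<^sup>2"
    unfolding q2 minus by auto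
  also have "\<dots> \<longleftrightarrow> ?q \<le> \<bar>2 * r - 1\<bar>"
    using abs_le_square_iff[of ?q "2 * r - 1"] q0 by simp
  also have "\<dots> \<longleftrightarrow> (1 + ?q) / 2 \<le> r"
    using r q1 by (intro iffI; unfold abs_if; simp split: if_splits del: real_sqrt_ge_1_iff)
  finally show ?thesis .
qed

theorem theorem7p2:
  fixes r :: real
  assumes "r > 0"
  shows "(r \<le> (- 1 + sqrt (1 + 4 * real CARD('n))) / 2 \<or> r \<ge> (1 + sqrt (1 + 4 * real CARD('n))) / 2
            \<longrightarrow> weakly_stable r (\<lambda>p :: (real ^ 'n::finite) \<times> real. p))
       \<and> ((- 1 + sqrt (1 + 4 * real CARD('n))) / 2 < r \<and> r < (1 + sqrt (1 + 4 * real CARD('n))) / 2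
            \<longrightarrow> weakly_unstable r (\<lambda>p :: (real ^ 'n::finite) \<times> real. p))"
proof -
  let ?X = "\<lambda>p :: 'n space. p"
  note threshold = threshold_iff[OF assms, of "real CARD('n)", OF of_nat_0_le_iff]
  have critical: "critical_point r ?X"
    unfolding critical_point_def using second_variation_lower_bound(1)[OF assms] by blast
  show ?thesis
  proof (intro conjI impI)
    assume "r \<le> (- 1 + sqrt (1 + 4 * real CARD('n))) / 2 \<or> r \<ge> (1 + sqrt (1 + 4 * real CARD('n))) / 2"
    then have "1 \<le> (real CARD('n) / r - r)\<^sup>2" unfolding threshold .
    with critical show "weakly_stable r ?X"
      unfolding weakly_stable_def using second_variation_lower_bound(2)[OF assms] by blast
  next
    assume "(- 1 + sqrt (1 + 4 * real CARD('n))) / 2 < r \<and> r < (1 + sqrt (1 + 4 * real CARD('n))) / 2"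
    then have "\<not> 1 \<le> (real CARD('n) / r - r)\<^sup>2" unfolding threshold by linarith
    then have "(real CARD('n) / r - r)\<^sup>2 < 1" by simp
    with critical show "weakly_unstable r ?X"
      unfolding weakly_unstable_def using unstable_variation_exists[OF assms] by blast
  qed
qed

end
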